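(* Let $\Delta$ be a hyperbolic ideal tetrahedron with ideal vertices numbered $0,1,2,3$ so that some orientation-preserving isometry to upper half space takes vertices $0,1,2,3$ to $0,\infty,z,1$ respectively with $\mathrm{Im}\,z>0$. Let $z_{ij}$ be the shape parameter of the edge $ij$. Choose a spin-decorated horosphere $(H_i,W_i)$ at each ideal vertex $i$, and let $\lambda_{ij}$ be the complex lambda length from $(H_i,W_i)$ to $(H_j,W_j)$. Then $$z_{01}=z_{23}=\frac{\lambda_{02}\lambda_{13}}{\lambda_{03}\lambda_{12}},\qquad z_{02}=z_{13}=-\frac{\lambda_{03}\lambda_{12}}{\lambda_{01}\lambda_{23}},\qquad z_{03}=z_{12}=\frac{\lambda_{01}\lambda_{23}}{\lambda_{02}\lambda_{13}}.$$
   Context: Shape parameters. The shape parameter of an ideal tetrahedron $\Delta$ along an edge $e$ is the complex number $z$ such that, if an orientation-preserving isometry places the two endpoints of $e$ at $0$ and $\infty$ in $\partial\mathbb{U}^3\cong\mathbb{C}\cup\{\infty\}$, and the remaining two ideal vertices at $1$ and a point with positive imaginary part, then the final vertex lies at $z$. Spin decorations. $\mathbb{H}^3$ is oriented (standard orientation in the upper half space model). A decoration on a horosphere $H$ is a tangent oriented line field invariant under all parabolic isometries fixing $H$ (equivalently a parallel unit tangent vector field $v$ on $H$). The centre of $H$ is its point at infinity. A frame is a right-handed orthonormal frame at a point of $\mathbb{H}^3$; $\mathrm{Fr}\to\mathbb{H}^3$ is the bundle of frames and $\mathrm{Fr}^S$ its double (universal) cover, whose points are spin frames. Rotations and translations of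 spin frames are obtained by lifting to $\mathrm{Fr}^S$ the corresponding paths of rotated/translated frames; rotation by $2\pi$ interchanges the two lifts of a frame. Let $N^{out}$ (resp. $N^{in}$) be the unit normal field along $H$ pointing towards (resp. away from) its centre. For a decoration $v$ on $H$, the inward and outward frame fields are $(N^{in},v,N^{in}\times v)$ and $(N^{out},v,N^{out}\times v)$. An inward (outward) spin decoration is a continuous lift of the inward (outward) frame field along $H$ to $\mathrm{Fr}^S$. A spin decoration on $H$ is a pair $W=(W^{in},W^{out})$ of an inward and an outward spin decoration lifting the frame fields of the same $v$ such that $W^{out}$ is obtained from $W^{in}$ by rotation of angle $-\pi$ about $v$ at each point (equivalently $W^{in}$ from $W^{out}$ by rotation of angle $\pi$ about $v$). A spin-decorated horosphere at an ideal vertex is one centred there. Complex lambda length. A spin frame at a point of an oriented geodesic $\gamma$ is adapted to $\gamma$ if it lifts a frame whose first vector is positively tangent to $\gamma$. The complex distance from one spin frame adapted to $\gamma$ to another is $\rho+i\theta$, where translation along $\gamma$ by signed distance $\rho$ followed by rotation about $\gamma$ by angle $\theta$ (signed by the orientation of $\gamma$ and the right-hand rule) takes the first to the second; it is well defined modulo $4\pi i$. For spin-decorated horospheres $(H_1,W_1),(H_2,W_2)$ with distinct centres $z_1,z_2$, let $\gamma_{12}$ be the oriented geodesic from $z_1$ to $z_2$ and $p_i=\gamma_{12}\cap H_i$; the complex lambda length from $(H_1,W_1)$ to $(H_2,W_2)$ is $\exp(d/2)$, where $d$ is the complex distance from $W_1^{in}(p_1)$ to $W_2^{out}(p_2)$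 along $\gamma_{12}$. *)

theory Defs
  imports "HOL-Analysis.Analysis"
begin

section \<open>The upper half space model\<close>

definition upper_half_space :: "(real^3) set"
  where "upper_half_space = {x. x $ 3 > 0}"

text \<open>Tangent vectors at a point are identified with vectors of \<open>real^3\<close>. The metric is
  \<open>(dx\<^sup>2 + dy\<^sup>2 + dt\<^sup>2) / t\<^sup>2\<close>, and the orientation is the standard one of \<open>real^3\<close>;
  the factor in \<open>hyp_cross\<close> makes the cross product of a right-handed orthonormal pair a
  unit vector for this metric.\<close>

definition hyp_inner :: "real^3 \<Rightarrow> real^3 \<Rightarrow> real^3 \<Rightarrow> real"
  where "hyp_inner x u v = (u \<bullet> v) / (x $ 3)\<^sup>2"

definition hyp_cross :: "real^3 \<Rightarrow> real^3 \<Rightarrow> real^3 \<Rightarrow> real^3"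
  where "hyp_cross x u v = (1 / x $ 3) *\<^sub>R cross3 u v"

definition hyp_dist :: "real^3 \<Rightarrow> real^3 \<Rightarrow> real"
  where "hyp_dist x y = arcosh (1 + (dist x y)\<^sup>2 / (2 * x $ 3 * y $ 3))"

text \<open>The sphere at infinity is the Riemann sphere; the filter \<open>ideal_nhds \<zeta>\<close> describes
  convergence of points of the upper half space to \<open>\<zeta>\<close>.\<close>

datatype ideal_point = Fin complex | Infty

fun ideal_nhds :: "ideal_point \<Rightarrow> (real^3) filter" where
  "ideal_nhds (Fin z) = at (vector [Re z, Im z, 0]) within upper_half_space"
| "ideal_nhds Infty = inf at_infinity (principal upper_half_space)"

text \<open>Isometries are total functions on \<open>real^3\<close> of which only the values on the upper half
  space matter.\<close>

definition hyp_isometry :: "(real^3 \<Rightarrow> real^3) \<Rightarrow> bool"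
  where "hyp_isometry \<phi> \<longleftrightarrow> bij_betw \<phi> upper_half_space upper_half_space \<and>
    (\<forall>x\<in>upper_half_space. \<forall>y\<in>upper_half_space. hyp_dist (\<phi> x) (\<phi> y) = hyp_dist x y)"

definition op_isometry :: "(real^3 \<Rightarrow> real^3) \<Rightarrow> bool"
  where "op_isometry \<phi> \<longleftrightarrow> hyp_isometry \<phi> \<and>
    (\<forall>x\<in>upper_half_space. \<phi> differentiable (at x) \<and>
       det (matrix (frechet_derivative \<phi> (at x))) > 0)"

definition ideal_maps_to :: "(real^3 \<Rightarrow> real^3) \<Rightarrow> ideal_point \<Rightarrow> ideal_point \<Rightarrow> bool"
  where "ideal_maps_to \<phi> \<zeta> \<zeta>' \<longleftrightarrow> filterlim \<phi> (ideal_nhds \<zeta>') (ideal_nhds \<zeta>)"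

definition parabolic_isometry :: "(real^3 \<Rightarrow> real^3) \<Rightarrow> bool"
  where "parabolic_isometry \<phi> \<longleftrightarrow> op_isometry \<phi> \<and>
    (\<forall>x\<in>upper_half_space. \<phi> x \<noteq> x) \<and> (\<exists>!\<zeta>. ideal_maps_to \<phi> \<zeta> \<zeta>)"

text \<open>An oriented geodesic, parametrised by signed arc length.\<close>

definition geodesic_from_to :: "(real \<Rightarrow> real^3) \<Rightarrow> ideal_point \<Rightarrow> ideal_point \<Rightarrow> bool"
  where "geodesic_from_to \<gamma> \<zeta>1 \<zeta>2 \<longleftrightarrow>
    (\<forall>s. \<gamma> s \<in> upper_half_space) \<and> (\<forall>s t. hyp_dist (\<gamma> s) (\<gamma> t) = \<bar>s - t\<bar>) \<and>
    filterlim \<gamma> (ideal_nhds \<zeta>1) at_bot \<and> filterlim \<gamma> (ideal_nhds \<zeta>2) at_top"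

text \<open>Vanishing covariant derivative along \<open>\<gamma>\<close>: for the metric above, the Levi-Civita
  connection is
  \<open>\<nabla>\<^sub>X Y = D\<^sub>X Y - (X\<^sub>3 / t) Y - (Y\<^sub>3 / t) X + (X \<bullet> Y / t) e\<^sub>3\<close>.\<close>

definition parallel_along :: "(real \<Rightarrow> real^3) \<Rightarrow> (real \<Rightarrow> real^3) \<Rightarrow> bool"
  where "parallel_along \<gamma> V \<longleftrightarrow>
    (\<forall>s. let X = vector_derivative \<gamma> (at s) in
       (V has_vector_derivative
          (1 / \<gamma> s $ 3) *\<^sub>R (X $ 3 *\<^sub>R V s + V s $ 3 *\<^sub>R X - (X \<bullet> V s) *\<^sub>R axis 3 1)) (at s))"


section \<open>Shape parameters\<close>

text \<open>An ideal tetrahedron is given by its set \<open>\<Delta>\<close> of four ideal vertices, an edge by the set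
  \<open>e\<close> of its two endpoints. Either endpoint may be the one sent to \<open>0\<close>, and either of the
  remaining vertices the one sent to \<open>1\<close>.\<close>

definition shape_parameter :: "ideal_point set \<Rightarrow> ideal_point set \<Rightarrow> complex"
  where "shape_parameter \<Delta> e = (THE z. Im z > 0 \<and>
    (\<exists>\<phi> a b c d. op_isometry \<phi> \<and> e = {a, b} \<and> \<Delta> - e = {c, d} \<and>
       ideal_maps_to \<phi> a (Fin 0) \<and> ideal_maps_to \<phi> b Infty \<and>
       ideal_maps_to \<phi> c (Fin 1) \<and> ideal_maps_to \<phi> d (Fin z)))"


section \<open>Horospheres and decorations\<close>

text \<open>The logarithm of \<open>horo_level \<zeta>\<close> is, up to sign, a Busemann function at \<open>\<zeta>\<close>: the level sets
  are the horizontal planes if \<open>\<zeta> = Infty\<close>, and the Euclidean spheres tangent to the complex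
  plane at \<open>z\<close> (without \<open>z\<close>) if \<open>\<zeta> = Fin z\<close>. It increases towards \<open>\<zeta>\<close>.\<close>

fun horo_level :: "ideal_point \<Rightarrow> real^3 \<Rightarrow> real" where
  "horo_level (Fin z) x = x $ 3 / (dist x (vector [Re z, Im z, 0]))\<^sup>2"
| "horo_level Infty x = x $ 3"

definition horosphere :: "ideal_point \<Rightarrow> (real^3) set \<Rightarrow> bool"
  where "horosphere \<zeta> H \<longleftrightarrow> (\<exists>c>0. H = {x \<in> upper_half_space. horo_level \<zeta> x = c})"

text \<open>The unit normal at \<open>x\<close>, pointing towards the centre, of the horosphere through \<open>x\<close> centred
  at \<open>\<zeta>\<close>: the unit vector that is a positive multiple of the gradient of \<open>horo_level \<zeta>\<close>.\<close>

definition normal_out :: "ideal_point \<Rightarrow> real^3 \<Rightarrow> real^3"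
  where "normal_out \<zeta> x = (THE N. hyp_inner x N N = 1 \<and>
    (\<exists>k>0. (horo_level \<zeta> has_derivative (\<lambda>u. k * hyp_inner x N u)) (at x)))"

definition normal_in :: "ideal_point \<Rightarrow> real^3 \<Rightarrow> real^3"
  where "normal_in \<zeta> x = - normal_out \<zeta> x"

text \<open>The oriented line field is represented by its unit vector field.\<close>

definition decoration :: "ideal_point \<Rightarrow> (real^3) set \<Rightarrow> (real^3 \<Rightarrow> real^3) \<Rightarrow> bool"
  where "decoration \<zeta> H v \<longleftrightarrow>
    (\<forall>x\<in>H. hyp_inner x (v x) (v x) = 1 \<and> hyp_inner x (normal_out \<zeta> x) (v x) = 0) \<and>
    (\<forall>\<phi>. parabolic_isometry \<phi> \<and> \<phi> ` H = H \<longrightarrow>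
       (\<forall>x\<in>H. frechet_derivative \<phi> (at x) (v x) = v (\<phi> x)))"


section \<open>Frames and spin frames\<close>

text \<open>The frame \<open>(x, f1, f2, f3)\<close> is based at \<open>x\<close>.\<close>

type_synonym frame = "(real^3) \<times> (real^3) \<times> (real^3) \<times> (real^3)"

definition frames :: "frame set"
  where "frames = {(x, f1, f2, f3). x \<in> upper_half_space \<and>
    hyp_inner x f1 f1 = 1 \<and> hyp_inner x f2 f2 = 1 \<and> hyp_inner x f3 f3 = 1 \<and>
    hyp_inner x f1 f2 = 0 \<and> hyp_inner x f1 f3 = 0 \<and> hyp_inner x f2 f3 = 0 \<and>
    hyp_inner x (hyp_cross x f1 f2) f3 > 0}"

text \<open>The double (universal) cover of the frame bundle is determined up to isomorphism, so no
  model is singled out: spin frames are the points of the total space \<open>E\<close> of any simply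
  connected two-sheeted covering \<open>\<pi>\<close> of \<open>frames\<close>.\<close>

definition spin_frame_bundle :: "'e::real_normed_vector set \<Rightarrow> ('e \<Rightarrow> frame) \<Rightarrow> bool"
  where "spin_frame_bundle E \<pi> \<longleftrightarrow>
    covering_space E \<pi> frames \<and> simply_connected E \<and>
    (\<forall>f\<in>frames. card {S \<in> E. \<pi> S = f} = 2)"

text \<open>Rodrigues' formula: right-handed rotation by \<open>\<theta>\<close> about the unit tangent vector \<open>n\<close> at \<open>x\<close>.\<close>

definition rotate_vec :: "real^3 \<Rightarrow> real^3 \<Rightarrow> real \<Rightarrow> real^3 \<Rightarrow> real^3"
  where "rotate_vec x n \<theta> u = cos \<theta> *\<^sub>R u + sin \<theta> *\<^sub>R hyp_cross x n u +
    ((1 - cos \<theta>) * hyp_inner x n u) *\<^sub>R n"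

fun rotate_frame :: "real^3 \<Rightarrow> real \<Rightarrow> frame \<Rightarrow> frame" where
  "rotate_frame n \<theta> (x, f1, f2, f3) =
    (x, rotate_vec x n \<theta> f1, rotate_vec x n \<theta> f2, rotate_vec x n \<theta> f3)"

text \<open>\<open>spin_rotation E \<pi> n \<theta> S S'\<close>: rotating \<open>S\<close> by \<open>\<theta>\<close> about \<open>n\<close> gives \<open>S'\<close>;
  \<open>\<sigma>\<close> is the lifted path of rotated frames. The angle may be negative.\<close>

definition spin_rotation ::
    "'e::real_normed_vector set \<Rightarrow> ('e \<Rightarrow> frame) \<Rightarrow> real^3 \<Rightarrow> real \<Rightarrow> 'e \<Rightarrow> 'e \<Rightarrow> bool"
  where "spin_rotation E \<pi> n \<theta> S S' \<longleftrightarrow>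
    (\<exists>\<sigma>. continuous_on (closed_segment 0 \<theta>) \<sigma> \<and> \<sigma> 0 = S \<and> \<sigma> \<theta> = S' \<and>
       (\<forall>\<alpha>\<in>closed_segment 0 \<theta>. \<sigma> \<alpha> \<in> E \<and> \<pi> (\<sigma> \<alpha>) = rotate_frame n \<alpha> (\<pi> S)))"

text \<open>\<open>spin_translation E \<pi> \<gamma> s t S S'\<close>: translating \<open>S\<close>, based at \<open>\<gamma> s\<close>, along \<open>\<gamma>\<close> by signed
  distance \<open>t - s\<close> gives \<open>S'\<close>. Translation along a geodesic moves tangent vectors at its points
  by parallel transport.\<close>

definition spin_translation ::
    "'e::real_normed_vector set \<Rightarrow> ('e \<Rightarrow> frame) \<Rightarrow> (real \<Rightarrow> real^3) \<Rightarrow> real \<Rightarrow> real \<Rightarrow> 'e \<Rightarrow> 'e \<Rightarrow> bool"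
  where "spin_translation E \<pi> \<gamma> s t S S' \<longleftrightarrow>
    (\<exists>f1 f2 f3 \<sigma>. parallel_along \<gamma> f1 \<and> parallel_along \<gamma> f2 \<and> parallel_along \<gamma> f3 \<and>
       continuous_on (closed_segment s t) \<sigma> \<and> \<sigma> s = S \<and> \<sigma> t = S' \<and>
       (\<forall>r\<in>closed_segment s t. \<sigma> r \<in> E \<and> \<pi> (\<sigma> r) = (\<gamma> r, f1 r, f2 r, f3 r)))"


section \<open>Spin decorations and complex lambda lengths\<close>

definition frame_in :: "ideal_point \<Rightarrow> (real^3 \<Rightarrow> real^3) \<Rightarrow> real^3 \<Rightarrow> frame"
  where "frame_in \<zeta> v x = (x, normal_in \<zeta> x, v x, hyp_cross x (normal_in \<zeta> x) (v x))"

definition frame_out :: "ideal_point \<Rightarrow> (real^3 \<Rightarrow> real^3) \<Rightarrow> real^3 \<Rightarrow> frame"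
  where "frame_out \<zeta> v x = (x, normal_out \<zeta> x, v x, hyp_cross x (normal_out \<zeta> x) (v x))"

definition lift_along ::
    "'e::real_normed_vector set \<Rightarrow> ('e \<Rightarrow> frame) \<Rightarrow> (real^3) set \<Rightarrow> (real^3 \<Rightarrow> frame) \<Rightarrow> (real^3 \<Rightarrow> 'e) \<Rightarrow> bool"
  where "lift_along E \<pi> H F W \<longleftrightarrow> continuous_on H W \<and> (\<forall>x\<in>H. W x \<in> E \<and> \<pi> (W x) = F x)"

text \<open>A spin decoration is a pair \<open>W = (W_in, W_out)\<close>.\<close>

type_synonym 'e spin_decoration = "(real^3 \<Rightarrow> 'e) \<times> (real^3 \<Rightarrow> 'e)"

definition spin_decorated_horosphere ::
    "'e::real_normed_vector set \<Rightarrow> ('e \<Rightarrow> frame) \<Rightarrow> ideal_point \<Rightarrow> (real^3) set \<Rightarrow> 'e spin_decoration \<Rightarrow> bool"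
  where "spin_decorated_horosphere E \<pi> \<zeta> H W \<longleftrightarrow> horosphere \<zeta> H \<and>
    (\<exists>v. decoration \<zeta> H v \<and>
       lift_along E \<pi> H (frame_in \<zeta> v) (fst W) \<and> lift_along E \<pi> H (frame_out \<zeta> v) (snd W) \<and>
       (\<forall>x\<in>H. spin_rotation E \<pi> (v x) (- pi) (fst W x) (snd W x)))"

fun adapted_at :: "(real \<Rightarrow> real^3) \<Rightarrow> real \<Rightarrow> frame \<Rightarrow> bool" where
  "adapted_at \<gamma> s (x, f1, f2, f3) \<longleftrightarrow> x = \<gamma> s \<and> f1 = vector_derivative \<gamma> (at s)"

text \<open>\<open>d\<close> is a value of the complex distance along \<open>\<gamma>\<close> from \<open>S\<close> to \<open>S'\<close>, which is
  defined modulo \<open>4 pi i\<close>.\<close>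

definition complex_distance ::
    "'e::real_normed_vector set \<Rightarrow> ('e \<Rightarrow> frame) \<Rightarrow> (real \<Rightarrow> real^3) \<Rightarrow> 'e \<Rightarrow> 'e \<Rightarrow> complex \<Rightarrow> bool"
  where "complex_distance E \<pi> \<gamma> S S' d \<longleftrightarrow>
    (\<exists>s t T. t - s = Re d \<and> adapted_at \<gamma> s (\<pi> S) \<and> adapted_at \<gamma> t (\<pi> S') \<and>
       spin_translation E \<pi> \<gamma> s t S T \<and>
       spin_rotation E \<pi> (vector_derivative \<gamma> (at t)) (Im d) T S')"

definition lambda_length ::
    "'e::real_normed_vector set \<Rightarrow> ('e \<Rightarrow> frame) \<Rightarrow> ideal_point \<Rightarrow> (real^3) set \<Rightarrow> 'e spin_decoration \<Rightarrow>
     ideal_point \<Rightarrow> (real^3) set \<Rightarrow> 'e spin_decoration \<Rightarrow> complex"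
  where "lambda_length E \<pi> \<zeta>1 H1 W1 \<zeta>2 H2 W2 = (THE l. \<exists>\<gamma> p1 p2 d.
    geodesic_from_to \<gamma> \<zeta>1 \<zeta>2 \<and> p1 \<in> range \<gamma> \<inter> H1 \<and> p2 \<in> range \<gamma> \<inter> H2 \<and>
    complex_distance E \<pi> \<gamma> (fst W1 p1) (snd W2 p2) d \<and> l = exp (d / 2))"

end

theory Submission
  imports Defs
begin

text \<open>The theorem is a comparison of two formulas in terms of spinors. A spinor is a
  non-zero vector \<open>k\<close> of \<open>complex^2\<close> and stands for the ideal point \<open>k $ 1 / k $ 2\<close>.

  First, every spin-decorated horosphere has a spinor \<open>k\<close> representing its centre, and the
  complex lambda length between two of them is \<open>\<i>\<close> times the determinant of their spinors
  (\<open>lambda_length_spinors\<close>). Second, the shape parameter of the edge \<open>ab\<close> is the cross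
  ratio \<open>det(a,d) det(b,c) / (det(a,c) det(b,d))\<close>, with the remaining vertices \<open>c\<close>, \<open>d\<close> in
  the order that makes its imaginary part positive (\<open>shape_parameter_spinors\<close>). In the
  claimed quotients the factors \<open>\<i>\<close> cancel, and the minus sign in the middle formula comes
  from the antisymmetry of the determinant.

  The first formula rests on a concrete model of the spin frames. A matrix of determinant
  \<open>1\<close> moves a standard frame to some frame, and every frame arises from exactly two
  matrices \<open>A\<close>, \<open>- A\<close>. This is a covering (\<open>covering_space_spin_proj\<close>), so any simply
  connected two-sheeted covering of the frames embeds into the group of these matrices
  (\<open>spin_chart_exists\<close>). There, rotating a frame about its own vectors and translating it
  along the geodesic tangent to its first vector are right multiplications; two frames
  have complex distance \<open>w\<close> if right multiplication by the diagonal matrix with entries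
  \<open>exp (w/2)\<close>, \<open>exp (- w/2)\<close> takes one to the other (\<open>complex_distanceD\<close>,
  \<open>complex_distanceI\<close>). The centre of a horosphere is the ideal point of the second column
  of the matrices of its inward frames. Parabolic isometries act by left multiplication
  with matrices fixing this column, so the column is constant along the horosphere: it is
  the spinor (\<open>spinor_of_decoration\<close>). Rotating by \<open>- pi\<close> about the decoration turns the
  second column, times \<open>-\<i>\<close>, into the first one, and the formula for the lambda length is
  a comparison of first columns.

  The second formula needs that orientation-preserving isometries preserve cross ratios.
  Limits of distances to points going to infinity show that an isometry respects, up to a
  constant, products of horosphere levels at two ideal points, and an
  orientation-preserving isometry that fixes \<open>0\<close>, \<open>1\<close>, \<open>Infty\<close> must be the identity
  (\<open>op_isometry_fixing_three\<close>). Since matrices act by isometries (\<open>SL2_realized\<close>) and move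
  any three ideal points to these, the image of a fourth point is its cross ratio with the
  three. The same limits identify the geodesics (\<open>geodesic_classification\<close>).\<close>

section \<open>Complex coordinates on the upper half space\<close>

text \<open>A point of the upper half space is written with a complex horizontal
  coordinate and a real height, so that all later identities become identities between
  complex numbers.\<close>

definition pt :: "complex \<Rightarrow> real \<Rightarrow> real^3"
  where "pt z t = vector [Re z, Im z, t]"

definition cpart :: "real^3 \<Rightarrow> complex"
  where "cpart x = Complex (x $ 1) (x $ 2)"

lemma pt_nth [simp]: "pt z t $ 1 = Re z" "pt z t $ 2 = Im z" "pt z t $ 3 = t"
  by (simp_all add: pt_def)

lemma cpart_pt [simp]: "cpart (pt z t) = z"
  by (simp add: cpart_def)

lemma pt_cpart [simp]: "pt (cpart x) (x $ 3) = x"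
  by (simp add: vec_eq_iff forall_3 cpart_def)

lemma pt_eq_iff: "pt z s = pt w t \<longleftrightarrow> z = w \<and> s = t"
  by (metis cpart_pt pt_nth(3))

lemma Re_cpart [simp]: "Re (cpart x) = x $ 1" and Im_cpart [simp]: "Im (cpart x) = x $ 2"
  by (simp_all add: cpart_def)

lemma pt_arith: "pt z s + pt w t = pt (z + w) (s + t)" "pt z s - pt w t = pt (z - w) (s - t)"
  "- pt z s = pt (- z) (- s)" "r *\<^sub>R pt z s = pt (r *\<^sub>R z) (r * s)"
  by (simp_all add: vec_eq_iff forall_3)

lemma inner_pt: "pt z s \<bullet> pt w t = Re (cnj z * w) + s * t"
  by (simp add: inner_vec_def sum_3)

lemma norm_pt_sq: "(norm (pt z s))\<^sup>2 = (cmod z)\<^sup>2 + s\<^sup>2"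
  unfolding power2_norm_eq_inner[of "pt z s"] inner_pt by (simp add: cmod_power2) (simp add: power2_eq_square)

lemma bounded_linear_cpart: "bounded_linear cpart"
proof
  show "\<exists>K. \<forall>x. norm (cpart x) \<le> norm x * K"
  proof (intro exI allI)
    fix x
    have "(norm (cpart x))\<^sup>2 \<le> (norm x)\<^sup>2"
      using norm_pt_sq[of "cpart x" "x $ 3"] by simp
    from power2_le_imp_le[OF this] show "norm (cpart x) \<le> norm x * 1" by simp
  qed
qed (simp_all add: complex_eq_iff)

lemma pt_axis: "pt z t = Re z *\<^sub>R axis 1 1 + Im z *\<^sub>R axis 2 1 + t *\<^sub>R axis 3 1"
  by (simp add: vec_eq_iff forall_3 axis_def)

lemma tendsto_pt [tendsto_intros]:
  assumes "(f \<longlongrightarrow> z) F" "(g \<longlongrightarrow> s) F"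
  shows "((\<lambda>k. pt (f k) (g k)) \<longlongrightarrow> pt z s) F"
  unfolding pt_axis by (intro tendsto_intros assms)

lemma continuous_on_pt [continuous_intros]:
  assumes "continuous_on S f" "continuous_on S g"
  shows "continuous_on S (\<lambda>k. pt (f k) (g k))"
  using assms by (auto simp: continuous_on_def intro: tendsto_pt)

lemma has_vector_derivative_pt:
  assumes "(f has_vector_derivative f') F" "(g has_vector_derivative g') F"
  shows "((\<lambda>s. pt (f s) (g s)) has_vector_derivative pt f' g') F"
proof -
  have "((\<lambda>s. Re (f s) *\<^sub>R axis 1 1 + Im (f s) *\<^sub>R axis 2 1 + g s *\<^sub>R axis 3 (1::real)) has_derivative
     (\<lambda>x. Re (x *\<^sub>R f') *\<^sub>R axis 1 1 + Im (x *\<^sub>R f') *\<^sub>R axis 2 1 + (x *\<^sub>R g') *\<^sub>R axis 3 (1::real))) F"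
    using assms unfolding has_vector_derivative_def
    by (intro derivative_intros bounded_linear.has_derivative[OF bounded_linear_Re] bounded_linear.has_derivative[OF bounded_linear_Im])
  then show ?thesis
    by (simp add: has_vector_derivative_def pt_axis scaleR_add_right)
qed

lemma uhs_iff [simp]: "pt z t \<in> upper_half_space \<longleftrightarrow> t > 0"
  by (simp add: upper_half_space_def)

lemma uhs_pos: "x \<in> upper_half_space \<Longrightarrow> x $ 3 > 0"
  by (simp add: upper_half_space_def)

lemma open_uhs: "open upper_half_space"
  unfolding upper_half_space_def
  by (rule open_Collect_less) (auto intro!: continuous_intros)

section \<open>Isometries and ideal points\<close>

text \<open>The hyperbolic cosine of the distance is a rational function of the
  coordinates. Isometries preserve it, and unlike the distance itself it has explicit
  limits at infinity.\<close>

definition cosh_dist :: "real^3 \<Rightarrow> real^3 \<Rightarrow> real"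
  where "cosh_dist x y = 1 + (dist x y)\<^sup>2 / (2 * x $ 3 * y $ 3)"

lemma cosh_dist_ge_1: "x \<in> upper_half_space \<Longrightarrow> y \<in> upper_half_space \<Longrightarrow> cosh_dist x y \<ge> 1"
  by (simp add: cosh_dist_def upper_half_space_def)

lemma cosh_hyp_dist: "x \<in> upper_half_space \<Longrightarrow> y \<in> upper_half_space \<Longrightarrow> cosh (hyp_dist x y) = cosh_dist x y"
  using cosh_dist_ge_1[of x y] by (simp add: hyp_dist_def cosh_dist_def)

lemma hyp_dist_eq_arcosh: "hyp_dist x y = arcosh (cosh_dist x y)"
  by (simp add: hyp_dist_def cosh_dist_def)

lemma hyp_isometryD:
  assumes "hyp_isometry \<phi>" "x \<in> upper_half_space"
  shows "\<phi> x \<in> upper_half_space" "y \<in> upper_half_space \<Longrightarrow> cosh_dist (\<phi> x) (\<phi> y) = cosh_dist x y"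
proof -
  show 1: "\<phi> x \<in> upper_half_space"
    using assms by (auto simp: hyp_isometry_def dest: bij_betwE)
  show "cosh_dist (\<phi> x) (\<phi> y) = cosh_dist x y" if "y \<in> upper_half_space"
  proof -
    have "\<phi> y \<in> upper_half_space" using assms that by (auto simp: hyp_isometry_def dest: bij_betwE)
    then show ?thesis using assms that 1 cosh_hyp_dist unfolding hyp_isometry_def by metis
  qed
qed

lemma hyp_isometryI:
  assumes "bij_betw \<phi> upper_half_space upper_half_space"
    and "\<And>x y. x \<in> upper_half_space \<Longrightarrow> y \<in> upper_half_space \<Longrightarrow> cosh_dist (\<phi> x) (\<phi> y) = cosh_dist x y"
  shows "hyp_isometry \<phi>"
  using assms by (simp add: hyp_isometry_def hyp_dist_eq_arcosh)

lemma op_isometryD: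
  assumes "op_isometry \<phi>"
  shows "hyp_isometry \<phi>"
    and "x \<in> upper_half_space \<Longrightarrow> (\<phi> has_derivative frechet_derivative \<phi> (at x)) (at x)"
    and "x \<in> upper_half_space \<Longrightarrow> det (matrix (frechet_derivative \<phi> (at x))) > 0"
  using assms by (auto simp: op_isometry_def frechet_derivative_works)

lemma op_isometryI:
  assumes "hyp_isometry \<phi>"
    and "\<And>x. x \<in> upper_half_space \<Longrightarrow> \<exists>D. (\<phi> has_derivative D) (at x) \<and> det (matrix D) > 0"
  shows "op_isometry \<phi>"
  unfolding op_isometry_def
  using assms frechet_derivative_at differentiable_def by metis

lemma frechet_derivative_op_comp:
  assumes "op_isometry \<phi>" "op_isometry \<psi>" "x \<in> upper_half_space"
  shows "frechet_derivative (\<phi> \<circ> \<psi>) (at x) =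
    frechet_derivative \<phi> (at (\<psi> x)) \<circ> frechet_derivative \<psi> (at x)"
  using assms by (intro frechet_derivative_compose) (auto simp: op_isometry_def dest: hyp_isometryD)

lemma op_isometry_comp:
  assumes "op_isometry \<phi>" "op_isometry \<psi>"
  shows "op_isometry (\<phi> \<circ> \<psi>)"
proof (rule op_isometryI)
  show "hyp_isometry (\<phi> \<circ> \<psi>)"
    using assms[THEN op_isometryD(1)] unfolding hyp_isometry_def
    by (auto intro: bij_betw_trans dest: bij_betwE)
  fix x assume x: "x \<in> upper_half_space"
  then have y: "\<psi> x \<in> upper_half_space" using assms op_isometryD(1) hyp_isometryD by blast
  let ?D1 = "frechet_derivative \<phi> (at (\<psi> x))" and ?D2 = "frechet_derivative \<psi> (at x)"
  have "(\<phi> \<circ> \<psi> has_derivative ?D1 \<circ> ?D2) (at x)"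
    using op_isometryD(2)[OF assms(1) y] op_isometryD(2)[OF assms(2) x] by (rule diff_chain_at[rotated])
  moreover have "det (matrix (?D1 \<circ> ?D2)) > 0"
    using op_isometryD(2,3)[OF assms(1) y] op_isometryD(2,3)[OF assms(2) x]
    by (subst matrix_compose) (auto simp: det_mul dest: has_derivative_linear)
  ultimately show "\<exists>D. (\<phi> \<circ> \<psi> has_derivative D) (at x) \<and> det (matrix D) > 0" by blast
qed

lemma ideal_maps_to_comp:
  "ideal_maps_to \<psi> a b \<Longrightarrow> ideal_maps_to \<phi> b c \<Longrightarrow> ideal_maps_to (\<phi> \<circ> \<psi>) a c"
  unfolding ideal_maps_to_def comp_def by (rule filterlim_compose)

lemma filterlim_ideal_Fin:
  "filterlim f (ideal_nhds (Fin z)) F \<longleftrightarrow> (f \<longlongrightarrow> pt z 0) F \<and> eventually (\<lambda>k. f k \<in> upper_half_space) F"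
proof -
  have "f k \<in> upper_half_space \<and> f k \<noteq> pt z 0 \<longleftrightarrow> f k \<in> upper_half_space" for k
    by (auto simp: upper_half_space_def)
  then show ?thesis
    by (auto simp: filterlim_at pt_def[symmetric])
qed

lemma filterlim_ideal_Infty:
  "filterlim f (ideal_nhds Infty) F \<longleftrightarrow> filterlim f at_infinity F \<and> eventually (\<lambda>k. f k \<in> upper_half_space) F"
  by (simp add: filterlim_inf filterlim_principal)

lemma filterlim_ideal_uhs:
  "filterlim f (ideal_nhds \<zeta>) F \<Longrightarrow> eventually (\<lambda>k. f k \<in> upper_half_space) F"
  by (cases \<zeta>) (simp_all add: filterlim_ideal_Fin filterlim_ideal_Infty del: ideal_nhds.simps)

text \<open>The closed upper half space with \<open>Infty\<close> added is Hausdorff: a map that tends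
  to a finite point is eventually bounded.\<close>

lemma filterlim_ideal_unique:
  assumes "filterlim f (ideal_nhds \<zeta>) F" "filterlim f (ideal_nhds \<eta>) F" "F \<noteq> bot"
  shows "\<zeta> = \<eta>"
proof (cases \<zeta>; cases \<eta>)
  fix z w assume "\<zeta> = Fin z" "\<eta> = Fin w"
  then show ?thesis using assms tendsto_unique[OF assms(3), of f "pt z 0" "pt w 0"]
    by (simp add: filterlim_ideal_Fin pt_eq_iff del: ideal_nhds.simps)
qed (use assms not_tendsto_and_filterlim_at_infinity in \<open>auto simp: filterlim_ideal_Fin filterlim_ideal_Infty simp del: ideal_nhds.simps\<close>)

lemma ideal_approach: "\<exists>y :: nat \<Rightarrow> real^3. filterlim y (ideal_nhds \<zeta>) sequentially"
proof (cases \<zeta>)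
  case (Fin z)
  have "filterlim (\<lambda>k. pt z (inverse (real (Suc k)))) (ideal_nhds (Fin z)) sequentially"
    unfolding filterlim_ideal_Fin using LIMSEQ_inverse_real_of_nat by (auto intro!: tendsto_intros)
  then show ?thesis using Fin by blast
next
  case Infty
  have "filterlim (\<lambda>k. pt 0 (real (Suc k))) at_infinity sequentially"
  proof (rule filterlim_norm_at_top_imp_at_infinity)
    have "norm (pt 0 (real (Suc k))) = real (Suc k)" for k
      by (rule power2_eq_imp_eq) (simp_all add: norm_pt_sq)
    then show "LIM k sequentially. norm (pt 0 (real (Suc k))) :> at_top"
      by (simp only:) (rule filterlim_compose[OF filterlim_real_sequentially filterlim_Suc])
  qed
  then have "filterlim (\<lambda>k. pt 0 (real (Suc k))) (ideal_nhds Infty) sequentially"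
    unfolding filterlim_ideal_Infty by simp
  then show ?thesis using Infty by blast
qed

lemma ideal_nhds_not_bot: "ideal_nhds \<zeta> \<noteq> bot"
proof
  assume "ideal_nhds \<zeta> = bot"
  with ideal_approach[of \<zeta>] obtain y :: "nat \<Rightarrow> real^3" where "filterlim y bot sequentially" by auto
  then have "eventually (\<lambda>_. False) (filtermap y sequentially)"
    unfolding filterlim_def by (metis eventually_bot filter_leD)
  then show False by (simp add: eventually_filtermap)
qed

lemma ideal_maps_to_unique: "ideal_maps_to \<phi> \<zeta> \<eta> \<Longrightarrow> ideal_maps_to \<phi> \<zeta> \<eta>' \<Longrightarrow> \<eta> = \<eta>'"
  unfolding ideal_maps_to_def using filterlim_ideal_unique ideal_nhds_not_bot by blast

section \<open>Horosphere levels as limits of distances\<close>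

text \<open>\<open>cosh_dist x y\<close> blows up as \<open>y\<close> tends to an ideal point. The weights are the
  factors that turn it into a quantity with a finite non-zero limit: with \<open>x\<close> fixed the
  limit is the reciprocal of the horosphere level of \<open>x\<close>, and with both arguments going to
  different ideal points it is \<open>ideal_gap\<close>.\<close>

fun ideal_weight :: "ideal_point \<Rightarrow> real^3 \<Rightarrow> real" where
  "ideal_weight (Fin z) y = 2 * y $ 3"
| "ideal_weight Infty y = 2 * y $ 3 / (norm y)\<^sup>2"

fun ideal_gap :: "ideal_point \<Rightarrow> ideal_point \<Rightarrow> real" where
  "ideal_gap (Fin z) (Fin w) = 2 * (cmod (z - w))\<^sup>2"
| "ideal_gap (Fin z) Infty = 2"
| "ideal_gap Infty \<zeta> = 2"

lemma ideal_gap_pos: "\<zeta> \<noteq> \<eta> \<Longrightarrow> ideal_gap \<zeta> \<eta> > 0"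
  by (cases \<zeta>; cases \<eta>) auto

lemma horo_level_pos: "x \<in> upper_half_space \<Longrightarrow> horo_level \<zeta> x > 0"
  by (cases \<zeta>) (auto simp: upper_half_space_def intro!: divide_pos_pos)

lemma inversion_tendsto_0:
  assumes "filterlim w at_infinity F"
  shows "((\<lambda>k. w k /\<^sub>R (norm (w k))\<^sup>2) \<longlongrightarrow> (0::'a::real_normed_vector)) F"
proof -
  have "((\<lambda>k. inverse (norm (w k))) \<longlongrightarrow> 0) F"
    using assms by (intro tendsto_inverse_0_at_top) (simp add: filterlim_at_infinity_conv_norm_at_top)
  moreover have "norm (w k /\<^sub>R (norm (w k))\<^sup>2) = inverse (norm (w k))" for k
    by (cases "w k = 0") (auto simp: power2_eq_square divide_simps)
  ultimately have "((\<lambda>k. norm (w k /\<^sub>R (norm (w k))\<^sup>2)) \<longlongrightarrow> 0) F" by (simp only:)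
  then show ?thesis by (rule tendsto_norm_zero_cancel)
qed

text \<open>At infinity the point \<open>w\<close> is replaced by its inversion \<open>u\<close>, which tends to
  \<open>0\<close>.\<close>

lemma dist_sq_inversion:
  fixes x w :: "'a::real_inner"
  assumes "w \<noteq> 0"
  defines "u \<equiv> w /\<^sub>R (norm w)\<^sup>2"
  shows "(dist x w)\<^sup>2 / (norm w)\<^sup>2 = (norm x)\<^sup>2 * (norm u)\<^sup>2 - 2 * (x \<bullet> u) + 1"
proof -
  have "(dist x w)\<^sup>2 = (norm x)\<^sup>2 - 2 * (x \<bullet> w) + (norm w)\<^sup>2"
    by (simp add: dist_norm power2_norm_eq_inner inner_diff inner_commute)
  then show ?thesis using assms
    by (simp add: u_def field_simps power2_eq_square)
qed

lemma cosh_dist_limit: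
  assumes x: "x \<in> upper_half_space" and y: "filterlim y (ideal_nhds \<zeta>) F"
  shows "((\<lambda>k. cosh_dist x (y k) * ideal_weight \<zeta> (y k)) \<longlongrightarrow> 1 / horo_level \<zeta> x) F"
proof (cases \<zeta>)
  case (Fin z)
  have lim: "(y \<longlongrightarrow> pt z 0) F" and ev: "eventually (\<lambda>k. y k \<in> upper_half_space) F"
    using y Fin filterlim_ideal_Fin by auto
  have "((\<lambda>k. 2 * y k $ 3 + (dist x (y k))\<^sup>2 / x $ 3) \<longlongrightarrow> 2 * pt z 0 $ 3 + (dist x (pt z 0))\<^sup>2 / x $ 3) F"
    by (intro tendsto_intros lim) (use uhs_pos[OF x] in auto)
  moreover have "eventually (\<lambda>k. 2 * y k $ 3 + (dist x (y k))\<^sup>2 / x $ 3 = cosh_dist x (y k) * ideal_weight \<zeta> (y k)) F"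
    using ev by eventually_elim (use uhs_pos[OF x] in \<open>auto dest!: uhs_pos simp: Fin cosh_dist_def field_simps\<close>)
  ultimately show ?thesis
    by (simp add: Fin pt_def[symmetric] tendsto_cong)
next
  case Infty
  have lim: "filterlim y at_infinity F" and ev: "eventually (\<lambda>k. y k \<in> upper_half_space) F"
    using y Infty filterlim_ideal_Infty by auto
  define u where "u k = y k /\<^sub>R (norm (y k))\<^sup>2" for k
  have u: "(u \<longlongrightarrow> 0) F" unfolding u_def by (rule inversion_tendsto_0[OF lim])
  have "((\<lambda>k. 2 * u k $ 3 + ((norm x)\<^sup>2 * (norm (u k))\<^sup>2 - 2 * (x \<bullet> u k) + 1) / x $ 3) \<longlongrightarrow>
      2 * (0::real^3) $ 3 + ((norm x)\<^sup>2 * (norm (0::real^3))\<^sup>2 - 2 * (x \<bullet> 0) + 1) / x $ 3) F"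
    by (intro tendsto_intros u) (use uhs_pos[OF x] in auto)
  moreover have "eventually (\<lambda>k. 2 * u k $ 3 + ((norm x)\<^sup>2 * (norm (u k))\<^sup>2 - 2 * (x \<bullet> u k) + 1) / x $ 3
      = cosh_dist x (y k) * ideal_weight \<zeta> (y k)) F"
    using ev
  proof eventually_elim
    case (elim k)
    then have "y k \<noteq> 0" by (auto simp: upper_half_space_def)
    then show ?case unfolding u_def
      by (subst dist_sq_inversion[symmetric]) (use uhs_pos[OF x] uhs_pos[OF elim] in \<open>auto simp: Infty cosh_dist_def field_simps\<close>)
  qed
  ultimately show ?thesis
    by (simp add: Infty tendsto_cong)
qed

lemma cosh_dist_commute: "cosh_dist x y = cosh_dist y x"
  by (simp add: cosh_dist_def dist_commute mult.commute mult.left_commute)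

lemma cosh_dist_limit_pair:
  assumes y: "filterlim y (ideal_nhds \<zeta>) F" and w: "filterlim w (ideal_nhds \<eta>) F" and "\<zeta> \<noteq> \<eta>"
  shows "((\<lambda>k. cosh_dist (y k) (w k) * ideal_weight \<zeta> (y k) * ideal_weight \<eta> (w k)) \<longlongrightarrow> ideal_gap \<zeta> \<eta>) F"
proof -
  have Fin_Infty: "((\<lambda>k. cosh_dist (y k) (w k) * ideal_weight (Fin a) (y k) * ideal_weight Infty (w k)) \<longlongrightarrow> 2) F"
    if y: "filterlim y (ideal_nhds (Fin a)) F" and w: "filterlim w (ideal_nhds Infty) F" for y w a
  proof -
    have lim: "filterlim w at_infinity F" and ev: "eventually (\<lambda>k. w k \<in> upper_half_space) F"
      using w filterlim_ideal_Infty by auto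
    have limy: "(y \<longlongrightarrow> pt a 0) F" and evy: "eventually (\<lambda>k. y k \<in> upper_half_space) F"
      using y filterlim_ideal_Fin by auto
    define u where "u k = w k /\<^sub>R (norm (w k))\<^sup>2" for k
    have u: "(u \<longlongrightarrow> 0) F" unfolding u_def by (rule inversion_tendsto_0[OF lim])
    have "((\<lambda>k. 4 * y k $ 3 * u k $ 3 + 2 * ((norm (y k))\<^sup>2 * (norm (u k))\<^sup>2 - 2 * (y k \<bullet> u k) + 1)) \<longlongrightarrow>
        4 * pt a 0 $ 3 * (0::real^3) $ 3 + 2 * ((norm (pt a 0))\<^sup>2 * (norm (0::real^3))\<^sup>2 - 2 * (pt a 0 \<bullet> 0) + 1)) F"
      by (intro tendsto_intros u limy)
    moreover have "eventually (\<lambda>k. 4 * y k $ 3 * u k $ 3 + 2 * ((norm (y k))\<^sup>2 * (norm (u k))\<^sup>2 - 2 * (y k \<bullet> u k) + 1)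
        = cosh_dist (y k) (w k) * ideal_weight (Fin a) (y k) * ideal_weight Infty (w k)) F"
      using ev evy
    proof eventually_elim
      case (elim k)
      then have "w k \<noteq> 0" by (auto simp: upper_half_space_def)
      then show ?case unfolding u_def
        by (subst dist_sq_inversion[symmetric])
          (use uhs_pos[OF elim(1)] uhs_pos[OF elim(2)] in \<open>auto simp: cosh_dist_def field_simps\<close>)
    qed
    ultimately show ?thesis by (simp add: tendsto_cong)
  qed
  show ?thesis
  proof (cases \<zeta>; cases \<eta>)
    fix a b assume *: "\<zeta> = Fin a" "\<eta> = Fin b"
    have lim: "(w \<longlongrightarrow> pt b 0) F" and ev: "eventually (\<lambda>k. w k \<in> upper_half_space) F"
      using w * filterlim_ideal_Fin by auto
    have limy: "(y \<longlongrightarrow> pt a 0) F" and evy: "eventually (\<lambda>k. y k \<in> upper_half_space) F"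
      using y * filterlim_ideal_Fin by auto
    have "((\<lambda>k. 4 * y k $ 3 * w k $ 3 + 2 * (dist (y k) (w k))\<^sup>2) \<longlongrightarrow>
       4 * pt a 0 $ 3 * pt b 0 $ 3 + 2 * (dist (pt a 0) (pt b 0))\<^sup>2) F"
      by (intro tendsto_intros lim limy)
    moreover have "eventually (\<lambda>k. 4 * y k $ 3 * w k $ 3 + 2 * (dist (y k) (w k))\<^sup>2 =
       cosh_dist (y k) (w k) * ideal_weight \<zeta> (y k) * ideal_weight \<eta> (w k)) F"
      using ev evy by eventually_elim (auto dest!: uhs_pos simp: * cosh_dist_def field_simps)
    moreover have "(dist (pt a 0) (pt b 0))\<^sup>2 = (cmod (a - b))\<^sup>2"
      by (simp add: dist_norm pt_arith norm_pt_sq)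
    ultimately show ?thesis by (simp add: * tendsto_cong)
  next
    fix a assume "\<zeta> = Fin a" "\<eta> = Infty"
    then show ?thesis using Fin_Infty y w by simp
  next
    fix a assume "\<zeta> = Infty" "\<eta> = Fin a"
    then show ?thesis using Fin_Infty[of w a y] y w by (simp add: cosh_dist_commute mult_ac)
  qed (use assms in auto)
qed

lemma ideal_weight_pos: "x \<in> upper_half_space \<Longrightarrow> ideal_weight \<zeta> x > 0"
  by (cases \<zeta>) (auto simp: upper_half_space_def intro!: divide_pos_pos)

text \<open>The weights cancel in this combination of distances, so its limit is a
  geometric invariant although a single horosphere level depends on the chosen
  coordinates.\<close>

lemma horo_level_product_limit:
  assumes x: "x \<in> upper_half_space" and y: "filterlim y (ideal_nhds \<zeta>) F"
    and w: "filterlim w (ideal_nhds \<eta>) F" and "\<zeta> \<noteq> \<eta>"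
  shows "((\<lambda>k. cosh_dist x (y k) * cosh_dist x (w k) / cosh_dist (y k) (w k)) \<longlongrightarrow>
     1 / (horo_level \<zeta> x * horo_level \<eta> x * ideal_gap \<zeta> \<eta>)) F"
proof -
  have "((\<lambda>k. (cosh_dist x (y k) * ideal_weight \<zeta> (y k)) * (cosh_dist x (w k) * ideal_weight \<eta> (w k)) /
     (cosh_dist (y k) (w k) * ideal_weight \<zeta> (y k) * ideal_weight \<eta> (w k))) \<longlongrightarrow>
     (1 / horo_level \<zeta> x) * (1 / horo_level \<eta> x) / ideal_gap \<zeta> \<eta>) F"
    by (intro tendsto_divide tendsto_mult[of "\<lambda>k. cosh_dist x (y k) * ideal_weight \<zeta> (y k)"] cosh_dist_limit cosh_dist_limit_pair assms)
       (use ideal_gap_pos[OF assms(4)] in auto)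
  moreover have "eventually (\<lambda>k. (cosh_dist x (y k) * ideal_weight \<zeta> (y k)) * (cosh_dist x (w k) * ideal_weight \<eta> (w k)) /
     (cosh_dist (y k) (w k) * ideal_weight \<zeta> (y k) * ideal_weight \<eta> (w k)) =
     cosh_dist x (y k) * cosh_dist x (w k) / cosh_dist (y k) (w k)) F"
    using filterlim_ideal_uhs[OF y] filterlim_ideal_uhs[OF w]
  proof eventually_elim
    case (elim k)
    then show ?case using ideal_weight_pos[of "y k" \<zeta>] ideal_weight_pos[of "w k" \<eta>] by (simp add: field_simps)
  qed
  ultimately show ?thesis by (simp add: tendsto_cong)
qed

lemma horo_level_product_isometry:
  assumes "hyp_isometry \<phi>" and x: "x \<in> upper_half_space"
    and "ideal_maps_to \<phi> \<zeta> \<zeta>'" "ideal_maps_to \<phi> \<eta> \<eta>'" "\<zeta> \<noteq> \<eta>" "\<zeta>' \<noteq> \<eta>'"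
  shows "horo_level \<zeta>' (\<phi> x) * horo_level \<eta>' (\<phi> x) * ideal_gap \<zeta>' \<eta>' =
    horo_level \<zeta> x * horo_level \<eta> x * ideal_gap \<zeta> \<eta>"
proof -
  obtain y w :: "nat \<Rightarrow> real^3" where y: "filterlim y (ideal_nhds \<zeta>) sequentially"
     and w: "filterlim w (ideal_nhds \<eta>) sequentially" using ideal_approach by metis
  have 1: "(\<lambda>k. cosh_dist x (y k) * cosh_dist x (w k) / cosh_dist (y k) (w k)) \<longlonglongrightarrow>
     1 / (horo_level \<zeta> x * horo_level \<eta> x * ideal_gap \<zeta> \<eta>)"
    by (rule horo_level_product_limit[OF x y w assms(5)])
  have 2: "(\<lambda>k. cosh_dist (\<phi> x) (\<phi> (y k)) * cosh_dist (\<phi> x) (\<phi> (w k)) / cosh_dist (\<phi> (y k)) (\<phi> (w k))) \<longlonglongrightarrow>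
     1 / (horo_level \<zeta>' (\<phi> x) * horo_level \<eta>' (\<phi> x) * ideal_gap \<zeta>' \<eta>')"
    using assms(3,4) y w hyp_isometryD(1)[OF assms(1) x] unfolding ideal_maps_to_def
    by (intro horo_level_product_limit assms(6)) (auto intro: filterlim_compose)
  have "eventually (\<lambda>k. cosh_dist (\<phi> x) (\<phi> (y k)) * cosh_dist (\<phi> x) (\<phi> (w k)) / cosh_dist (\<phi> (y k)) (\<phi> (w k)) =
     cosh_dist x (y k) * cosh_dist x (w k) / cosh_dist (y k) (w k)) sequentially"
    using filterlim_ideal_uhs[OF y] filterlim_ideal_uhs[OF w]
    by eventually_elim (simp add: hyp_isometryD(2)[OF assms(1)] x)
  from 1 2 tendsto_cong[OF this] LIMSEQ_unique
  have "1 / (horo_level \<zeta>' (\<phi> x) * horo_level \<eta>' (\<phi> x) * ideal_gap \<zeta>' \<eta>') = 1 / (horo_level \<zeta> x * horo_level \<eta> x * ideal_gap \<zeta> \<eta>)"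
    by blast
  then show ?thesis by (metis div_by_1 divide_divide_eq_right mult_1)
qed

section \<open>Isometries fixing three ideal points\<close>

text \<open>The products of the levels at any two of \<open>0\<close>, \<open>1\<close>, \<open>Infty\<close> are, up to a
  constant, reciprocals of limits of expressions in distances, hence preserved, and three
  pairwise products of positive numbers determine the numbers. The three levels determine
  a point up to the reflection in the plane through the three ideal points. Where the
  isometry took the other choice, it would coincide with that reflection on a
  neighbourhood by continuity, and its derivative would have determinant \<open>-1\<close>.\<close>

lemma op_isometry_fixing_three:
  assumes op: "op_isometry \<phi>" and maps: "ideal_maps_to \<phi> (Fin 0) (Fin 0)"
    "ideal_maps_to \<phi> (Fin 1) (Fin 1)" "ideal_maps_to \<phi> Infty Infty"
    and x: "x \<in> upper_half_space"
  shows "\<phi> x = x"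
proof -
  have coords: "\<phi> y $ 3 = y $ 3 \<and> \<phi> y $ 1 = y $ 1 \<and> \<bar>\<phi> y $ 2\<bar> = \<bar>y $ 2\<bar>" if y: "y \<in> upper_half_space" for y
  proof -
    have y': "\<phi> y \<in> upper_half_space" using op_isometryD(1)[OF op] y hyp_isometryD by blast
    note prod = horo_level_product_isometry[OF op_isometryD(1)[OF op] y]
    define a b c a' b' c' where d: "a = horo_level (Fin 0) y" "b = horo_level (Fin 1) y" "c = horo_level Infty y"
       "a' = horo_level (Fin 0) (\<phi> y)" "b' = horo_level (Fin 1) (\<phi> y)" "c' = horo_level Infty (\<phi> y)"
    have pos: "a > 0" "b > 0" "c > 0" "a' > 0" "b' > 0" "c' > 0"
      unfolding d by (intro horo_level_pos y y')+
    have ab: "a' * b' = a * b" and ac: "a' * c' = a * c" and bc: "b' * c' = b * c"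
      using prod[OF maps(1) maps(2)] prod[OF maps(1) maps(3)] prod[OF maps(2) maps(3)] by (simp_all add: d del: horo_level.simps)
    have "a'^2 * (b' * c') = a^2 * (b * c)"
      using ab ac by (simp add: power2_eq_square) (metis mult.assoc mult.commute)
    then have "a'^2 = a^2" using bc pos by simp
    then have aa: "a' = a" using pos by simp
    then have bb: "b' = b" and cc: "c' = c" using ab ac pos by auto
    have 3: "\<phi> y $ 3 = y $ 3" using cc by (simp add: d)
    \<comment> \<open>The height is the level at infinity; the other two levels now give
      the distances to the two finite ideal points.\<close>
    have "(dist (\<phi> y) (pt 0 0))\<^sup>2 = (dist y (pt 0 0))\<^sup>2" "(dist (\<phi> y) (pt 1 0))\<^sup>2 = (dist y (pt 1 0))\<^sup>2"
      using aa bb 3 uhs_pos[OF y] pos by (auto simp: d pt_def field_simps)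
    moreover have "(dist u (pt r 0))\<^sup>2 = (u $ 1 - Re r)\<^sup>2 + (u $ 2 - Im r)\<^sup>2 + (u $ 3)\<^sup>2" for u r
      using norm_pt_sq[of "cpart u - r" "u $ 3"] pt_arith(2)[of "cpart u" "u $ 3" r 0]
      by (simp add: dist_norm cmod_power2)
    ultimately have *: "(\<phi> y $ 1)\<^sup>2 + (\<phi> y $ 2)\<^sup>2 = (y $ 1)\<^sup>2 + (y $ 2)\<^sup>2"
        "(\<phi> y $ 1 - 1)\<^sup>2 + (\<phi> y $ 2)\<^sup>2 = (y $ 1 - 1)\<^sup>2 + (y $ 2)\<^sup>2"
      using 3 by simp_all
    then have 1: "\<phi> y $ 1 = y $ 1" by (simp add: power2_eq_square algebra_simps)
    with * have "(\<phi> y $ 2)\<^sup>2 = (y $ 2)\<^sup>2" by simp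
    then show ?thesis using 1 3 by (simp add: power2_eq_iff abs_eq_iff)
  qed
  have "\<phi> x $ 2 = x $ 2"
  proof (rule ccontr)
    assume "\<phi> x $ 2 \<noteq> x $ 2"
    with coords[OF x] have neg: "\<phi> x $ 2 = - x $ 2" and nz: "x $ 2 \<noteq> 0" by auto
    define R :: "real^3 \<Rightarrow> real^3" where "R y = pt (cnj (cpart y)) (y $ 3)" for y
    have R: "bounded_linear R"
    proof -
      have "linear R" by (rule linearI) (simp_all add: R_def vec_eq_iff forall_3)
      then show ?thesis by (simp add: linear_conv_bounded_linear)
    qed
    have "det (matrix R) = -1"
      by (simp add: det_3 matrix_def R_def axis_def)
    have "isCont \<phi> x" using op_isometryD(2)[OF op x] has_derivative_continuous by blast
    then have lim: "((\<lambda>y. \<phi> y $ 2 * y $ 2) \<longlongrightarrow> \<phi> x $ 2 * x $ 2) (nhds x)"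
      unfolding isCont_def by (intro tendsto_intros) (auto simp: tendsto_at_iff_tendsto_nhds filterlim_ident)
    have "0 < x $ 2 * x $ 2" using nz by (metis not_real_square_gt_zero)
    then have "eventually (\<lambda>y. \<phi> y $ 2 * y $ 2 < 0) (nhds x)"
      using order_tendstoD(2)[OF lim, of 0] neg by simp
    moreover have "eventually (\<lambda>y. y \<in> upper_half_space) (nhds x)"
      using open_uhs x by (simp add: eventually_nhds) blast
    ultimately have "eventually (\<lambda>y. \<phi> y = R y) (nhds x)"
    proof eventually_elim
      case (elim y)
      have "\<phi> y $ 2 = - (y $ 2)"
        using coords[OF elim(2)] elim(1) by (auto simp: abs_eq_iff not_less zero_le_mult_iff)
      then show ?case using coords[OF elim(2)] by (simp add: R_def vec_eq_iff forall_3)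
    qed
    then have "eventually (\<lambda>y. R y = \<phi> y) (at x)" "R x = \<phi> x"
      by (auto simp: eventually_at_filter elim: eventually_mono dest: eventually_nhds_x_imp_x)
    then have "(\<phi> has_derivative R) (at x)"
      by (intro has_derivative_transform_eventually[OF bounded_linear_imp_has_derivative[OF R]]) auto
    then have "frechet_derivative \<phi> (at x) = R" by (metis frechet_derivative_at)
    then show False using op_isometryD(3)[OF op x] \<open>det (matrix R) = -1\<close> by simp
  qed
  with coords[OF x] show ?thesis by (simp add: vec_eq_iff forall_3)
qed

section \<open>Frames of complex matrices\<close>

definition mat2 :: "complex \<Rightarrow> complex \<Rightarrow> complex \<Rightarrow> complex \<Rightarrow> complex^2^2"
  where "mat2 a b c d = vector [vector [a, b], vector [c, d]]"

definition SL2 :: "(complex^2^2) set"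
  where "SL2 = {A. det A = 1}"

lemma mat2_nth [simp]: "mat2 a b c d $ 1 $ 1 = a" "mat2 a b c d $ 1 $ 2 = b"
    "mat2 a b c d $ 2 $ 1 = c" "mat2 a b c d $ 2 $ 2 = d"
  by (simp_all add: mat2_def)

lemma mat2_eta: "mat2 (A $ 1 $ 1) (A $ 1 $ 2) (A $ 2 $ 1) (A $ 2 $ 2) = A"
  by (simp add: vec_eq_iff forall_2)

lemma mat2_eq_iff: "A = B \<longleftrightarrow> A $ 1 $ 1 = B $ 1 $ 1 \<and> A $ 1 $ 2 = B $ 1 $ 2 \<and> A $ 2 $ 1 = B $ 2 $ 1 \<and> A $ 2 $ 2 = B $ 2 $ 2"
  for A B :: "'a^2^2"
  by (auto simp: vec_eq_iff forall_2)

lemma matrix_mult_2 [simp]: "(A ** B) $ i $ j = A $ i $ 1 * B $ 1 $ j + A $ i $ 2 * B $ 2 $ j" for A B :: "'a::semiring_1^2^2"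
  by (simp add: matrix_matrix_mult_def sum_2)

lemma matrix_vector_mult_2 [simp]: "(A *v k) $ i = A $ i $ 1 * k $ 1 + A $ i $ 2 * k $ 2" for A :: "'a::semiring_1^2^2"
  by (simp add: matrix_vector_mult_def sum_2)

lemma SL2_iff: "A \<in> SL2 \<longleftrightarrow> A $ 1 $ 1 * A $ 2 $ 2 - A $ 1 $ 2 * A $ 2 $ 1 = 1"
  by (simp add: SL2_def det_2)

lemma SL2_mult: "A \<in> SL2 \<Longrightarrow> B \<in> SL2 \<Longrightarrow> A ** B \<in> SL2"
  by (simp add: SL2_def det_mul)

lemma SL2_mat2 [simp]: "mat2 a b c d \<in> SL2 \<longleftrightarrow> a * d - b * c = 1"
  by (simp add: SL2_iff)

definition row_norm :: "complex^2^2 \<Rightarrow> real"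
  where "row_norm A = (cmod (A $ 2 $ 1))\<^sup>2 + (cmod (A $ 2 $ 2))\<^sup>2"

definition base :: "complex^2^2 \<Rightarrow> real^3" where
  "base A = pt ((A $ 1 $ 1 * cnj (A $ 2 $ 1) + A $ 1 $ 2 * cnj (A $ 2 $ 2)) / row_norm A) (1 / row_norm A)"

definition dir1 :: "complex \<Rightarrow> complex \<Rightarrow> real^3"
  where "dir1 c d = pt (2 * cnj c * cnj d) ((cmod d)\<^sup>2 - (cmod c)\<^sup>2)"
definition dir2 :: "complex \<Rightarrow> complex \<Rightarrow> real^3"
  where "dir2 c d = pt ((cnj d)\<^sup>2 - (cnj c)\<^sup>2) (- 2 * Re (c * cnj d))"
definition dir3 :: "complex \<Rightarrow> complex \<Rightarrow> real^3"
  where "dir3 c d = pt (\<i> * ((cnj d)\<^sup>2 + (cnj c)\<^sup>2)) (2 * Im (c * cnj d))"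

definition axis1 :: "complex^2^2 \<Rightarrow> real^3"
  where "axis1 A = (1 / (row_norm A)\<^sup>2) *\<^sub>R dir1 (A $ 2 $ 1) (A $ 2 $ 2)"
definition axis2 :: "complex^2^2 \<Rightarrow> real^3"
  where "axis2 A = (1 / (row_norm A)\<^sup>2) *\<^sub>R dir2 (A $ 2 $ 1) (A $ 2 $ 2)"
definition axis3 :: "complex^2^2 \<Rightarrow> real^3"
  where "axis3 A = (1 / (row_norm A)\<^sup>2) *\<^sub>R dir3 (A $ 2 $ 1) (A $ 2 $ 2)"

text \<open>\<open>spin_proj A\<close> is the image of the standard frame (up, east, north) at the
  point \<open>(0, 1)\<close> under the Moebius transformation of the upper half space with matrix \<open>A\<close>.
  The three vectors depend only on the bottom row \<open>(c, d)\<close> of \<open>A\<close>; up to the factor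
  \<open>1 / (row_norm A)\<^sup>2\<close> their coordinates are quadratic forms in \<open>c\<close>, \<open>d\<close> and their
  conjugates.\<close>

definition spin_proj :: "complex^2^2 \<Rightarrow> frame"
  where "spin_proj A = (base A, axis1 A, axis2 A, axis3 A)"

lemma row_norm_pos: "A \<in> SL2 \<Longrightarrow> row_norm A > 0"
proof -
  assume "A \<in> SL2"
  then have "A $ 2 $ 1 \<noteq> 0 \<or> A $ 2 $ 2 \<noteq> 0" by (auto simp: SL2_iff)
  then show ?thesis unfolding row_norm_def by (auto intro: add_pos_nonneg add_nonneg_pos)
qed

lemma base_uhs: "A \<in> SL2 \<Longrightarrow> base A \<in> upper_half_space"
  by (simp add: base_def row_norm_pos)

lemma base_3 [simp]: "base A $ 3 = 1 / row_norm A"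
  by (simp add: base_def)

lemma cmod_sq: "complex_of_real ((cmod c)\<^sup>2) = c * cnj c"
  by (simp only: complex_norm_square)

lemma of_row_norm: "complex_of_real (row_norm A) = A $ 2 $ 1 * cnj (A $ 2 $ 1) + A $ 2 $ 2 * cnj (A $ 2 $ 2)"
  by (simp only: row_norm_def of_real_add complex_norm_square)

text \<open>The first row can be recovered from the base point and the bottom row: it
  solves the linear system formed by the determinant condition and the formula for the
  base point.\<close>

lemma SL2_first_row:
  assumes "A \<in> SL2"
  shows "A $ 1 $ 1 = cpart (base A) * A $ 2 $ 1 + cnj (A $ 2 $ 2) / row_norm A"
    and "A $ 1 $ 2 = cpart (base A) * A $ 2 $ 2 - cnj (A $ 2 $ 1) / row_norm A"
proof -
  define a b c d where abcd: "a = A $ 1 $ 1" "b = A $ 1 $ 2" "c = A $ 2 $ 1" "d = A $ 2 $ 2"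
  define N where "N = complex_of_real (row_norm A)"
  have nz: "N \<noteq> 0" using row_norm_pos[OF assms] by (simp add: N_def)
  have N: "N = c * cnj c + d * cnj d" by (simp add: N_def of_row_norm abcd)
  have \<zeta>: "cpart (base A) = (a * cnj c + b * cnj d) / N"
    by (simp add: base_def N_def abcd)
  have det: "a * d = 1 + b * c" using assms by (simp add: SL2_iff abcd algebra_simps)
  have "a * N = (a * cnj c + b * cnj d) * c + cnj d" "b * N = (a * cnj c + b * cnj d) * d - cnj c"
    unfolding N using det by algebra+
  then have "a = (a * cnj c + b * cnj d) / N * c + cnj d / N" "b = (a * cnj c + b * cnj d) / N * d - cnj c / N"
    using nz by (simp_all add: nonzero_eq_divide_eq add_divide_distrib[symmetric] diff_divide_distrib[symmetric])
  then show "A $ 1 $ 1 = cpart (base A) * A $ 2 $ 1 + cnj (A $ 2 $ 2) / row_norm A"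
   "A $ 1 $ 2 = cpart (base A) * A $ 2 $ 2 - cnj (A $ 2 $ 1) / row_norm A"
    unfolding \<zeta> abcd N_def by simp_all
qed

lemma dir_inner:
  "dir1 c d \<bullet> dir1 c d = ((cmod c)\<^sup>2 + (cmod d)\<^sup>2)\<^sup>2" "dir2 c d \<bullet> dir2 c d = ((cmod c)\<^sup>2 + (cmod d)\<^sup>2)\<^sup>2"
  "dir3 c d \<bullet> dir3 c d = ((cmod c)\<^sup>2 + (cmod d)\<^sup>2)\<^sup>2"
  "dir1 c d \<bullet> dir2 c d = 0" "dir1 c d \<bullet> dir3 c d = 0" "dir2 c d \<bullet> dir3 c d = 0"
  unfolding dir1_def dir2_def dir3_def inner_pt cmod_power2
  by (simp_all add: power2_eq_square algebra_simps)

lemma dir_cross: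
  "cross3 (dir1 c d) (dir2 c d) = ((cmod c)\<^sup>2 + (cmod d)\<^sup>2) *\<^sub>R dir3 c d"
  "cross3 (dir2 c d) (dir3 c d) = ((cmod c)\<^sup>2 + (cmod d)\<^sup>2) *\<^sub>R dir1 c d"
  "cross3 (dir1 c d) (dir3 c d) = - (((cmod c)\<^sup>2 + (cmod d)\<^sup>2) *\<^sub>R dir2 c d)"
  unfolding dir1_def dir2_def dir3_def cmod_power2
  by (simp_all add: cross3_def power2_eq_square vec_eq_iff forall_3 algebra_simps)

lemma axis_inner:
  assumes "A \<in> SL2"
  shows "hyp_inner (base A) (axis1 A) (axis1 A) = 1" "hyp_inner (base A) (axis2 A) (axis2 A) = 1"
    "hyp_inner (base A) (axis3 A) (axis3 A) = 1" "hyp_inner (base A) (axis1 A) (axis2 A) = 0"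
    "hyp_inner (base A) (axis1 A) (axis3 A) = 0" "hyp_inner (base A) (axis2 A) (axis3 A) = 0"
  using row_norm_pos[OF assms]
  by (simp_all add: hyp_inner_def axis1_def axis2_def axis3_def
      dir_inner[of "A $ 2 $ 1" "A $ 2 $ 2", folded row_norm_def] power2_eq_square)

lemma hyp_inner_commute: "hyp_inner x u v = hyp_inner x v u"
  by (simp add: hyp_inner_def inner_commute)

lemma axis_cross:
  assumes "A \<in> SL2"
  shows "hyp_cross (base A) (axis1 A) (axis2 A) = axis3 A" "hyp_cross (base A) (axis2 A) (axis3 A) = axis1 A"
    "hyp_cross (base A) (axis1 A) (axis3 A) = - axis2 A"
  using row_norm_pos[OF assms]
  by (simp_all add: hyp_cross_def axis1_def axis2_def axis3_def cross_mult_left cross_mult_right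
      dir_cross[of "A $ 2 $ 1" "A $ 2 $ 2", folded row_norm_def] power2_eq_square)

lemma spin_proj_frames: "A \<in> SL2 \<Longrightarrow> spin_proj A \<in> frames"
  using axis_inner[of A] by (simp add: frames_def spin_proj_def base_uhs axis_cross(1))

section \<open>The action of matrices by isometries\<close>

fun push_frame :: "(real^3 \<Rightarrow> real^3) \<Rightarrow> frame \<Rightarrow> frame" where
  "push_frame \<phi> (x, f1, f2, f3) = (\<phi> x, frechet_derivative \<phi> (at x) f1,
     frechet_derivative \<phi> (at x) f2, frechet_derivative \<phi> (at x) f3)"

text \<open>A non-zero vector of \<open>complex^2\<close>, called a spinor below, represents the ideal
  point with these homogeneous coordinates.\<close>

definition ideal_of :: "complex^2 \<Rightarrow> ideal_point"
  where "ideal_of k = (if k $ 2 = 0 then Infty else Fin (k $ 1 / k $ 2))"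

text \<open>An isometry realizes a matrix if it acts on the frames of matrices, and on
  ideal points, as left multiplication by this matrix. Working with this relation instead
  of a formula for the Moebius action means that only two kinds of generators have to be
  computed.\<close>

definition realizes :: "(real^3 \<Rightarrow> real^3) \<Rightarrow> complex^2^2 \<Rightarrow> bool"
  where "realizes \<phi> B \<longleftrightarrow> op_isometry \<phi> \<and>
    (\<forall>A\<in>SL2. spin_proj (B ** A) = push_frame \<phi> (spin_proj A)) \<and>
    (\<forall>k. k \<noteq> 0 \<longrightarrow> ideal_maps_to \<phi> (ideal_of k) (ideal_of (B *v k)))"

lemma SL2_vec_nonzero:
  assumes "A \<in> SL2" "k \<noteq> 0" shows "A *v k \<noteq> 0"
proof
  assume *: "A *v k = 0"
  have det: "A $ 1 $ 1 * A $ 2 $ 2 - A $ 1 $ 2 * A $ 2 $ 1 = 1" using assms by (simp add: SL2_iff)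
  have "A $ 1 $ 1 * k $ 1 + A $ 1 $ 2 * k $ 2 = 0" "A $ 2 $ 1 * k $ 1 + A $ 2 $ 2 * k $ 2 = 0"
    using arg_cong[OF *, of "\<lambda>v. v $ 1"] arg_cong[OF *, of "\<lambda>v. v $ 2"] by simp_all
  then have "k $ 1 = 0" "k $ 2 = 0" using det by algebra+
  then show False using assms(2) by (simp add: vec_eq_iff forall_2)
qed

lemma realizes_mult:
  assumes "realizes \<phi> B" "realizes \<psi> C" "C \<in> SL2"
  shows "realizes (\<phi> \<circ> \<psi>) (B ** C)"
  unfolding realizes_def
proof (intro conjI ballI allI impI)
  note op = assms(1,2)[unfolded realizes_def, THEN conjunct1]
  show "op_isometry (\<phi> \<circ> \<psi>)" by (rule op_isometry_comp[OF op])
  fix A assume A: "A \<in> SL2"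
  have "spin_proj (B ** C ** A) = push_frame \<phi> (push_frame \<psi> (spin_proj A))"
    using assms A by (simp add: realizes_def matrix_mul_assoc[symmetric] SL2_mult)
  also have "\<dots> = push_frame (\<phi> \<circ> \<psi>) (spin_proj A)"
    using frechet_derivative_op_comp[OF op base_uhs[OF A]] by (simp add: spin_proj_def)
  finally show "spin_proj (B ** C ** A) = push_frame (\<phi> \<circ> \<psi>) (spin_proj A)" .
next
  fix k :: "complex^2" assume k: "k \<noteq> 0"
  show "ideal_maps_to (\<phi> \<circ> \<psi>) (ideal_of k) (ideal_of (B ** C *v k))"
    using assms k SL2_vec_nonzero[OF assms(3) k] ideal_maps_to_comp[of \<psi> _ _ \<phi>]
    by (auto simp: realizes_def matrix_vector_mul_assoc[symmetric])
qed

lemma spin_proj_uminus: "spin_proj (- A) = spin_proj A"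
  by (simp add: spin_proj_def base_def axis1_def axis2_def axis3_def dir1_def dir2_def dir3_def row_norm_def)

text \<open>Matrices and spinors differing by a sign give the same frames and the same
  ideal points.\<close>

lemma realizes_uminus:
  assumes "realizes \<phi> B" shows "realizes \<phi> (- B)"
proof -
  have "(- B) ** A = - (B ** A)" for A :: "complex^2^2" by (simp add: mat2_eq_iff)
  moreover have "(- B) *v k = - (B *v k)" for k :: "complex^2" by (simp add: vec_eq_iff forall_2)
  moreover have "ideal_of (- k) = ideal_of k" for k by (simp add: ideal_of_def)
  ultimately show ?thesis using assms by (simp add: realizes_def spin_proj_uminus)
qed

lemma bij_betw_involution:
  "(\<And>x. x \<in> S \<Longrightarrow> f x \<in> S \<and> g x \<in> S \<and> g (f x) = x \<and> f (g x) = x) \<Longrightarrow> bij_betw f S S"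
  by (rule bij_betw_byWitness[where f' = g]) auto

lemma realizes_translation: "realizes (\<lambda>x. x + pt z 0) (mat2 1 z 0 1)"
  unfolding realizes_def
proof (intro conjI ballI allI impI)
  let ?\<phi> = "\<lambda>x. x + pt z 0"
  have D: "(?\<phi> has_derivative (\<lambda>u. u)) (at x)" for x
    by (auto intro!: derivative_eq_intros)
  show "op_isometry ?\<phi>"
  proof (rule op_isometryI)
    show "hyp_isometry ?\<phi>"
      by (rule hyp_isometryI)
        (auto intro!: bij_betw_involution[of _ _ "\<lambda>x. x - pt z 0"] simp: cosh_dist_def dist_norm upper_half_space_def)
    have "matrix (\<lambda>u::real^3. u) = mat 1" using matrix_id_mat_1 by (simp add: id_def)
    then show "\<exists>D. (?\<phi> has_derivative D) (at x) \<and> det (matrix D) > 0" for x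
      using D by (metis det_I zero_less_one)
  qed
  have fD: "frechet_derivative ?\<phi> (at x) = (\<lambda>u. u)" for x
    using frechet_derivative_at[OF D] by simp
  fix A assume A: "A \<in> SL2"
  have "row_norm (mat2 1 z 0 1 ** A) = row_norm A" by (simp add: row_norm_def)
  moreover have "base (mat2 1 z 0 1 ** A) = base A + pt z 0"
  proof -
    have "complex_of_real (row_norm A) \<noteq> 0" using row_norm_pos[OF A] by simp
    then have "((A $ 1 $ 1 + z * A $ 2 $ 1) * cnj (A $ 2 $ 1) + (A $ 1 $ 2 + z * A $ 2 $ 2) * cnj (A $ 2 $ 2)) / row_norm A
      = (A $ 1 $ 1 * cnj (A $ 2 $ 1) + A $ 1 $ 2 * cnj (A $ 2 $ 2)) / row_norm A + z"
      by (simp add: field_simps) (simp add: of_row_norm algebra_simps)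
    then show ?thesis
      unfolding base_def calculation pt_arith by simp
  qed
  ultimately show "spin_proj (mat2 1 z 0 1 ** A) = push_frame ?\<phi> (spin_proj A)"
    by (simp add: spin_proj_def fD axis1_def axis2_def axis3_def)
next
  fix k :: "complex^2" assume k: "k \<noteq> 0"
  note id = filterlim_ident[of "ideal_nhds (ideal_of k)"]
  have uhs: "x + pt z 0 \<in> upper_half_space \<longleftrightarrow> x \<in> upper_half_space" for x by (simp add: upper_half_space_def)
  show "ideal_maps_to (\<lambda>x. x + pt z 0) (ideal_of k) (ideal_of (mat2 1 z 0 1 *v k))"
  proof (cases "k $ 2 = 0")
    case True
    then have eq: "ideal_of k = Infty" "ideal_of (mat2 1 z 0 1 *v k) = Infty" by (simp_all add: ideal_of_def)
    show ?thesis using id unfolding ideal_maps_to_def eq filterlim_ideal_Infty uhs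
      by (auto intro: tendsto_add_filterlim_at_infinity')
  next
    case False
    then have eq: "ideal_of k = Fin (k $ 1 / k $ 2)" "ideal_of (mat2 1 z 0 1 *v k) = Fin (k $ 1 / k $ 2 + z)" by (simp_all add: ideal_of_def field_simps)
    have "pt (k $ 1 / k $ 2 + z) 0 = pt (k $ 1 / k $ 2) 0 + pt z 0" by (simp add: pt_arith)
    then show ?thesis using id unfolding ideal_maps_to_def eq filterlim_ideal_Fin uhs
      by (auto intro: tendsto_intros)
  qed
qed

definition mirror :: "real^3 \<Rightarrow> real^3"
  where "mirror x = pt (- cnj (cpart x)) (x $ 3)"

lemma bounded_linear_mirror: "bounded_linear mirror"
proof -
  have "linear mirror" by (rule linearI) (simp_all add: mirror_def vec_eq_iff forall_3)
  then show ?thesis by (simp add: linear_conv_bounded_linear)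
qed

lemma mirror_pt [simp]: "mirror (pt z t) = pt (- cnj z) t"
  by (simp add: mirror_def)

lemma mirror_mirror [simp]: "mirror (mirror x) = x"
  by (simp add: mirror_def)

lemma mirror_nth [simp]: "mirror x $ 1 = - x $ 1" "mirror x $ 2 = x $ 2" "mirror x $ 3 = x $ 3"
  by (simp_all add: mirror_def)

lemma inner_mirror [simp]: "mirror x \<bullet> mirror y = x \<bullet> y"
  by (simp add: inner_vec_def sum_3)

lemma norm_mirror [simp]: "norm (mirror x) = norm x"
  by (simp add: norm_eq_sqrt_inner)

text \<open>\<open>invert\<close> is the inversion in the unit sphere followed by a reflection, which
  restores the orientation. On the boundary it is \<open>z \<mapsto> -1/z\<close>.\<close>

definition invert :: "real^3 \<Rightarrow> real^3"
  where "invert x = mirror (x /\<^sub>R (norm x)\<^sup>2)"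

lemma invert_alt: "invert x = mirror x /\<^sub>R (x \<bullet> x)"
  using bounded_linear_mirror by (simp add: invert_def linear_simps power2_norm_eq_inner)

lemma invert_uhs: "x \<in> upper_half_space \<Longrightarrow> invert x \<in> upper_half_space"
proof -
  assume x: "x \<in> upper_half_space"
  then have "x \<noteq> 0" by (auto simp: upper_half_space_def)
  then show ?thesis using uhs_pos[OF x] by (simp add: upper_half_space_def invert_alt)
qed

lemma mirror_scaleR [simp]: "mirror (r *\<^sub>R x) = r *\<^sub>R mirror x"
  using bounded_linear_mirror by (simp add: linear_simps)

lemma invert_invert: "x \<noteq> 0 \<Longrightarrow> invert (invert x) = x"
  unfolding invert_alt by simp

lemma has_derivative_invert:
  assumes "x \<noteq> 0"
  shows "(invert has_derivative (\<lambda>u. mirror u /\<^sub>R (x \<bullet> x) - (2 * (x \<bullet> u) / (x \<bullet> x)\<^sup>2) *\<^sub>R mirror x)) (at x)"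
proof -
  have "((\<lambda>x. inverse (x \<bullet> x)) has_derivative
     (\<lambda>u. - (inverse (x \<bullet> x) * (x \<bullet> u + u \<bullet> x) * inverse (x \<bullet> x)))) (at x)"
    using assms by (intro Deriv.has_derivative_inverse has_derivative_inner has_derivative_ident) auto
  from has_derivative_scaleR[OF this bounded_linear_imp_has_derivative[OF bounded_linear_mirror]]
  have "(invert has_derivative (\<lambda>u. inverse (x \<bullet> x) *\<^sub>R mirror u +
     - (inverse (x \<bullet> x) * (x \<bullet> u + u \<bullet> x) * inverse (x \<bullet> x)) *\<^sub>R mirror x)) (at x)"
    by (simp add: invert_alt[abs_def])
  moreover have "- (inverse (x \<bullet> x) * (x \<bullet> u + u \<bullet> x) * inverse (x \<bullet> x)) = - (2 * (x \<bullet> u) / (x \<bullet> x)\<^sup>2)" for u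
    by (simp add: inner_commute[of u] power2_eq_square divide_inverse)
  ultimately show ?thesis by simp
qed

text \<open>The derivative is, up to scale, the product of two reflections, whence the
  positive determinant.\<close>

lemma det_invert:
  assumes "x \<noteq> 0"
  shows "det (matrix (\<lambda>u. mirror u /\<^sub>R (x \<bullet> x) - (2 * (x \<bullet> u) / (x \<bullet> x)\<^sup>2) *\<^sub>R mirror x)) > 0"
proof -
  define r where "r = x \<bullet> x"
  have r: "r > 0" using assms by (simp add: r_def)
  have r': "r = (x $ 1)\<^sup>2 + (x $ 2)\<^sup>2 + (x $ 3)\<^sup>2"
    by (simp add: r_def inner_vec_def sum_3 power2_eq_square)
  define q k where qk: "q = inverse r" "k = 2 * q"
  have "(\<lambda>u. mirror u /\<^sub>R r - (2 * (x \<bullet> u) / r\<^sup>2) *\<^sub>R mirror x) = (\<lambda>u. q *\<^sub>R (mirror u - (k * (x \<bullet> u)) *\<^sub>R mirror x))"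
    by (simp add: qk fun_eq_iff scaleR_diff_right power2_eq_square divide_inverse mult_ac)
  moreover have "det (matrix (\<lambda>u. q *\<^sub>R (mirror u - (k * (x \<bullet> u)) *\<^sub>R mirror x))) = q ^ 3 * (k * r - 1)"
    by (simp add: det_3 matrix_def inner_vec_def sum_3 axis_def r') (simp add: algebra_simps power2_eq_square power3_eq_cube)
  moreover have "k * r - 1 = 1" using r by (simp add: qk)
  ultimately have "det (matrix (\<lambda>u. mirror u /\<^sub>R r - (2 * (x \<bullet> u) / r\<^sup>2) *\<^sub>R mirror x)) = q ^ 3" by simp
  then show ?thesis using r unfolding r_def[symmetric] by (simp add: qk)
qed

lemma cosh_dist_invert:
  assumes "x \<in> upper_half_space" "y \<in> upper_half_space"
  shows "cosh_dist (invert x) (invert y) = cosh_dist x y"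
proof -
  have nz: "x \<noteq> 0" "y \<noteq> 0" using assms by (auto simp: upper_half_space_def)
  have "(dist (invert x) (invert y))\<^sup>2 = (dist x y)\<^sup>2 / ((x \<bullet> x) * (y \<bullet> y))"
    unfolding invert_alt dist_norm power2_norm_eq_inner inner_diff_left inner_diff_right
    using nz by (simp add: inner_commute field_simps)
  then show ?thesis using nz uhs_pos[OF assms(1)] uhs_pos[OF assms(2)]
    by (simp add: cosh_dist_def invert_alt field_simps)
qed

text \<open>Here \<open>a\<close> and \<open>b\<close> are the entries of the first row of the matrix with base
  point \<open>pt z m\<close> and bottom row \<open>(c, d)\<close>, which become the bottom row after left
  multiplication by \<open>mat2 0 (-1) 1 0\<close>. The right-hand sides are the derivative of
  \<open>invert\<close>, up to scale.\<close>

lemma dir_invert: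
  fixes z c d :: complex and m :: real
  defines "a \<equiv> z * c + cnj d * m" and "b \<equiv> z * d - cnj c * m"
  shows "dir1 a b = ((cmod z)\<^sup>2 + m\<^sup>2) *\<^sub>R mirror (dir1 c d) - (2 * (pt z m \<bullet> dir1 c d)) *\<^sub>R mirror (pt z m)"
    "dir2 a b = ((cmod z)\<^sup>2 + m\<^sup>2) *\<^sub>R mirror (dir2 c d) - (2 * (pt z m \<bullet> dir2 c d)) *\<^sub>R mirror (pt z m)"
    "dir3 a b = ((cmod z)\<^sup>2 + m\<^sup>2) *\<^sub>R mirror (dir3 c d) - (2 * (pt z m \<bullet> dir3 c d)) *\<^sub>R mirror (pt z m)"
    "(cmod a)\<^sup>2 + (cmod b)\<^sup>2 = ((cmod z)\<^sup>2 + m\<^sup>2) * ((cmod c)\<^sup>2 + (cmod d)\<^sup>2)"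
  unfolding a_def b_def dir1_def dir2_def dir3_def inner_pt cmod_power2
  by (simp_all add: vec_eq_iff forall_3 power2_eq_square) (simp_all add: algebra_simps)

lemma realizes_inversion: "realizes invert (mat2 0 (-1) 1 0)"
  unfolding realizes_def
proof (intro conjI ballI allI impI)
  have nz: "x \<noteq> 0" if "x \<in> upper_half_space" for x using that by (auto simp: upper_half_space_def)
  show "op_isometry invert"
  proof (rule op_isometryI)
    show "hyp_isometry invert"
      by (rule hyp_isometryI[OF bij_betw_involution[of _ _ invert] cosh_dist_invert]) (auto simp: invert_uhs invert_invert nz)
    show "\<exists>D. (invert has_derivative D) (at x) \<and> det (matrix D) > 0" if "x \<in> upper_half_space" for x
      using has_derivative_invert det_invert nz[OF that] by blast
  qed
  fix A assume A: "A \<in> SL2"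
  define z m c d where defs: "z = cpart (base A)" "m = 1 / row_norm A" "c = A $ 2 $ 1" "d = A $ 2 $ 2"
  define R where "R = (cmod z)\<^sup>2 + m\<^sup>2"
  have x: "base A = pt z m" using pt_cpart[of "base A"] by (simp add: defs)
  have xx: "base A \<bullet> base A = R" unfolding R_def x norm_pt_sq[symmetric] by (rule power2_norm_eq_inner[symmetric])
  have m: "m > 0" using row_norm_pos[OF A] by (simp add: defs)
  have R: "R > 0" using m by (simp add: R_def add_nonneg_pos)
  have n: "row_norm A = (cmod c)\<^sup>2 + (cmod d)\<^sup>2" by (simp add: row_norm_def defs)
  have a: "A $ 1 $ 1 = z * c + cnj d * m" and b: "A $ 1 $ 2 = z * d - cnj c * m"
    using SL2_first_row[OF A] by (simp_all add: defs)
  let ?B = "mat2 0 (-1) 1 0 ** A"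
  have frB: "?B $ 2 $ 1 = z * c + cnj d * m" "?B $ 2 $ 2 = z * d - cnj c * m" by (simp_all add: a b)
  have nB: "row_norm ?B = R * row_norm A"
    unfolding row_norm_def[of ?B] frB R_def n by (rule dir_invert(4))
  have fD: "frechet_derivative invert (at (base A)) = (\<lambda>u. mirror u /\<^sub>R R - (2 * (base A \<bullet> u) / R\<^sup>2) *\<^sub>R mirror (base A))"
    using frechet_derivative_at[OF has_derivative_invert[OF nz[OF base_uhs[OF A]]]] xx by simp
  have key: "(1 / (R * row_norm A)\<^sup>2) *\<^sub>R (R *\<^sub>R mirror v - (2 * (pt z m \<bullet> v)) *\<^sub>R mirror (pt z m))
    = frechet_derivative invert (at (base A)) ((1 / (row_norm A)\<^sup>2) *\<^sub>R v)" for v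
    using R row_norm_pos[OF A] unfolding fD unfolding x by (simp add: scaleR_diff_right power2_eq_square field_simps)
  have "base ?B = invert (base A)"
  proof -
    have nc: "complex_of_real (row_norm A) \<noteq> 0" "complex_of_real R \<noteq> 0" using row_norm_pos[OF A] R by auto
    have "- c * cnj (z * c + cnj d * m) + (- d) * cnj (z * d - cnj c * m) = - cnj z * complex_of_real (row_norm A)"
      unfolding of_row_norm by (simp add: defs algebra_simps)
    then have "(- c * cnj (z * c + cnj d * m) + (- d) * cnj (z * d - cnj c * m)) / complex_of_real (row_norm ?B) = - cnj z / R"
      unfolding nB using nc by simp
    moreover have "?B $ 1 $ 1 = - c" "?B $ 1 $ 2 = - d" by (simp_all add: defs)
    moreover have "1 / row_norm ?B = m / R" by (simp add: nB defs)
    moreover have "invert (base A) = pt (- cnj z / R) (m / R)"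
      unfolding invert_alt xx unfolding x mirror_pt pt_arith
      by (simp add: pt_eq_iff divide_inverse mult.commute scaleR_conv_of_real)
    ultimately show ?thesis unfolding base_def[of ?B] frB by simp
  qed
  then show "spin_proj ?B = push_frame invert (spin_proj A)"
    by (simp only: spin_proj_def push_frame.simps axis1_def axis2_def axis3_def nB frB key[symmetric] dir_invert defs(3,4)[symmetric] R_def[symmetric])
next
  fix k :: "complex^2" assume k: "k \<noteq> 0"
  note id = filterlim_ident[of "ideal_nhds (ideal_of k)"]
  note uhs = eventually_mono[OF filterlim_ideal_uhs[OF id] invert_uhs]
  have ideal: "ideal_of (mat2 0 (-1) 1 0 *v k) = (if k $ 1 = 0 then Infty else Fin (- k $ 2 / k $ 1))"
    by (simp add: ideal_of_def)
  show "ideal_maps_to invert (ideal_of k) (ideal_of (mat2 0 (-1) 1 0 *v k))"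
  proof (cases "k $ 2 = 0")
    case True
    then have k1: "k $ 1 \<noteq> 0" using k by (auto simp: vec_eq_iff forall_2)
    have eq: "ideal_of k = Infty" using True by (simp add: ideal_of_def)
    have "((\<lambda>x. x /\<^sub>R (norm x)\<^sup>2) \<longlongrightarrow> 0) (ideal_nhds (ideal_of k))"
      by (rule inversion_tendsto_0) (use id in \<open>simp add: eq filterlim_ideal_Infty del: ideal_nhds.simps\<close>)
    from bounded_linear.tendsto[OF bounded_linear_mirror this]
    moreover have "mirror 0 = pt 0 0" by (simp add: vec_eq_iff forall_3)
    ultimately have "(invert \<longlongrightarrow> pt 0 0) (ideal_nhds (ideal_of k))"
      unfolding invert_def[abs_def] by simp
    then show ?thesis using uhs k1 unfolding ideal_maps_to_def ideal by (simp add: filterlim_ideal_Fin True del: ideal_nhds.simps)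
  next
    case False
    define w where "w = k $ 1 / k $ 2"
    have eq: "ideal_of k = Fin w" using False by (simp add: ideal_of_def w_def)
    have lim: "((\<lambda>x. x) \<longlongrightarrow> pt w 0) (ideal_nhds (ideal_of k))"
      using id by (simp add: eq filterlim_ideal_Fin del: ideal_nhds.simps)
    show ?thesis
    proof (cases "k $ 1 = 0")
      case True
      have "LIM x (ideal_nhds (ideal_of k)). inverse (norm x) :> at_top"
      proof (rule filterlim_inverse_at_top)
        show "((\<lambda>x. norm x) \<longlongrightarrow> 0) (ideal_nhds (ideal_of k))"
          using tendsto_norm[OF lim] True by (simp add: w_def pt_def[of 0 0] norm_eq_zero[THEN iffD2] vec_eq_iff forall_3)
        show "eventually (\<lambda>x. 0 < norm (x::real^3)) (ideal_nhds (ideal_of k))"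
          by (rule eventually_mono[OF filterlim_ideal_uhs[OF id]]) (auto simp: upper_half_space_def)
      qed
      moreover have "norm (invert x) = inverse (norm x)" for x
        by (cases "x = 0") (simp_all add: invert_def power2_eq_square)
      ultimately have "LIM x (ideal_nhds (ideal_of k)). invert x :> at_infinity"
        by (intro filterlim_norm_at_top_imp_at_infinity) simp
      then show ?thesis using uhs unfolding ideal_maps_to_def ideal by (simp add: filterlim_ideal_Infty True del: ideal_nhds.simps)
    next
      case k1: False
      then have w: "w \<noteq> 0" using False by (simp add: w_def)
      have p: "pt w 0 \<noteq> 0" using w by (metis cpart_pt bounded_linear_cpart linear_simps(3))
      have "continuous (at (pt w 0)) invert"
        using has_derivative_invert[OF p] by (rule has_derivative_continuous)
      then have "(invert \<longlongrightarrow> invert (pt w 0)) (ideal_nhds (ideal_of k))"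
        using lim by (rule isCont_tendsto_compose)
      moreover have "invert (pt w 0) = pt (- k $ 2 / k $ 1) 0"
      proof -
        have "invert (pt w 0) = pt (inverse ((cmod w)\<^sup>2) *\<^sub>R (- cnj w)) 0"
          unfolding invert_alt power2_norm_eq_inner[symmetric] norm_pt_sq mirror_pt pt_arith by simp
        also have "inverse ((cmod w)\<^sup>2) *\<^sub>R (- cnj w) = - (1 / w)"
          unfolding scaleR_conv_of_real of_real_inverse cmod_sq using w by (simp add: divide_simps)
        also have "- (1 / w) = - k $ 2 / k $ 1" by (simp add: w_def)
        finally show ?thesis .
      qed
      ultimately show ?thesis using uhs k1 unfolding ideal_maps_to_def ideal by (simp add: filterlim_ideal_Fin del: ideal_nhds.simps)
    qed
  qed
qed

lemma realizes_lower: "\<exists>\<phi>. realizes \<phi> (mat2 1 0 w 1)"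
proof -
  let ?J = "mat2 0 (-1) 1 0"
  have "- (?J ** mat2 1 (- w) 0 1 ** ?J) = mat2 1 0 w 1"
    by (simp add: mat2_eq_iff)
  moreover have "realizes (invert \<circ> (\<lambda>x. x + pt (- w) 0) \<circ> invert) (?J ** mat2 1 (- w) 0 1 ** ?J)"
    by (intro realizes_mult realizes_translation realizes_inversion) simp_all
  ultimately show ?thesis using realizes_uminus by metis
qed

text \<open>Translations and \<open>invert\<close> suffice: conjugating translations by the inversion
  gives the lower unipotent matrices, and a matrix of determinant \<open>1\<close> with non-zero lower
  left entry is a product of an upper, a lower and an upper unipotent matrix. The
  remaining matrices acquire such an entry after multiplication by the matrix of the
  inversion.\<close>

lemma SL2_realized:
  assumes "B \<in> SL2" shows "\<exists>\<phi>. realizes \<phi> B"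
proof -
  have *: "\<exists>\<phi>. realizes \<phi> C" if C: "C \<in> SL2" and nz: "C $ 2 $ 1 \<noteq> 0" for C
  proof -
    define c where "c = C $ 2 $ 1"
    obtain \<psi> where \<psi>: "realizes \<psi> (mat2 1 0 c 1)" using realizes_lower by blast
    let ?x = "(C $ 1 $ 1 - 1) / c" and ?y = "(C $ 2 $ 2 - 1) / c"
    have "C = mat2 1 ?x 0 1 ** mat2 1 0 c 1 ** mat2 1 ?y 0 1"
      using C nz unfolding SL2_iff by (simp add: mat2_eq_iff c_def[symmetric] field_simps)
    moreover have "realizes ((\<lambda>x. x + pt ?x 0) \<circ> \<psi> \<circ> (\<lambda>x. x + pt ?y 0)) (mat2 1 ?x 0 1 ** mat2 1 0 c 1 ** mat2 1 ?y 0 1)"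
      by (intro realizes_mult realizes_translation \<psi>) simp_all
    ultimately show ?thesis by metis
  qed
  show ?thesis
  proof (cases "B $ 2 $ 1 = 0")
    case True
    let ?J = "mat2 0 (-1) 1 0"
    have JB: "?J ** B \<in> SL2" using assms by (intro SL2_mult) simp_all
    have "(?J ** B) $ 2 $ 1 \<noteq> 0" using True assms by (auto simp: SL2_iff)
    then obtain \<psi> where "realizes \<psi> (?J ** B)" using *[OF JB] by blast
    from realizes_uminus[OF realizes_mult[OF realizes_inversion this JB]]
    have "realizes (invert \<circ> \<psi>) (- (?J ** (?J ** B)))" .
    moreover have "- (?J ** (?J ** B)) = B" by (simp add: mat2_eq_iff)
    ultimately show ?thesis by auto
  qed (use * assms in blast)
qed

section \<open>Every frame comes from a matrix\<close>

definition of_base_row :: "real^3 \<Rightarrow> complex \<Rightarrow> complex \<Rightarrow> complex^2^2"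
  where "of_base_row x c d = mat2 (cpart x * c + cnj d * x $ 3) (cpart x * d - cnj c * x $ 3) c d"

lemma of_base_row_base:
  assumes "A \<in> SL2" shows "of_base_row (base A) (A $ 2 $ 1) (A $ 2 $ 2) = A"
  using SL2_first_row[OF assms] by (simp add: of_base_row_def mat2_eq_iff)

lemma base_of_base_row:
  assumes "(cmod c)\<^sup>2 + (cmod d)\<^sup>2 = 1 / x $ 3" "x \<in> upper_half_space"
  shows "of_base_row x c d \<in> SL2" "base (of_base_row x c d) = x" "row_norm (of_base_row x c d) = 1 / x $ 3"
proof -
  have x3: "x $ 3 > 0" using uhs_pos[OF assms(2)] .
  show rn: "row_norm (of_base_row x c d) = 1 / x $ 3"
    using assms by (simp add: row_norm_def of_base_row_def)
  have *: "c * cnj c + d * cnj d = 1 / complex_of_real (x $ 3)"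
    using arg_cong[OF assms(1), of complex_of_real] by (simp add: cmod_sq[symmetric])
  have "(cpart x * c + cnj d * x $ 3) * d - (cpart x * d - cnj c * x $ 3) * c = (c * cnj c + d * cnj d) * x $ 3"
    by (simp add: algebra_simps)
  also have "\<dots> = 1" using x3 unfolding * by simp
  finally show "of_base_row x c d \<in> SL2" by (simp add: of_base_row_def)
  have "(cpart x * c + cnj d * x $ 3) * cnj c + (cpart x * d - cnj c * x $ 3) * cnj d = cpart x * (c * cnj c + d * cnj d)"
    by (simp add: algebra_simps)
  also have "\<dots> = cpart x / x $ 3" unfolding * by simp
  finally have "(cpart x * c + cnj d * x $ 3) * cnj c + (cpart x * d - cnj c * x $ 3) * cnj d = cpart x / x $ 3" .
  then have "base (of_base_row x c d) = pt (cpart x) (x $ 3)"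
    unfolding base_def rn using x3 by (simp add: of_base_row_def)
  then show "base (of_base_row x c d) = x" by simp
qed

lemma SL2_eqI:
  assumes "A \<in> SL2" "B \<in> SL2" "base A = base B" "A $ 2 $ 1 = B $ 2 $ 1" "A $ 2 $ 2 = B $ 2 $ 2"
  shows "A = B"
  by (metis assms of_base_row_base)

text \<open>The products \<open>c\<^sup>2\<close>, \<open>c * d\<close>, \<open>d\<^sup>2\<close> of the bottom row of a matrix, read off
  from its frame. They determine the bottom row up to a common sign, and this sign is all
  that a frame forgets.\<close>

definition quad11 :: "frame \<Rightarrow> complex"
  where "quad11 f = (case f of (x, f1, f2, f3) \<Rightarrow> cnj (- \<i> * cpart f3 - cpart f2) / (2 * (x $ 3)\<^sup>2))"
definition quad12 :: "frame \<Rightarrow> complex"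
  where "quad12 f = (case f of (x, f1, f2, f3) \<Rightarrow> cnj (cpart f1) / (2 * (x $ 3)\<^sup>2))"
definition quad22 :: "frame \<Rightarrow> complex"
  where "quad22 f = (case f of (x, f1, f2, f3) \<Rightarrow> cnj (cpart f2 - \<i> * cpart f3) / (2 * (x $ 3)\<^sup>2))"

lemma cpart_scaleR [simp]: "cpart (r *\<^sub>R x) = r *\<^sub>R cpart x"
  by (simp add: complex_eq_iff)

lemma cpart_axis:
  "cpart (axis1 A) = 2 * cnj (A $ 2 $ 1) * cnj (A $ 2 $ 2) / (row_norm A)\<^sup>2"
  "cpart (axis2 A) = ((cnj (A $ 2 $ 2))\<^sup>2 - (cnj (A $ 2 $ 1))\<^sup>2) / (row_norm A)\<^sup>2"
  "cpart (axis3 A) = \<i> * ((cnj (A $ 2 $ 2))\<^sup>2 + (cnj (A $ 2 $ 1))\<^sup>2) / (row_norm A)\<^sup>2"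
  unfolding axis1_def axis2_def axis3_def dir1_def dir2_def dir3_def cpart_scaleR cpart_pt
  by (simp_all add: scaleR_conv_of_real)

lemma quad_spin_proj:
  assumes "A \<in> SL2"
  shows "quad11 (spin_proj A) = (A $ 2 $ 1)\<^sup>2" "quad12 (spin_proj A) = A $ 2 $ 1 * A $ 2 $ 2" "quad22 (spin_proj A) = (A $ 2 $ 2)\<^sup>2"
proof -
  define N where "N = complex_of_real (row_norm A)"
  have nz: "N \<noteq> 0" "cnj N = N" using row_norm_pos[OF assms] by (simp_all add: N_def)
  show "quad11 (spin_proj A) = (A $ 2 $ 1)\<^sup>2" "quad12 (spin_proj A) = A $ 2 $ 1 * A $ 2 $ 2" "quad22 (spin_proj A) = (A $ 2 $ 2)\<^sup>2"
    by (simp_all add: quad11_def quad12_def quad22_def spin_proj_def cpart_axis N_def[symmetric])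
     (use nz in \<open>simp_all add: field_simps\<close>)
qed

lemma square_pair_eq:
  fixes c d c' d' :: complex
  assumes "c\<^sup>2 = c'\<^sup>2" "c * d = c' * d'" "d\<^sup>2 = d'\<^sup>2"
  shows "c = c' \<and> d = d' \<or> c = - c' \<and> d = - d'"
  using assms by (auto simp: power2_eq_iff)

lemma spin_proj_eq_iff:
  assumes "A \<in> SL2" "B \<in> SL2"
  shows "spin_proj A = spin_proj B \<longleftrightarrow> A = B \<or> A = - B"
proof
  assume eq: "spin_proj A = spin_proj B"
  then have base: "base A = base B" by (simp add: spin_proj_def)
  have "(A $ 2 $ 1)\<^sup>2 = (B $ 2 $ 1)\<^sup>2" "A $ 2 $ 1 * A $ 2 $ 2 = B $ 2 $ 1 * B $ 2 $ 2" "(A $ 2 $ 2)\<^sup>2 = (B $ 2 $ 2)\<^sup>2"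
    using quad_spin_proj[OF assms(1)] quad_spin_proj[OF assms(2)] eq by simp_all
  from square_pair_eq[OF this] show "A = B \<or> A = - B"
  proof
    assume "A $ 2 $ 1 = B $ 2 $ 1 \<and> A $ 2 $ 2 = B $ 2 $ 2"
    then show ?thesis using SL2_eqI[OF assms base] by simp
  next
    have mB: "- B \<in> SL2" using assms(2) by (simp add: SL2_iff)
    have "base (- B) = base B" using spin_proj_uminus[of B] by (simp add: spin_proj_def)
    moreover assume "A $ 2 $ 1 = - B $ 2 $ 1 \<and> A $ 2 $ 2 = - B $ 2 $ 2"
    ultimately show ?thesis using SL2_eqI[OF assms(1) mB] base by simp
  qed
qed (auto simp: spin_proj_uminus)

lemma cross_orthonormal:
  fixes u v w :: "real^3"
  assumes "u \<bullet> u = 1" "v \<bullet> v = 1" "w \<bullet> w = 1" "u \<bullet> v = 0" "u \<bullet> w = 0" "v \<bullet> w = 0" "cross3 u v \<bullet> w > 0"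
  shows "w = cross3 u v" "u = cross3 v w" "v = cross3 w u"
proof -
  have lagrange: "cross3 x (cross3 y z) = (x \<bullet> z) *\<^sub>R y - (x \<bullet> y) *\<^sub>R z" for x y z :: "real^3"
    by (simp add: cross3_simps forall_3)
  have h: "cross3 u v \<bullet> cross3 u v = 1"
    using norm_cross_dot[of u v] assms by (simp add: power2_norm_eq_inner power_mult_distrib)
  have "cross3 w (cross3 u v) = 0" using assms by (simp add: lagrange inner_commute)
  then have "(w \<bullet> cross3 u v)\<^sup>2 = 1"
    using norm_cross_dot[of w "cross3 u v"] assms h by (simp add: power2_norm_eq_inner power_mult_distrib)
  then have "w \<bullet> cross3 u v = 1" using assms(7) by (simp add: power2_eq_1_iff inner_commute)
  then have "(w - cross3 u v) \<bullet> (w - cross3 u v) = 0"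
    using assms h by (simp add: inner_diff inner_commute)
  then show w: "w = cross3 u v" by simp
  show "u = cross3 v w" "v = cross3 w u" using assms(1-4)
    by (simp_all add: w lagrange inner_commute cross_skew[of "cross3 u v" u])
qed

lemma orthonormal_rows:
  fixes u v w :: "real^3"
  assumes "u \<bullet> u = 1" "v \<bullet> v = 1" "w \<bullet> w = 1" "u \<bullet> v = 0" "u \<bullet> w = 0" "v \<bullet> w = 0"
  shows "u $ i * u $ j + v $ i * v $ j + w $ i * w $ j = (if i = j then 1 else 0)"
proof -
  let ?P = "vector [u, v, w] :: real^3^3"
  have "?P ** transpose ?P = mat 1"
    using assms by (simp add: vec_eq_iff forall_3 matrix_matrix_mult_def transpose_def mat_def inner_vec_def sum_3 mult.commute)
  then have "transpose ?P ** ?P = mat 1" using matrix_left_right_inverse by blast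
  then have "(transpose ?P ** ?P) $ i $ j = (mat 1 :: real^3^3) $ i $ j" by simp
  then show ?thesis by (simp add: matrix_matrix_mult_def transpose_def mat_def sum_3)
qed

lemma sum_squares_cpart:
  fixes u v w :: "real^3"
  assumes "u \<bullet> u = 1" "v \<bullet> v = 1" "w \<bullet> w = 1" "u \<bullet> v = 0" "u \<bullet> w = 0" "v \<bullet> w = 0"
  shows "(cpart u)\<^sup>2 + (cpart v)\<^sup>2 + (cpart w)\<^sup>2 = 0" "(cmod (cpart u))\<^sup>2 + (cmod (cpart v))\<^sup>2 + (cmod (cpart w))\<^sup>2 = 2"
  using orthonormal_rows[OF assms, of 1 1] orthonormal_rows[OF assms, of 2 2] orthonormal_rows[OF assms, of 1 2]
  unfolding cmod_power2 by (simp_all add: complex_eq_iff power2_eq_square)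

lemma spinor_of_quadratic:
  fixes P Q R :: complex
  assumes "P * R = Q\<^sup>2"
  shows "\<exists>c d. c\<^sup>2 = P \<and> c * d = Q \<and> d\<^sup>2 = R"
proof (cases "R = 0")
  case True
  then show ?thesis using assms by (intro exI[of _ "csqrt P"] exI[of _ 0]) simp
next
  case False
  then have "csqrt R \<noteq> 0" by simp
  then show ?thesis using assms False
    by (intro exI[of _ "Q / csqrt R"] exI[of _ "csqrt R"]) (simp add: power_divide field_simps)
qed

lemma eq_from_cross:
  assumes "u = cross3 v w" "u' = cross3 v' w'" "cpart v = cpart v'" "cpart w = cpart w'"
  shows "u $ 3 = u' $ 3"
  using assms by (auto simp: cross3_def complex_eq_iff)

text \<open>For an orthonormal frame the complex parts \<open>G1\<close>, \<open>G2\<close>, \<open>G3\<close> of the three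
  vectors satisfy \<open>G1\<^sup>2 + G2\<^sup>2 + G3\<^sup>2 = 0\<close>, since the first two rows of an orthogonal
  matrix are orthonormal. This is exactly the condition for the three numbers read off as
  \<open>c\<^sup>2\<close>, \<open>c * d\<close>, \<open>d\<^sup>2\<close> to come from a pair \<open>(c, d)\<close>. The heights of the vectors then
  agree as well, because in a right-handed orthonormal frame each vector is the cross
  product of the other two.\<close>

lemma frames_spin_proj:
  assumes "f \<in> frames" shows "\<exists>A\<in>SL2. spin_proj A = f"
proof -
  obtain x f1 f2 f3 where f: "f = (x, f1, f2, f3)" by (cases f) auto
  define t where "t = x $ 3"
  define u v w where uvw: "u = f1 /\<^sub>R t" "v = f2 /\<^sub>R t" "w = f3 /\<^sub>R t"
  have x: "x \<in> upper_half_space" using assms by (simp add: f frames_def)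
  then have t: "t > 0" by (simp add: t_def upper_half_space_def)
  have orth: "u \<bullet> u = 1" "v \<bullet> v = 1" "w \<bullet> w = 1" "u \<bullet> v = 0" "u \<bullet> w = 0" "v \<bullet> w = 0"
    using assms t by (simp_all add: f frames_def hyp_inner_def uvw t_def[symmetric] power2_eq_square divide_simps)
  have "hyp_inner x (hyp_cross x f1 f2) f3 = (cross3 f1 f2 \<bullet> f3) / t ^ 3"
    using t by (simp add: hyp_inner_def hyp_cross_def t_def power2_eq_square power3_eq_cube)
  also have "\<dots> = cross3 u v \<bullet> w"
    using t by (simp add: uvw cross_mult_left cross_mult_right power3_eq_cube divide_inverse)
  finally have "cross3 u v \<bullet> w > 0" using assms by (simp add: f frames_def)
  note cr = cross_orthonormal[OF orth this]
  define G1 G2 G3 where G: "G1 = cpart u" "G2 = cpart v" "G3 = cpart w"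
  have G0: "G1\<^sup>2 + G2\<^sup>2 + G3\<^sup>2 = 0" and G2: "(cmod G1)\<^sup>2 + (cmod G2)\<^sup>2 + (cmod G3)\<^sup>2 = 2"
    using sum_squares_cpart[OF orth] by (simp_all add: G)
  have "(- \<i> * G3 - G2) * (G2 - \<i> * G3) = - (G2\<^sup>2 + G3\<^sup>2)"
    by (simp add: algebra_simps power2_eq_square)
  also have "\<dots> = G1\<^sup>2" using G0 by algebra
  finally have "(- \<i> * G3 - G2) * (G2 - \<i> * G3) = G1\<^sup>2" .
  moreover have "(cnj X / (2 * t)) * (cnj Y / (2 * t)) = cnj (X * Y) / (complex_of_real (2 * t))\<^sup>2" for X Y
    by (simp add: power2_eq_square)
  ultimately have "(cnj (- \<i> * G3 - G2) / (2 * t)) * (cnj (G2 - \<i> * G3) / (2 * t)) = (cnj G1 / (2 * t))\<^sup>2"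
    by (simp only: complex_cnj_power power_divide)
  then obtain c d where cd: "c\<^sup>2 = cnj (- \<i> * G3 - G2) / (2 * t)" "c * d = cnj G1 / (2 * t)" "d\<^sup>2 = cnj (G2 - \<i> * G3) / (2 * t)"
    using spinor_of_quadratic by blast
  have norm: "(cmod c)\<^sup>2 + (cmod d)\<^sup>2 = 1 / t"
  proof (rule power2_eq_imp_eq)
    have "((cmod c)\<^sup>2 + (cmod d)\<^sup>2)\<^sup>2 = (cmod (c\<^sup>2))\<^sup>2 + (cmod (d\<^sup>2))\<^sup>2 + 2 * (cmod (c * d))\<^sup>2"
      by (simp add: norm_mult norm_power power2_eq_square algebra_simps)
    also have "\<dots> = ((cmod (- \<i> * G3 - G2))\<^sup>2 + (cmod (G2 - \<i> * G3))\<^sup>2 + 2 * (cmod G1)\<^sup>2) / (4 * t\<^sup>2)"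
      unfolding cd using t by (simp only: norm_divide complex_mod_cnj) (simp add: norm_mult power_divide power_mult_distrib add_divide_distrib)
    also have "(cmod (- \<i> * G3 - G2))\<^sup>2 + (cmod (G2 - \<i> * G3))\<^sup>2 = 2 * (cmod G3)\<^sup>2 + 2 * (cmod G2)\<^sup>2"
      by (simp add: cmod_power2) (simp add: power2_eq_square algebra_simps)
    also have "(2 * (cmod G3)\<^sup>2 + 2 * (cmod G2)\<^sup>2 + 2 * (cmod G1)\<^sup>2) / (4 * t\<^sup>2) = (1 / t)\<^sup>2"
    proof -
      have "2 * (cmod G3)\<^sup>2 + 2 * (cmod G2)\<^sup>2 + 2 * (cmod G1)\<^sup>2 = 4" using G2 by simp
      then show ?thesis by (simp add: power_divide)
    qed
    finally show "((cmod c)\<^sup>2 + (cmod d)\<^sup>2)\<^sup>2 = (1 / t)\<^sup>2" .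
  qed (use t in auto)
  define A where "A = of_base_row x c d"
  have A: "A \<in> SL2" "base A = x" "row_norm A = 1 / t" "A $ 2 $ 1 = c" "A $ 2 $ 2 = d"
    using base_of_base_row[of c d x] norm x by (simp_all add: A_def t_def) (simp_all add: of_base_row_def)
  have cp: "cpart (dir1 c d) = G1 / t" "cpart (dir2 c d) = G2 / t" "cpart (dir3 c d) = G3 / t"
  proof -
    have "cnj c * cnj d = G1 / (2 * t)" using arg_cong[OF cd(2), of cnj] by simp
    then show "cpart (dir1 c d) = G1 / t" using t by (simp add: dir1_def field_simps)
    have *: "(cnj c)\<^sup>2 = (- \<i> * G3 - G2) / (2 * t)" "(cnj d)\<^sup>2 = (G2 - \<i> * G3) / (2 * t)"
      using arg_cong[OF cd(1), of cnj] arg_cong[OF cd(3), of cnj] by simp_all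
    show "cpart (dir2 c d) = G2 / t" "cpart (dir3 c d) = G3 / t"
      unfolding dir2_def dir3_def cpart_pt * using t by (simp_all add: field_simps)
  qed
  define u' v' w' where uvw': "u' = t *\<^sub>R dir1 c d" "v' = t *\<^sub>R dir2 c d" "w' = t *\<^sub>R dir3 c d"
  have cr': "w' = cross3 u' v'" "u' = cross3 v' w'" "v' = cross3 w' u'"
    using t by (simp_all add: uvw' cross_mult_left cross_mult_right dir_cross norm cross_skew[of "dir3 c d"])
  have cpe: "cpart u = cpart u'" "cpart v = cpart v'" "cpart w = cpart w'"
    unfolding uvw' cpart_scaleR cp G[symmetric] using t by (simp_all add: scaleR_conv_of_real)
  have "u = u'" "v = v'" "w = w'"
    using eq_from_cross[OF cr(2) cr'(2) cpe(2,3)] eq_from_cross[OF cr(3) cr'(3) cpe(3,1)] eq_from_cross[OF cr(1) cr'(1) cpe(1,2)] cpe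
    by (metis pt_cpart)+
  then have "f1 = t *\<^sub>R u'" "f2 = t *\<^sub>R v'" "f3 = t *\<^sub>R w'" using t by (auto simp: uvw)
  then have "spin_proj A = f"
    by (simp add: spin_proj_def f A axis1_def axis2_def axis3_def uvw' power_divide power2_eq_square)
  then show ?thesis using A(1) by blast
qed

lemma spin_proj_image: "spin_proj ` SL2 = frames"
  using spin_proj_frames frames_spin_proj by blast

section \<open>The double covering of the frame bundle\<close>

lemma tendsto_mat2 [tendsto_intros]:
  assumes "(a \<longlongrightarrow> a') F" "(b \<longlongrightarrow> b') F" "(c \<longlongrightarrow> c') F" "(d \<longlongrightarrow> d') F"
  shows "((\<lambda>x. mat2 (a x) (b x) (c x) (d x)) \<longlongrightarrow> mat2 a' b' c' d') F"
proof (rule vec_tendstoI, rule vec_tendstoI)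
  fix i j :: 2
  show "((\<lambda>x. mat2 (a x) (b x) (c x) (d x) $ i $ j) \<longlongrightarrow> mat2 a' b' c' d' $ i $ j) F"
    using exhaust_2[of i] exhaust_2[of j] assms by auto
qed

lemma continuous_on_mat2 [continuous_intros]:
  assumes "continuous_on S a" "continuous_on S b" "continuous_on S c" "continuous_on S d"
  shows "continuous_on S (\<lambda>x. mat2 (a x) (b x) (c x) (d x))"
  using assms by (auto simp: continuous_on_def intro: tendsto_mat2)

lemma continuous_on_cpart [continuous_intros]: "continuous_on S f \<Longrightarrow> continuous_on S (\<lambda>x. cpart (f x))"
  using bounded_linear.continuous_on[OF bounded_linear_cpart] .

lemma continuous_on_row_norm: "continuous_on S row_norm"
  unfolding row_norm_def[abs_def] by (intro continuous_intros)

lemma continuous_on_base: "continuous_on SL2 base"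
  unfolding base_def[abs_def]
  by (intro continuous_intros continuous_on_row_norm) (use row_norm_pos in force)+

lemma continuous_on_spin_proj: "continuous_on SL2 spin_proj"
  unfolding spin_proj_def[abs_def] axis1_def axis2_def axis3_def dir1_def dir2_def dir3_def
  by (intro continuous_intros continuous_on_row_norm continuous_on_base) (use row_norm_pos in force)+

lemma continuous_on_of_base_row [continuous_intros]:
  assumes "continuous_on S x" "continuous_on S c" "continuous_on S d"
  shows "continuous_on S (\<lambda>y. of_base_row (x y) (c y) (d y))"
  unfolding of_base_row_def by (intro continuous_intros assms)

text \<open>The base point and the bottom row are global coordinates; the height of the
  base point is redundant, being the reciprocal of \<open>row_norm\<close>.\<close>

lemma homeomorphic_SL2: "SL2 homeomorphic ((UNIV :: complex set) \<times> - {0 :: complex \<times> complex})"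
  unfolding homeomorphic_def
proof (intro exI)
  let ?t = "\<lambda>p::complex \<times> complex. 1 / ((cmod (fst p))\<^sup>2 + (cmod (snd p))\<^sup>2)"
  show "homeomorphism SL2 ((UNIV :: complex set) \<times> - {0 :: complex \<times> complex})
     (\<lambda>A. (cpart (base A), A $ 2 $ 1, A $ 2 $ 2)) (\<lambda>(z, p). of_base_row (pt z (?t p)) (fst p) (snd p))"
  proof (rule homeomorphismI)
    have pos: "(cmod (fst p))\<^sup>2 + (cmod (snd p))\<^sup>2 > 0" if "p \<noteq> 0" for p :: "complex \<times> complex"
      using that by (cases p) (auto simp: zero_prod_def intro: add_pos_nonneg add_nonneg_pos)
    show "continuous_on SL2 (\<lambda>A. (cpart (base A), A $ 2 $ 1, A $ 2 $ 2))"
      by (intro continuous_intros continuous_on_base)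
    show "continuous_on ((UNIV :: complex set) \<times> - {0 :: complex \<times> complex}) (\<lambda>(z, p). of_base_row (pt z (?t p)) (fst p) (snd p))"
      unfolding case_prod_beta by (intro continuous_intros) (use pos in force)
    show "(\<lambda>A. (cpart (base A), A $ 2 $ 1, A $ 2 $ 2)) ` SL2 \<subseteq> (UNIV :: complex set) \<times> - {0 :: complex \<times> complex}"
      by (auto simp: zero_prod_def SL2_iff)
    show "(\<lambda>(z, p). of_base_row (pt z (?t p)) (fst p) (snd p)) ` ((UNIV :: complex set) \<times> - {0 :: complex \<times> complex}) \<subseteq> SL2"
      using pos by (auto intro!: base_of_base_row)
    show "(\<lambda>(z, p). of_base_row (pt z (?t p)) (fst p) (snd p)) (cpart (base A), A $ 2 $ 1, A $ 2 $ 2) = A" if "A \<in> SL2" for A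
    proof -
      have "pt (cpart (base A)) (1 / row_norm A) = base A" by (metis base_3 pt_cpart)
      then show ?thesis using of_base_row_base[OF that] by (simp add: row_norm_def)
    qed
    show "(\<lambda>A. (cpart (base A), A $ 2 $ 1, A $ 2 $ 2)) ((\<lambda>(z, p). of_base_row (pt z (?t p)) (fst p) (snd p)) y) = y"
      if "y \<in> (UNIV :: complex set) \<times> - {0 :: complex \<times> complex}" for y
    proof -
      define z p where "z = fst y" "p = snd y"
      then have y: "y = (z, p)" "p \<noteq> 0" using that by (cases y, auto)
      have "base (of_base_row (pt z (?t p)) (fst p) (snd p)) = pt z (?t p)"
        using pos[OF y(2)] by (intro base_of_base_row) auto
      then show ?thesis by (simp add: y) (simp add: of_base_row_def)
    qed
  qed
qed

lemma path_connected_SL2: "path_connected SL2"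
  and locally_path_connected_SL2: "locally path_connected SL2"
proof -
  let ?M = "(UNIV :: complex set) \<times> - {0 :: complex \<times> complex}"
  have "path_connected ?M"
    by (intro path_connected_Times path_connected_punctured_universe) (simp_all add: convex_imp_path_connected)
  then show "path_connected SL2" using homeomorphic_path_connectedness[OF homeomorphic_SL2] by blast
  have "open ?M" by (intro open_Times) auto
  then have "locally path_connected ?M" by (rule open_imp_locally_path_connected)
  then show "locally path_connected SL2"
    using homeomorphic_locally[OF homeomorphic_SL2, of path_connected path_connected] homeomorphic_path_connectedness by blast
qed

lemma continuous_on_quad:
  "continuous_on frames quad11" "continuous_on frames quad12" "continuous_on frames quad22"
  unfolding quad11_def[abs_def] quad12_def[abs_def] quad22_def[abs_def] case_prod_beta
  by (intro continuous_intros; auto simp: frames_def upper_half_space_def)+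

lemma uminus_SL2: "A \<in> SL2 \<Longrightarrow> - A \<in> SL2"
  by (simp add: SL2_iff)

lemma Re_nonzero_iff_square: "Re l \<noteq> 0 \<longleftrightarrow> l\<^sup>2 \<notin> \<real>\<^sub>\<le>\<^sub>0"
proof -
  have "l\<^sup>2 \<in> \<real>\<^sub>\<le>\<^sub>0" if "Re l = 0"
    using that by (auto simp: complex_nonpos_Reals_iff power2_eq_square)
  moreover have False if "Re l \<noteq> 0" "l\<^sup>2 \<in> \<real>\<^sub>\<le>\<^sub>0"
  proof -
    have "Im l = 0" "Re l * Re l \<le> Im l * Im l" using that by (auto simp: complex_nonpos_Reals_iff power2_eq_square)
    then have "Re l * Re l \<le> 0" by simp
    with that(1) show False by (metis not_real_square_gt_zero not_less)
  qed
  ultimately show ?thesis by blast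
qed

text \<open>Near a frame with matrix \<open>A0\<close> the two sheets are separated by the sign of the
  real part of the linear form \<open>l A\<close>, the Hermitian product of the bottom rows of \<open>A\<close> and
  \<open>A0\<close>. Its square is a continuous function \<open>L\<close> of the frame. Where \<open>L\<close> avoids the
  non-positive reals, its principal square root is continuous and recovers \<open>l A\<close>, hence
  the bottom row, from the frame.\<close>

lemma covering_space_spin_proj: "covering_space SL2 spin_proj frames"
proof (rule covering_spaceI[OF continuous_on_spin_proj spin_proj_image])
  fix f0 assume "f0 \<in> frames"
  then obtain A0 where A0: "A0 \<in> SL2" "spin_proj A0 = f0" using frames_spin_proj by blast
  define c0 d0 where cd0: "c0 = cnj (A0 $ 2 $ 1)" "d0 = cnj (A0 $ 2 $ 2)"
  define l where "l A = A $ 2 $ 1 * c0 + A $ 2 $ 2 * d0" for A :: "complex^2^2"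
  define L where "L f = quad11 f * c0\<^sup>2 + 2 * quad12 f * c0 * d0 + quad22 f * d0\<^sup>2" for f
  have L: "L (spin_proj A) = (l A)\<^sup>2" if "A \<in> SL2" for A
    using that by (simp add: L_def l_def quad_spin_proj power2_eq_square algebra_simps)
  define T where "T = {f \<in> frames. L f \<notin> \<real>\<^sub>\<le>\<^sub>0}"
  \<comment> \<open>The local inverse: \<open>c * l A = c\<^sup>2 * c0 + c * d * d0\<close>, and similarly
    for \<open>d\<close>.\<close>
  define s where "s f = of_base_row (fst f) ((quad11 f * c0 + quad12 f * d0) / csqrt (L f)) ((quad12 f * c0 + quad22 f * d0) / csqrt (L f))" for f
  define U where "U = {A \<in> SL2. Re (l A) > 0}"
  define V where "V = {A \<in> SL2. Re (l A) < 0}"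
  have contL: "continuous_on frames L"
    unfolding L_def[abs_def] by (intro continuous_intros continuous_on_quad)
  have l0: "l A0 = row_norm A0"
    by (simp only: l_def cd0 of_row_norm)
  have "f0 \<in> T"
    using A0 row_norm_pos[OF A0(1)] Re_nonzero_iff_square[of "l A0"] by (auto simp: T_def spin_proj_frames L l0)
  have openT: "openin (top_of_set frames) T"
  proof -
    have "T = frames \<inter> L -` (- \<real>\<^sub>\<le>\<^sub>0)" by (auto simp: T_def)
    then show ?thesis using continuous_openin_preimage_gen[OF contL, of "- \<real>\<^sub>\<le>\<^sub>0"] closed_nonpos_Reals_complex
      by (simp add: open_Compl)
  qed
  have contl: "continuous_on SL2 (\<lambda>A. Re (l A))" unfolding l_def by (intro continuous_intros)
  have openU: "openin (top_of_set SL2) U"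
  proof -
    have "U = SL2 \<inter> (\<lambda>A. Re (l A)) -` {0<..}" by (auto simp: U_def)
    then show ?thesis using continuous_openin_preimage_gen[OF contl, of "{0<..}"] by simp
  qed
  have openV: "openin (top_of_set SL2) V"
  proof -
    have "V = SL2 \<inter> (\<lambda>A. Re (l A)) -` {..<0}" by (auto simp: V_def)
    then show ?thesis using continuous_openin_preimage_gen[OF contl, of "{..<0}"] by simp
  qed
  have UV: "\<Union>{U, V} = SL2 \<inter> spin_proj -` T"
  proof (rule set_eqI)
    fix A show "A \<in> \<Union>{U, V} \<longleftrightarrow> A \<in> SL2 \<inter> spin_proj -` T"
      using Re_nonzero_iff_square[of "l A"] by (auto simp: U_def V_def T_def spin_proj_frames L)
  qed
  have s: "s (spin_proj A) = A" if "A \<in> U" for A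
  proof -
    have A: "A \<in> SL2" and l: "Re (l A) > 0" using that by (auto simp: U_def)
    then have nz: "l A \<noteq> 0" by auto
    have "csqrt (L (spin_proj A)) = l A" unfolding L[OF A] using l by (intro csqrt_square) simp
    moreover have "quad11 (spin_proj A) * c0 + quad12 (spin_proj A) * d0 = A $ 2 $ 1 * l A"
      "quad12 (spin_proj A) * c0 + quad22 (spin_proj A) * d0 = A $ 2 $ 2 * l A"
      by (simp_all add: quad_spin_proj[OF A] l_def power2_eq_square algebra_simps)
    ultimately show ?thesis using nz of_base_row_base[OF A] by (simp add: s_def) (simp add: spin_proj_def)
  qed
  have VU: "- A \<in> U \<longleftrightarrow> A \<in> V" for A
  proof -
    have "l (- A) = - l A" by (simp add: l_def)
    then show ?thesis by (simp add: U_def V_def SL2_iff)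
  qed
  have sT: "s f \<in> U \<and> spin_proj (s f) = f" if "f \<in> T" for f
  proof -
    have "f \<in> frames" using that by (simp add: T_def)
    then obtain A where A: "A \<in> SL2" "spin_proj A = f" using frames_spin_proj by blast
    with that UV have "A \<in> U \<or> - A \<in> U" using VU by auto
    then show ?thesis using s[of A] s[of "- A"] A by (auto simp: spin_proj_uminus)
  qed
  have conts: "continuous_on T s"
  proof -
    have c: "continuous_on T quad11" "continuous_on T quad12" "continuous_on T quad22" "continuous_on T L"
      using continuous_on_quad contL by (auto intro: continuous_on_subset simp: T_def)
    have "continuous_on (L ` T) csqrt"
      by (intro continuous_at_imp_continuous_on) (auto simp: T_def continuous_at_csqrt)
    then have "continuous_on T (csqrt \<circ> L)" by (rule continuous_on_compose[OF c(4)])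
    then have "continuous_on T (\<lambda>x. csqrt (L x))" by (simp add: o_def)
    then show ?thesis
      unfolding s_def using c by (intro continuous_intros) (auto simp: T_def)
  qed
  have contp: "continuous_on U spin_proj" "continuous_on V spin_proj"
    using continuous_on_spin_proj by (auto intro: continuous_on_subset simp: U_def V_def)
  have UT: "A \<in> U \<or> A \<in> V \<Longrightarrow> spin_proj A \<in> T" for A
    using UV by blast
  have homU: "homeomorphism U T spin_proj s"
    using sT s UT conts contp by (intro homeomorphismI) auto
  have homV: "homeomorphism V T spin_proj (\<lambda>f. - s f)"
  proof (rule homeomorphismI)
    show "continuous_on T (\<lambda>f. - s f)" by (intro continuous_intros conts)
    show "- s (spin_proj A) = A" if "A \<in> V" for A
      using s[of "- A"] that VU[of A] by (simp add: spin_proj_uminus)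
    show "(\<lambda>f. - s f) ` T \<subseteq> V" using sT VU[of "- s _"] by auto
  qed (use contp UT sT in \<open>auto simp: spin_proj_uminus\<close>)
  have disj: "pairwise disjnt {U, V}"
    by (auto simp: pairwise_def disjnt_def U_def V_def)
  show "\<exists>T. f0 \<in> T \<and> openin (top_of_set frames) T \<and>
     (\<exists>v. \<Union> v = SL2 \<inter> spin_proj -` T \<and> (\<forall>u\<in>v. openin (top_of_set SL2) u) \<and> pairwise disjnt v \<and>
        (\<forall>u\<in>v. \<exists>q. homeomorphism u T spin_proj q))"
    using \<open>f0 \<in> T\<close> openT UV openU openV disj homU homV by (intro exI[of _ T] conjI exI[of _ "{U, V}"]) auto
qed

section \<open>Spin frames as matrices\<close>

text \<open>Injectivity is what allows a spin frame to be recognized from its matrix.\<close>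

definition spin_chart :: "'e::real_normed_vector set \<Rightarrow> ('e \<Rightarrow> frame) \<Rightarrow> ('e \<Rightarrow> complex^2^2) \<Rightarrow> bool"
  where "spin_chart E \<pi> \<Phi> \<longleftrightarrow> covering_space E \<pi> frames \<and> continuous_on E \<Phi> \<and> \<Phi> ` E \<subseteq> SL2 \<and> inj_on \<Phi> E \<and>
    (\<forall>S\<in>E. spin_proj (\<Phi> S) = \<pi> S)"

lemma spin_chartD:
  assumes "spin_chart E \<pi> \<Phi>"
  shows "covering_space E \<pi> frames" "continuous_on E \<Phi>" "inj_on \<Phi> E"
    "S \<in> E \<Longrightarrow> \<Phi> S \<in> SL2" "S \<in> E \<Longrightarrow> spin_proj (\<Phi> S) = \<pi> S"
  using assms by (auto simp: spin_chart_def)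

lemma SL2_neq_uminus: "A \<in> SL2 \<Longrightarrow> A \<noteq> - A"
  by (auto simp: SL2_iff mat2_eq_iff)

lemma lift_unique_SL2:
  fixes T :: "'a::topological_space set"
  assumes "connected T" "continuous_on T F" "continuous_on T G" "F ` T \<subseteq> SL2" "G ` T \<subseteq> SL2"
    "\<And>x. x \<in> T \<Longrightarrow> spin_proj (F x) = spin_proj (G x)" "a \<in> T" "F a = G a" "x \<in> T"
  shows "F x = G x"
proof (rule covering_space_lift_unique[of SL2 spin_proj frames F a G T "spin_proj \<circ> F"])
  show "continuous_on T (spin_proj \<circ> F)"
    using assms(2,4) by (intro continuous_on_compose continuous_on_subset[OF continuous_on_spin_proj]) auto
  show "spin_proj \<circ> F \<in> T \<rightarrow> frames" using assms(4) spin_proj_frames by auto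
qed (use assms covering_space_spin_proj in auto)

text \<open>The covering \<open>\<pi>\<close> lifts to \<open>SL2\<close> because \<open>E\<close> is simply connected. For
  injectivity, suppose that the two points over a frame had the same image \<open>A\<close>. A path in
  \<open>SL2\<close> from \<open>A\<close> to \<open>- A\<close> projects to a loop of frames, which lifts to a path in \<open>E\<close> whose
  image ends at \<open>- A\<close>; but its end point is in the same fibre, where \<open>\<Phi>\<close> only takes the
  value \<open>A\<close>.\<close>

lemma spin_chart_exists:
  assumes "spin_frame_bundle E \<pi>" shows "\<exists>\<Phi>. spin_chart E \<pi> \<Phi>"
proof -
  have cov: "covering_space E \<pi> frames" and sc: "simply_connected E"
    and two: "\<And>f. f \<in> frames \<Longrightarrow> card {S \<in> E. \<pi> S = f} = 2"
    using assms by (auto simp: spin_frame_bundle_def)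
  have "locally path_connected E"
    using covering_space_locally_path_connected_eq[OF cov]
      covering_space_locally_path_connected_eq[OF covering_space_spin_proj] locally_path_connected_SL2 by blast
  have cont: "continuous_on E \<pi>" and im: "\<pi> ` E = frames" using cov by (auto simp: covering_space_def)
  have one: "mat 1 \<in> SL2" by (simp add: SL2_def)
  have "spin_proj (mat 1) \<in> \<pi> ` E" using im spin_proj_frames[OF one] by simp
  then obtain S0 where S0: "S0 \<in> E" "\<pi> S0 = spin_proj (mat 1)" by auto
  obtain \<Phi> where \<Phi>: "continuous_on E \<Phi>" "\<Phi> \<in> E \<rightarrow> SL2" "\<And>S. S \<in> E \<Longrightarrow> spin_proj (\<Phi> S) = \<pi> S"
  proof (rule covering_space_lift_strong[OF covering_space_spin_proj one S0(1) sc \<open>locally path_connected E\<close> cont _ S0(2)])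
    show "\<pi> \<in> E \<rightarrow> frames" using im by auto
  qed (use that in blast)
  have inj: "S = S'" if S: "S \<in> E" "S' \<in> E" "\<Phi> S = \<Phi> S'" for S S'
  proof (rule ccontr)
    assume "S \<noteq> S'"
    have A: "\<Phi> S \<in> SL2" "- \<Phi> S \<in> SL2" using \<Phi>(2) S uminus_SL2 by auto
    then obtain p where p: "path p" "path_image p \<subseteq> SL2" "pathstart p = \<Phi> S" "pathfinish p = - \<Phi> S"
      using path_connected_SL2 unfolding path_connected_def by blast
    have sp: "path (spin_proj \<circ> p)"
      using p continuous_on_subset[OF continuous_on_spin_proj] by (intro path_continuous_image) auto
    have "path_image (spin_proj \<circ> p) \<subseteq> frames" "pathstart (spin_proj \<circ> p) = \<pi> S"
      using p(2,3) spin_proj_frames \<Phi>(3) S(1) by (auto simp: path_image_def pathstart_def)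
    from covering_space_lift_path_strong[OF cov S(1) sp this]
    obtain h where h: "path h" "path_image h \<subseteq> E" "pathstart h = S" "\<And>t. t \<in> {0..1} \<Longrightarrow> \<pi> (h t) = (spin_proj \<circ> p) t"
      by metis
    have hE: "h t \<in> E" if "t \<in> {0..1}" for t using h(2) that by (auto simp: path_image_def)
    have "(\<Phi> \<circ> h) 1 = p 1"
    proof (rule lift_unique_SL2[of "{0..1::real}" _ _ 0])
      show "continuous_on {0..1} (\<Phi> \<circ> h)"
        using h(1) hE by (intro continuous_on_compose continuous_on_subset[OF \<Phi>(1)]) (auto simp: path_def)
      show "continuous_on {0..1} p" using p(1) by (simp add: path_def)
      show "(\<Phi> \<circ> h) ` {0..1} \<subseteq> SL2" using hE \<Phi>(2) by auto
      show "p ` {0..1} \<subseteq> SL2" using p(2) by (auto simp: path_image_def)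
      show "spin_proj ((\<Phi> \<circ> h) t) = spin_proj (p t)" if "t \<in> {0..1}" for t
        using hE[OF that] \<Phi>(3) h(4)[OF that] by simp
      show "(\<Phi> \<circ> h) 0 = p 0" using h(3) p(3) by (simp add: pathstart_def)
    qed auto
    then have h1: "\<Phi> (h 1) = - \<Phi> S" using p(4) by (simp add: pathfinish_def)
    have eq: "\<pi> S' = \<pi> S" using \<Phi>(3) S by metis
    have "\<pi> (h 1) = \<pi> S" using h1 \<Phi>(3) hE[of 1] S(1) spin_proj_uminus by (metis atLeastAtMost_iff order_refl zero_le_one)
    then have sub: "{S, S', h 1} \<subseteq> {R \<in> E. \<pi> R = \<pi> S}" using S hE eq by auto
    have card: "card {R \<in> E. \<pi> R = \<pi> S} = 2" using two im S(1) by blast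
    then have "finite {R \<in> E. \<pi> R = \<pi> S}" by (intro card_ge_0_finite) simp
    then have "card {S, S', h 1} \<le> 2" using card_mono[OF _ sub] card by simp
    then have "h 1 = S \<or> h 1 = S'" using \<open>S \<noteq> S'\<close> by (auto simp: card_insert_if split: if_splits)
    then have "\<Phi> S = - \<Phi> S" using h1 S(3) by auto
    then show False using SL2_neq_uminus[OF A(1)] by simp
  qed
  then show ?thesis using cov \<Phi> by (auto simp: spin_chart_def inj_on_def intro!: exI[of _ \<Phi>])
qed

text \<open>Together with the next lemma this translates the lifted paths that define
  rotations and translations of spin frames into paths of matrices.\<close>

lemma spin_path_lift:
  fixes s t :: real
  assumes "spin_chart E \<pi> \<Phi>" "S \<in> E" "continuous_on (closed_segment s t) F" "F ` closed_segment s t \<subseteq> SL2" "F s = \<Phi> S"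
  shows "\<exists>\<sigma>. continuous_on (closed_segment s t) \<sigma> \<and> \<sigma> s = S \<and>
    (\<forall>r\<in>closed_segment s t. \<sigma> r \<in> E \<and> \<pi> (\<sigma> r) = spin_proj (F r) \<and> \<Phi> (\<sigma> r) = F r)"
proof -
  let ?I = "closed_segment s t"
  note cov = spin_chartD(1)[OF assms(1)] and \<Phi> = spin_chartD(2,4,5)[OF assms(1)]
  have contF: "continuous_on ?I (spin_proj \<circ> F)"
    using assms(3,4) by (intro continuous_on_compose continuous_on_subset[OF continuous_on_spin_proj]) auto
  have imF: "spin_proj \<circ> F \<in> ?I \<rightarrow> frames" using assms(4) spin_proj_frames by auto
  have st: "(spin_proj \<circ> F) s = \<pi> S" using assms(5) \<Phi>(3)[OF assms(2)] by simp
  obtain \<sigma> where \<sigma>: "continuous_on ?I \<sigma>" "\<sigma> \<in> ?I \<rightarrow> E" "\<sigma> s = S" "\<And>r. r \<in> ?I \<Longrightarrow> \<pi> (\<sigma> r) = (spin_proj \<circ> F) r"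
    by (rule covering_space_lift_strong[OF cov assms(2), of s ?I, OF _ _ _ contF imF st])
       (auto simp: convex_imp_simply_connected convex_imp_locally_path_connected)
  have "(\<Phi> \<circ> \<sigma>) r = F r" if "r \<in> ?I" for r
  proof (rule lift_unique_SL2[of ?I "\<Phi> \<circ> \<sigma>" F s r])
    show "continuous_on ?I (\<Phi> \<circ> \<sigma>)" using \<sigma> by (intro continuous_on_compose continuous_on_subset[OF \<Phi>(1)]) auto
    show "spin_proj ((\<Phi> \<circ> \<sigma>) u) = spin_proj (F u)" if "u \<in> ?I" for u
      using \<sigma>(4)[OF that] \<sigma>(2) that \<Phi>(3) by (auto simp: Pi_def)
  qed (use assms \<sigma> \<Phi> that in \<open>auto simp: Pi_def\<close>)
  then show ?thesis using \<sigma> by (auto simp: Pi_def intro!: exI[of _ \<sigma>])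
qed

lemma spin_path_lift_end:
  fixes s t :: real
  assumes "spin_chart E \<pi> \<Phi>" "continuous_on (closed_segment s t) F" "F ` closed_segment s t \<subseteq> SL2" "F s = \<Phi> (\<sigma> s)"
    and "continuous_on (closed_segment s t) \<sigma>" "\<And>r. r \<in> closed_segment s t \<Longrightarrow> \<sigma> r \<in> E \<and> \<pi> (\<sigma> r) = spin_proj (F r)"
  shows "\<Phi> (\<sigma> t) = F t"
proof -
  let ?I = "closed_segment s t"
  note \<Phi> = spin_chartD(2,4,5)[OF assms(1)]
  have "(\<Phi> \<circ> \<sigma>) t = F t"
  proof (rule lift_unique_SL2[of ?I "\<Phi> \<circ> \<sigma>" F s t])
    show "continuous_on ?I (\<Phi> \<circ> \<sigma>)" using assms by (intro continuous_on_compose continuous_on_subset[OF \<Phi>(1)]) auto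
    show "spin_proj ((\<Phi> \<circ> \<sigma>) u) = spin_proj (F u)" if "u \<in> ?I" for u
      using assms(6)[OF that] \<Phi>(3) by auto
  qed (use assms \<Phi> in auto)
  then show ?thesis by simp
qed

section \<open>Rotations of spin frames\<close>

text \<open>Rotations about the first and the second vector of the standard frame, in the
  double cover: after a full turn both equal minus the identity.\<close>

definition rot1 :: "real \<Rightarrow> complex^2^2"
  where "rot1 \<alpha> = mat2 (cis (\<alpha> / 2)) 0 0 (cis (- \<alpha> / 2))"
definition rot2 :: "real \<Rightarrow> complex^2^2"
  where "rot2 \<alpha> = mat2 (cos (\<alpha> / 2)) (\<i> * sin (\<alpha> / 2)) (\<i> * sin (\<alpha> / 2)) (cos (\<alpha> / 2))"

lemma rot_SL2 [simp]: "rot1 \<alpha> \<in> SL2" "rot2 \<alpha> \<in> SL2"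
proof -
  show "rot1 \<alpha> \<in> SL2" by (simp add: rot1_def cis_mult)
  have "complex_of_real (cos (\<alpha>/2)) * cos (\<alpha>/2) + complex_of_real (sin (\<alpha>/2)) * sin (\<alpha>/2) = 1"
    by (simp only: of_real_mult[symmetric] of_real_add[symmetric]) (simp flip: power2_eq_square)
  then show "rot2 \<alpha> \<in> SL2" by (simp add: rot2_def algebra_simps)
qed

lemma dir_rot:
  fixes C S :: real
  defines "u \<equiv> Complex C S"
  shows "dir1 (c * u) (d * cnj u) = (C\<^sup>2 + S\<^sup>2) *\<^sub>R dir1 c d"
    "dir2 (c * u) (d * cnj u) = (C\<^sup>2 - S\<^sup>2) *\<^sub>R dir2 c d + (2 * S * C) *\<^sub>R dir3 c d"
    "dir3 (c * u) (d * cnj u) = (C\<^sup>2 - S\<^sup>2) *\<^sub>R dir3 c d - (2 * S * C) *\<^sub>R dir2 c d"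
    "dir1 (c * C + d * (\<i> * S)) (c * (\<i> * S) + d * C) = (C\<^sup>2 - S\<^sup>2) *\<^sub>R dir1 c d - (2 * S * C) *\<^sub>R dir3 c d"
    "dir2 (c * C + d * (\<i> * S)) (c * (\<i> * S) + d * C) = (C\<^sup>2 + S\<^sup>2) *\<^sub>R dir2 c d"
    "dir3 (c * C + d * (\<i> * S)) (c * (\<i> * S) + d * C) = (C\<^sup>2 - S\<^sup>2) *\<^sub>R dir3 c d + (2 * S * C) *\<^sub>R dir1 c d"
  unfolding dir1_def dir2_def dir3_def cmod_power2 u_def
  by (simp_all add: vec_eq_iff forall_3 power2_eq_square) (simp_all add: algebra_simps)

text \<open>The special unitary group fixes the base point of the standard frame, so
  rotating the standard frame before moving it by \<open>A\<close> has no effect on the base point.\<close>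

lemma base_unitary:
  assumes "A \<in> SL2" "B \<in> SL2"
    and "B $ 2 $ 1 = - cnj (B $ 1 $ 2)" "B $ 2 $ 2 = cnj (B $ 1 $ 1)"
  shows "base (A ** B) = base A" "row_norm (A ** B) = row_norm A"
proof -
  define u v where "u = B $ 1 $ 1" "v = B $ 1 $ 2"
  have uv: "u * cnj u + v * cnj v = 1" using assms(2-4) by (simp add: SL2_iff u_v_def)
  have "(A $ i $ 1 * u - A $ i $ 2 * cnj v) * cnj (A $ 2 $ 1 * u - A $ 2 $ 2 * cnj v) +
      (A $ i $ 1 * v + A $ i $ 2 * cnj u) * cnj (A $ 2 $ 1 * v + A $ 2 $ 2 * cnj u)
    = (A $ i $ 1 * cnj (A $ 2 $ 1) + A $ i $ 2 * cnj (A $ 2 $ 2)) * (u * cnj u + v * cnj v)" for i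
    by (simp add: algebra_simps)
  then have *: "(A ** B) $ i $ 1 * cnj ((A ** B) $ 2 $ 1) + (A ** B) $ i $ 2 * cnj ((A ** B) $ 2 $ 2)
    = A $ i $ 1 * cnj (A $ 2 $ 1) + A $ i $ 2 * cnj (A $ 2 $ 2)" for i
    unfolding uv by (simp add: assms(3,4) u_v_def[symmetric])
  have "complex_of_real (row_norm (A ** B)) = complex_of_real (row_norm A)"
    unfolding of_row_norm by (rule *)
  then show rn: "row_norm (A ** B) = row_norm A" by (simp only: of_real_eq_iff)
  show "base (A ** B) = base A" unfolding base_def rn * ..
qed

lemma cis_half: "cis (\<alpha> / 2) = Complex (cos (\<alpha> / 2)) (sin (\<alpha> / 2))" "cis (- \<alpha> / 2) = cnj (cis (\<alpha> / 2))"
  by (simp_all add: complex_eq_iff)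

lemma half_angle: "(cos (\<alpha> / 2))\<^sup>2 - (sin (\<alpha> / 2))\<^sup>2 = cos \<alpha>" "2 * sin (\<alpha> / 2) * cos (\<alpha> / 2) = sin \<alpha>" for \<alpha> :: real
  using cos_double[of "\<alpha> / 2"] sin_double[of "\<alpha> / 2"] by simp_all

lemma spin_proj_rot1:
  assumes "A \<in> SL2"
  shows "spin_proj (A ** rot1 \<alpha>) = rotate_frame (axis1 A) \<alpha> (spin_proj A)"
proof -
  have b: "base (A ** rot1 \<alpha>) = base A" and r: "row_norm (A ** rot1 \<alpha>) = row_norm A"
    by (rule base_unitary[OF assms rot_SL2(1)]; simp add: rot1_def cis_cnj)+
  have e: "(A ** rot1 \<alpha>) $ 2 $ 1 = A $ 2 $ 1 * cis (\<alpha> / 2)" "(A ** rot1 \<alpha>) $ 2 $ 2 = A $ 2 $ 2 * cnj (cis (\<alpha> / 2))"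
    by (simp_all add: rot1_def cis_cnj)
  have ax: "axis1 (A ** rot1 \<alpha>) = axis1 A" "axis2 (A ** rot1 \<alpha>) = cos \<alpha> *\<^sub>R axis2 A + sin \<alpha> *\<^sub>R axis3 A"
    "axis3 (A ** rot1 \<alpha>) = cos \<alpha> *\<^sub>R axis3 A - sin \<alpha> *\<^sub>R axis2 A"
    unfolding axis1_def axis2_def axis3_def r e cis_half(1) dir_rot half_angle
    by (simp_all add: scaleR_add_right scaleR_diff_right mult.commute)
  have c11: "hyp_cross (base A) (axis1 A) (axis1 A) = 0" by (simp add: hyp_cross_def)
  show ?thesis
    using axis_inner[OF assms] axis_cross[OF assms] c11
    by (simp add: spin_proj_def b ax rotate_vec_def algebra_simps flip: scaleR_add_left)
qed

lemma spin_proj_rot2: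
  assumes "A \<in> SL2"
  shows "spin_proj (A ** rot2 \<alpha>) = rotate_frame (axis2 A) \<alpha> (spin_proj A)"
proof -
  have b: "base (A ** rot2 \<alpha>) = base A" and r: "row_norm (A ** rot2 \<alpha>) = row_norm A"
    by (rule base_unitary[OF assms rot_SL2(2)]; simp add: rot2_def)+
  have e: "(A ** rot2 \<alpha>) $ 2 $ 1 = A $ 2 $ 1 * complex_of_real (cos (\<alpha> / 2)) + A $ 2 $ 2 * (\<i> * complex_of_real (sin (\<alpha> / 2)))"
     "(A ** rot2 \<alpha>) $ 2 $ 2 = A $ 2 $ 1 * (\<i> * complex_of_real (sin (\<alpha> / 2))) + A $ 2 $ 2 * complex_of_real (cos (\<alpha> / 2))"
    by (simp_all add: rot2_def)
  have ax: "axis1 (A ** rot2 \<alpha>) = cos \<alpha> *\<^sub>R axis1 A - sin \<alpha> *\<^sub>R axis3 A" "axis2 (A ** rot2 \<alpha>) = axis2 A"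
    "axis3 (A ** rot2 \<alpha>) = cos \<alpha> *\<^sub>R axis3 A + sin \<alpha> *\<^sub>R axis1 A"
    unfolding axis1_def axis2_def axis3_def r e dir_rot half_angle
    by (simp_all add: scaleR_add_right scaleR_diff_right mult.commute)
  have c: "hyp_cross (base A) (axis2 A) (axis2 A) = 0" "hyp_cross (base A) (axis2 A) (axis1 A) = - axis3 A"
    using axis_cross(1)[OF assms] by (simp_all add: hyp_cross_def cross_skew[of "axis2 A" "axis1 A"])
  show ?thesis
    using axis_inner[OF assms] axis_cross[OF assms] c hyp_inner_commute[of "base A" "axis2 A" "axis1 A"]
    by (simp add: spin_proj_def b ax rotate_vec_def algebra_simps flip: scaleR_add_left)
qed

lemma continuous_on_rot: "continuous_on S rot1" "continuous_on S rot2"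
  unfolding rot1_def[abs_def] rot2_def[abs_def] by (intro continuous_intros; simp)+

lemma continuous_on_matrix_mult_2:
  fixes A :: "complex^2^2" and F :: "'a::topological_space \<Rightarrow> complex^2^2"
  assumes "continuous_on S F" shows "continuous_on S (\<lambda>x. A ** F x)"
proof -
  have "continuous_on S (\<lambda>x. mat2 ((A ** F x) $ 1 $ 1) ((A ** F x) $ 1 $ 2) ((A ** F x) $ 2 $ 1) ((A ** F x) $ 2 $ 2))"
    unfolding matrix_mult_2 by (intro continuous_intros assms)
  then show ?thesis unfolding mat2_eta .
qed

lemma rot_0 [simp]: "rot1 0 = mat 1" "rot2 0 = mat 1"
  by (simp_all add: rot1_def rot2_def mat2_eq_iff mat_def)

lemma spin_rotation_iff:
  assumes chart: "spin_chart E \<pi> \<Phi>" and S: "S \<in> E"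
    and R: "continuous_on UNIV R" "R 0 = mat 1" "\<And>\<alpha>. R \<alpha> \<in> SL2"
      "\<And>\<alpha>. spin_proj (\<Phi> S ** R \<alpha>) = rotate_frame n \<alpha> (spin_proj (\<Phi> S))"
  shows "spin_rotation E \<pi> n \<theta> S S' \<longleftrightarrow> S' \<in> E \<and> \<Phi> S' = \<Phi> S ** R \<theta>"
proof -
  note \<Phi> = spin_chartD(4,5,3)[OF chart]
  let ?F = "\<lambda>\<alpha>. \<Phi> S ** R \<alpha>" and ?I = "closed_segment 0 \<theta>"
  have F: "continuous_on ?I ?F" "?F ` ?I \<subseteq> SL2" "?F 0 = \<Phi> S"
    using R \<Phi>(1)[OF S] by (auto intro!: continuous_on_matrix_mult_2 SL2_mult intro: continuous_on_subset)
  show ?thesis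
  proof
    assume "spin_rotation E \<pi> n \<theta> S S'"
    then obtain \<sigma> where \<sigma>: "continuous_on ?I \<sigma>" "\<sigma> 0 = S" "\<sigma> \<theta> = S'"
      "\<And>\<alpha>. \<alpha> \<in> ?I \<Longrightarrow> \<sigma> \<alpha> \<in> E \<and> \<pi> (\<sigma> \<alpha>) = rotate_frame n \<alpha> (\<pi> S)"
      by (auto simp: spin_rotation_def)
    have "\<Phi> (\<sigma> \<theta>) = ?F \<theta>"
      by (rule spin_path_lift_end[OF chart F(1,2)]) (use \<sigma> F(3) R(4) \<Phi>(2)[OF S] in auto)
    then show "S' \<in> E \<and> \<Phi> S' = \<Phi> S ** R \<theta>" using \<sigma>(3) \<sigma>(4)[of \<theta>] by auto
  next
    assume S': "S' \<in> E \<and> \<Phi> S' = \<Phi> S ** R \<theta>"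
    obtain \<sigma> where \<sigma>: "continuous_on ?I \<sigma>" "\<sigma> 0 = S"
      "\<And>r. r \<in> ?I \<Longrightarrow> \<sigma> r \<in> E \<and> \<pi> (\<sigma> r) = spin_proj (?F r) \<and> \<Phi> (\<sigma> r) = ?F r"
      using spin_path_lift[OF chart S F] by blast
    have "\<sigma> \<theta> = S'" using \<sigma>(3)[of \<theta>] S' \<Phi>(3) by (auto simp: inj_on_def)
    then show "spin_rotation E \<pi> n \<theta> S S'"
      unfolding spin_rotation_def using \<sigma> R(4) \<Phi>(2)[OF S] by (intro exI[of _ \<sigma>]) auto
  qed
qed

lemma spin_rotation_axis:
  assumes chart: "spin_chart E \<pi> \<Phi>" and S: "S \<in> E"
  shows "spin_rotation E \<pi> (axis1 (\<Phi> S)) \<theta> S S' \<longleftrightarrow> S' \<in> E \<and> \<Phi> S' = \<Phi> S ** rot1 \<theta>"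
    "spin_rotation E \<pi> (axis2 (\<Phi> S)) \<theta> S S' \<longleftrightarrow> S' \<in> E \<and> \<Phi> S' = \<Phi> S ** rot2 \<theta>"
proof -
  note \<Phi>S = spin_chartD(4)[OF chart S]
  show "spin_rotation E \<pi> (axis1 (\<Phi> S)) \<theta> S S' \<longleftrightarrow> S' \<in> E \<and> \<Phi> S' = \<Phi> S ** rot1 \<theta>"
    "spin_rotation E \<pi> (axis2 (\<Phi> S)) \<theta> S S' \<longleftrightarrow> S' \<in> E \<and> \<Phi> S' = \<Phi> S ** rot2 \<theta>"
    by (intro spin_rotation_iff[OF chart S] continuous_on_rot; simp add: spin_proj_rot1 spin_proj_rot2 \<Phi>S)+
qed

section \<open>Screw motions and spinors\<close>

text \<open>For real \<open>w\<close> this is the translation by \<open>w\<close> along the geodesic from \<open>0\<close> to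
  \<open>Infty\<close>, and for imaginary \<open>w = \<i> * \<theta>\<close> the rotation by \<open>\<theta>\<close> about it: complex distances
  are the exponents of these matrices.\<close>

definition screw :: "complex \<Rightarrow> complex^2^2"
  where "screw w = mat2 (exp (w / 2)) 0 0 (exp (- w / 2))"

lemma screw_SL2 [simp]: "screw w \<in> SL2"
  by (simp add: screw_def flip: exp_add)

lemma screw_mult: "screw v ** screw w = screw (v + w)"
  by (simp add: screw_def mat2_eq_iff add_divide_distrib diff_divide_distrib flip: exp_add)

lemma screw_0 [simp]: "screw 0 = mat 1"
  by (simp add: screw_def mat2_eq_iff mat_def)

lemma rot1_screw: "rot1 \<theta> = screw (\<i> * \<theta>)"
  by (simp add: rot1_def screw_def cis_conv_exp)

definition adjugate :: "complex^2^2 \<Rightarrow> complex^2^2"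
  where "adjugate A = mat2 (A $ 2 $ 2) (- A $ 1 $ 2) (- A $ 2 $ 1) (A $ 1 $ 1)"

lemma adjugate_SL2: "A \<in> SL2 \<Longrightarrow> adjugate A \<in> SL2"
  by (simp add: adjugate_def SL2_iff mult.commute)

lemma adjugate_mult: "A \<in> SL2 \<Longrightarrow> A ** adjugate A = mat 1" "A \<in> SL2 \<Longrightarrow> adjugate A ** A = mat 1"
  by (simp_all add: adjugate_def SL2_iff mat2_eq_iff mat_def algebra_simps)

lemma realizes_base: "realizes \<phi> B \<Longrightarrow> A \<in> SL2 \<Longrightarrow> \<phi> (base A) = base (B ** A)"
  by (auto simp: realizes_def spin_proj_def)

lemma base_surj:
  assumes "x \<in> upper_half_space" shows "\<exists>A\<in>SL2. base A = x"
proof -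
  have "x $ 3 > 0" using uhs_pos[OF assms] .
  then have "(cmod 0)\<^sup>2 + (cmod (complex_of_real (1 / sqrt (x $ 3))))\<^sup>2 = 1 / x $ 3"
    by (simp add: norm_divide power_divide)
  from base_of_base_row[OF this assms] show ?thesis by blast
qed

lemma realizes_mat1:
  assumes "realizes \<phi> (mat 1)" "x \<in> upper_half_space" shows "\<phi> x = x"
  using base_surj[OF assms(2)] realizes_base[OF assms(1)] by auto

lemma realizes_inverse:
  assumes "realizes \<phi> B" "realizes \<psi> (adjugate B)" "B \<in> SL2" "x \<in> upper_half_space"
  shows "\<phi> (\<psi> x) = x"
  using realizes_mat1[of "\<phi> \<circ> \<psi>" x] realizes_mult[OF assms(1,2) adjugate_SL2[OF assms(3)]] assms by (simp add: adjugate_mult)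

lemma ideal_of_surj: "\<exists>k. k \<noteq> 0 \<and> ideal_of k = \<zeta>"
proof (cases \<zeta>)
  case (Fin z)
  then show ?thesis by (intro exI[of _ "vector [z, 1]"]) (simp add: ideal_of_def vec_eq_iff forall_2)
next
  case Infty
  then show ?thesis by (intro exI[of _ "vector [1, 0]"]) (simp add: ideal_of_def vec_eq_iff forall_2)
qed

definition spinor_det :: "complex^2 \<Rightarrow> complex^2 \<Rightarrow> complex"
  where "spinor_det k l = k $ 1 * l $ 2 - k $ 2 * l $ 1"

lemma ideal_of_eq_iff:
  assumes "k \<noteq> 0" "l \<noteq> 0"
  shows "ideal_of k = ideal_of l \<longleftrightarrow> spinor_det k l = 0"
  using assms by (auto simp: ideal_of_def spinor_det_def vec_eq_iff forall_2 field_simps)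

lemma spinor_det_mult: "spinor_det (A *v k) (A *v l) = det A * spinor_det k l"
  by (simp add: spinor_det_def det_2 algebra_simps)

lemma column_2 [simp]: "column j A $ i = A $ i $ j"
  by (simp add: column_def)

lemma matrix_vector_axis: "A *v axis j 1 = column j A" for A :: "complex^2^2"
  using exhaust_2[of j] by (auto simp: vec_eq_iff forall_2 axis_def)

lemma column_mult: "column j (A ** B) = A *v column j B" for A :: "complex^2^2" and B :: "complex^2^2"
  by (simp add: vec_eq_iff forall_2)

lemma SL2_column_det: "A \<in> SL2 \<longleftrightarrow> spinor_det (column 1 A) (column 2 A) = 1"
  by (simp add: SL2_iff spinor_det_def mult.commute)

definition of_columns :: "complex^2 \<Rightarrow> complex^2 \<Rightarrow> complex^2^2"
  where "of_columns k l = mat2 (k $ 1) (l $ 1) (k $ 2) (l $ 2)"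

lemma column_of_columns [simp]: "column 1 (of_columns k l) = k" "column 2 (of_columns k l) = l"
  by (simp_all add: of_columns_def vec_eq_iff forall_2)

lemma spinor_det_scale: "spinor_det (c *s k) l = c * spinor_det k l" "spinor_det k (c *s l) = c * spinor_det k l"
  by (simp_all add: spinor_det_def algebra_simps)

lemma ideal_of_scale: "c \<noteq> 0 \<Longrightarrow> ideal_of (c *s k) = ideal_of k"
  by (simp add: ideal_of_def)

lemma SL2_with_columns:
  assumes "\<zeta> \<noteq> \<eta>" shows "\<exists>B\<in>SL2. ideal_of (column 1 B) = \<eta> \<and> ideal_of (column 2 B) = \<zeta>"
proof -
  obtain k l where kl: "k \<noteq> 0" "ideal_of k = \<zeta>" "l \<noteq> 0" "ideal_of l = \<eta>" using ideal_of_surj by metis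
  then have nz: "spinor_det l k \<noteq> 0" using ideal_of_eq_iff assms by metis
  let ?B = "of_columns ((1 / spinor_det l k) *s l) k"
  have "?B \<in> SL2" using nz by (simp add: SL2_column_det spinor_det_scale)
  then show ?thesis using kl nz by (intro bexI[of _ ?B]) (auto simp: ideal_of_scale)
qed

section \<open>Geodesics\<close>

lemma screw_real: "base (screw (of_real r)) = pt 0 (exp r)" "axis1 (screw (of_real r)) = pt 0 (exp r)"
proof -
  have e: "exp (- complex_of_real r / 2) = of_real (exp (- r / 2))" "exp (complex_of_real r / 2) = of_real (exp (r / 2))"
    by (simp_all add: exp_of_real[symmetric])
  have "(exp (- r / 2))\<^sup>2 = exp (- r)" by (simp add: power2_eq_square flip: exp_add)
  then have n: "row_norm (screw (of_real r)) = exp (- r)"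
    by (simp add: row_norm_def screw_def e)
  show "base (screw (of_real r)) = pt 0 (exp r)"
    unfolding base_def n by (simp add: screw_def e exp_minus inverse_eq_divide)
  show "axis1 (screw (of_real r)) = pt 0 (exp r)"
    unfolding axis1_def n using \<open>(exp (- r / 2))\<^sup>2 = exp (- r)\<close>
    by (simp add: screw_def e dir1_def pt_arith) (simp add: exp_minus power2_eq_square field_simps)
qed

lemma cosh_dist_vertical: "a > 0 \<Longrightarrow> b > 0 \<Longrightarrow> cosh_dist (pt 0 a) (pt 0 b) = cosh (ln a - ln b)"
proof -
  assume ab: "a > 0" "b > 0"
  have "(dist (pt 0 a) (pt 0 b))\<^sup>2 = (a - b)\<^sup>2" by (simp add: dist_norm pt_arith norm_pt_sq)
  moreover have "exp (ln a - ln b) = a / b" "exp (- (ln a - ln b)) = b / a"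
    using ab by (simp_all add: exp_diff)
  then have "cosh (ln a - ln b) = (a / b + b / a) / 2" unfolding cosh_field_def by simp
  ultimately show ?thesis using ab by (simp add: cosh_dist_def field_simps power2_eq_square)
qed

lemma cosh_eq_cosh_iff: "cosh (x::real) = cosh y \<longleftrightarrow> \<bar>x\<bar> = \<bar>y\<bar>"
  by (metis arcosh_cosh_real abs_ge_zero cosh_real_abs)

text \<open>For the identity matrix the curve is the vertical geodesic \<open>r \<mapsto> (0, exp r)\<close>;
  the general case is its image under an isometry realizing \<open>A\<close>, which sends \<open>0\<close> and
  \<open>Infty\<close> to the ideal points of the columns of \<open>A\<close>.\<close>

lemma geodesic_screw:
  assumes "A \<in> SL2"
  shows "geodesic_from_to (\<lambda>r. base (A ** screw (of_real r))) (ideal_of (column 2 A)) (ideal_of (column 1 A))"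
    and "((\<lambda>r. base (A ** screw (of_real r))) has_vector_derivative axis1 (A ** screw (of_real r))) (at r)"
proof -
  obtain \<phi> where \<phi>: "realizes \<phi> A" using SL2_realized[OF assms] by blast
  then have op: "op_isometry \<phi>" by (simp add: realizes_def)
  have eq: "base (A ** screw (of_real r)) = \<phi> (pt 0 (exp r))" for r
    using realizes_base[OF \<phi>, of "screw (of_real r)"] by (simp add: screw_real)
  have ideal: "ideal_maps_to \<phi> (Fin 0) (ideal_of (column 2 A))" "ideal_maps_to \<phi> Infty (ideal_of (column 1 A))"
  proof -
    have "ideal_maps_to \<phi> (ideal_of (axis j 1)) (ideal_of (column j A))" for j
      using \<phi> unfolding realizes_def matrix_vector_axis[symmetric] by simp
    from this[of 1] this[of 2] show "ideal_maps_to \<phi> (Fin 0) (ideal_of (column 2 A))" "ideal_maps_to \<phi> Infty (ideal_of (column 1 A))"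
      by (simp_all add: ideal_of_def axis_def)
  qed
  have bot: "filterlim (\<lambda>r. pt 0 (exp r)) (ideal_nhds (Fin 0)) at_bot"
    unfolding filterlim_ideal_Fin by (auto intro!: tendsto_intros exp_at_bot)
  have "filterlim (\<lambda>r. pt 0 (exp r)) at_infinity at_top"
  proof (rule filterlim_norm_at_top_imp_at_infinity)
    have "norm (pt 0 (exp r)) = exp r" for r
      by (rule power2_eq_imp_eq) (simp_all add: norm_pt_sq)
    then show "LIM r at_top. norm (pt 0 (exp r)) :> at_top" by (simp add: exp_at_top)
  qed
  then have top: "filterlim (\<lambda>r. pt 0 (exp r)) (ideal_nhds Infty) at_top"
    unfolding filterlim_ideal_Infty by simp
  show "geodesic_from_to (\<lambda>r. base (A ** screw (of_real r))) (ideal_of (column 2 A)) (ideal_of (column 1 A))"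
    unfolding geodesic_from_to_def eq
  proof (intro conjI allI)
    show "\<phi> (pt 0 (exp s)) \<in> upper_half_space" for s
      by (rule hyp_isometryD(1)[OF op_isometryD(1)[OF op]]) simp
    show "hyp_dist (\<phi> (pt 0 (exp s))) (\<phi> (pt 0 (exp t))) = \<bar>s - t\<bar>" for s t
    proof -
      have "cosh_dist (\<phi> (pt 0 (exp s))) (\<phi> (pt 0 (exp t))) = cosh (s - t)"
        using hyp_isometryD(2)[OF op_isometryD(1)[OF op]] by (simp add: cosh_dist_vertical)
      then have "hyp_dist (\<phi> (pt 0 (exp s))) (\<phi> (pt 0 (exp t))) = arcosh (cosh \<bar>s - t\<bar>)"
        by (simp add: hyp_dist_eq_arcosh)
      then show ?thesis by (simp only: arcosh_cosh_real abs_ge_zero)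
    qed
  qed (use ideal bot top in \<open>auto simp: ideal_maps_to_def intro: filterlim_compose simp del: ideal_nhds.simps\<close>)
  have d1: "((\<lambda>r. pt 0 (exp r)) has_vector_derivative pt 0 (exp r)) (at r)"
    by (intro has_vector_derivative_pt derivative_intros) (auto intro!: derivative_eq_intros simp: has_real_derivative_iff_has_vector_derivative[symmetric])
  have d2: "(\<phi> has_derivative frechet_derivative \<phi> (at (pt 0 (exp r)))) (at (pt 0 (exp r)))"
    by (rule op_isometryD(2)[OF op]) simp
  have "((\<phi> \<circ> (\<lambda>r. pt 0 (exp r))) has_vector_derivative frechet_derivative \<phi> (at (pt 0 (exp r))) (pt 0 (exp r))) (at r)"
    using diff_chain_at[OF d1[unfolded has_vector_derivative_def] d2] linear_cmul[OF has_derivative_linear[OF d2]]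
    unfolding has_vector_derivative_def by (simp add: o_def)
  moreover have "axis1 (A ** screw (of_real r)) = frechet_derivative \<phi> (at (pt 0 (exp r))) (pt 0 (exp r))"
    using \<phi> screw_real[of r] unfolding realizes_def spin_proj_def
    by (metis (no_types, lifting) prod.inject push_frame.simps screw_SL2)
  ultimately show "((\<lambda>r. base (A ** screw (of_real r))) has_vector_derivative axis1 (A ** screw (of_real r))) (at r)"
    unfolding eq by (simp add: o_def)
qed

text \<open>Letting the two auxiliary points of \<open>horo_level_product_limit\<close> run to the two
  ends of the geodesic itself shows that the product of the two levels is \<open>1\<close> along it,
  which forces the points onto the vertical axis. On the axis the logarithm of the height
  is an isometric function of the parameter, hence affine, and its slope is \<open>1\<close> because of
  the end points.\<close>

lemma geodesic_0_Infty:
  assumes "geodesic_from_to \<delta> (Fin 0) Infty"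
  shows "\<exists>c. \<forall>s. \<delta> s = pt 0 (exp (s + c))"
proof -
  have uhs: "\<delta> s \<in> upper_half_space" and dist: "hyp_dist (\<delta> s) (\<delta> t) = \<bar>s - t\<bar>" for s t
    using assms by (auto simp: geodesic_from_to_def)
  have bot: "filterlim \<delta> (ideal_nhds (Fin 0)) at_bot" and top: "filterlim \<delta> (ideal_nhds Infty) at_top"
    using assms by (auto simp: geodesic_from_to_def)
  have cd: "cosh_dist (\<delta> s) (\<delta> t) = cosh (s - t)" for s t
    using cosh_hyp_dist[OF uhs uhs] dist by (metis cosh_real_abs)
  have cpart0: "cpart (\<delta> s) = 0" for s
  proof -
    have "((\<lambda>u. cosh_dist (\<delta> s) (\<delta> (- u)) * cosh_dist (\<delta> s) (\<delta> u) / cosh_dist (\<delta> (- u)) (\<delta> u)) \<longlongrightarrow>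
     1 / (horo_level (Fin 0) (\<delta> s) * horo_level Infty (\<delta> s) * ideal_gap (Fin 0) Infty)) at_top"
      by (rule horo_level_product_limit[OF uhs filterlim_compose[OF bot filterlim_uminus_at_bot_at_top] top]) simp
    moreover have "((\<lambda>u. cosh_dist (\<delta> s) (\<delta> (- u)) * cosh_dist (\<delta> s) (\<delta> u) / cosh_dist (\<delta> (- u)) (\<delta> u)) \<longlongrightarrow> 1/2) at_top"
    proof -
      have "cosh (s - - u) * cosh (s - u) / cosh (- u - u) = cosh (2 * s) / 2 * inverse (cosh (2 * u)) + 1 / 2" for u
      proof -
        have "cosh (s - - u) * cosh (s - u) = (cosh (2 * s) + cosh (2 * u)) / 2"
          using cosh_add[of "s + u" "s - u"] cosh_diff[of "s + u" "s - u"] by simp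
        moreover have "cosh (- u - u) = cosh (2 * u)" using cosh_minus[of "2 * u"] by simp
        ultimately show ?thesis by (simp add: field_simps)
      qed
      moreover have "((\<lambda>u::real. inverse (cosh (2 * u))) \<longlongrightarrow> 0) at_top"
        by (intro tendsto_inverse_0_at_top filterlim_compose[OF cosh_real_at_top] filterlim_tendsto_pos_mult_at_top[OF tendsto_const] filterlim_ident) simp
      then have "((\<lambda>u::real. cosh (2 * s) / 2 * inverse (cosh (2 * u)) + 1 / 2) \<longlongrightarrow> cosh (2 * s) / 2 * 0 + 1 / 2) at_top"
        by (intro tendsto_intros)
      ultimately show ?thesis unfolding cd by simp
    qed
    ultimately have "1 / (horo_level (Fin 0) (\<delta> s) * horo_level Infty (\<delta> s) * ideal_gap (Fin 0) Infty) = 1 / 2"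
      by (rule tendsto_unique[rotated]) simp
    moreover have zero: "(vector [0, 0, 0] :: real^3) = 0" by (simp add: vec_eq_iff forall_3)
    ultimately have "(\<delta> s $ 3)\<^sup>2 = (norm (\<delta> s))\<^sup>2"
      using uhs_pos[OF uhs[of s]] zero by (auto simp: dist_norm field_simps power2_eq_square)
    moreover have "(norm (\<delta> s))\<^sup>2 = (cmod (cpart (\<delta> s)))\<^sup>2 + (\<delta> s $ 3)\<^sup>2"
      using norm_pt_sq[of "cpart (\<delta> s)" "\<delta> s $ 3"] by simp
    ultimately show ?thesis by simp
  qed
  define k where "k s = ln (\<delta> s $ 3)" for s
  have \<delta>: "\<delta> s = pt 0 (exp (k s))" for s
    using pt_cpart[of "\<delta> s"] cpart0 uhs_pos[OF uhs[of s]] by (simp add: k_def)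
  have k: "\<bar>k s - k t\<bar> = \<bar>s - t\<bar>" for s t
    using cd[of s t] unfolding \<delta> by (simp add: cosh_dist_vertical cosh_eq_cosh_iff)
  have "\<forall>s. k s = k 0 + s"
  proof (rule ccontr)
    assume "\<not> (\<forall>s. k s = k 0 + s)"
    \<comment> \<open>One parameter with slope \<open>-1\<close> forces slope \<open>-1\<close> for all, against the
      limit at \<open>at_top\<close>.\<close>
    then obtain s where s: "k s \<noteq> k 0 + s" by blast
    have neg: "k t = k 0 - t" for t
      using k[of s 0] k[of t 0] k[of s t] s by (auto simp: abs_if split: if_splits)
    have "((\<lambda>s. pt 0 (exp (k 0) * exp (- s))) \<longlongrightarrow> pt 0 (exp (k 0) * 0)) at_top"
      by (intro tendsto_intros filterlim_compose[OF exp_at_bot filterlim_uminus_at_bot_at_top])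
    moreover have "\<delta> = (\<lambda>s. pt 0 (exp (k 0) * exp (- s)))"
      unfolding \<delta>[abs_def] by (rule ext) (subst neg, simp add: exp_diff exp_minus divide_inverse)
    ultimately show False
      using top not_tendsto_and_filterlim_at_infinity[of at_top \<delta> "pt 0 (exp (k 0) * 0)"] unfolding filterlim_ideal_Infty by auto
  qed
  then show ?thesis using \<delta> by (intro exI[of _ "k 0"]) (metis add.commute)
qed

lemma geodesic_from_to_isometry:
  assumes "op_isometry \<phi>" "geodesic_from_to \<gamma> \<zeta> \<eta>" "ideal_maps_to \<phi> \<zeta> \<zeta>'" "ideal_maps_to \<phi> \<eta> \<eta>'"
  shows "geodesic_from_to (\<phi> \<circ> \<gamma>) \<zeta>' \<eta>'"
proof -
  have iso: "hyp_isometry \<phi>" using assms(1) by (rule op_isometryD)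
  then show ?thesis using assms(2-4) hyp_isometryD(1)[OF iso]
    by (auto simp: geodesic_from_to_def hyp_isometry_def ideal_maps_to_def o_def intro: filterlim_compose)
qed

lemma geodesic_classification:
  assumes \<gamma>: "geodesic_from_to \<gamma> \<zeta> \<eta>" and "\<zeta> \<noteq> \<eta>"
  shows "\<exists>A\<in>SL2. \<gamma> = (\<lambda>r. base (A ** screw (of_real r)))"
proof -
  obtain B where B: "B \<in> SL2" "ideal_of (column 1 B) = \<eta>" "ideal_of (column 2 B) = \<zeta>"
    using SL2_with_columns[OF assms(2)] by blast
  obtain \<phi> \<psi> where \<phi>: "realizes \<phi> B" and \<psi>: "realizes \<psi> (adjugate B)"
    using SL2_realized B(1) adjugate_SL2 by metis
  have nz: "column j B \<noteq> 0" for j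
    using SL2_vec_nonzero[OF B(1), of "axis j 1"] by (simp add: matrix_vector_axis axis_eq_0_iff)
  have "ideal_maps_to \<psi> (ideal_of (column j B)) (ideal_of (axis j 1))" for j
  proof -
    have "adjugate B *v column j B = axis j 1"
      by (simp only: column_mult[symmetric] adjugate_mult(2)[OF B(1)]) (simp add: matrix_vector_axis[symmetric])
    then show ?thesis using \<psi> nz unfolding realizes_def by metis
  qed
  from this[of 1] this[of 2] have "ideal_maps_to \<psi> \<eta> Infty" "ideal_maps_to \<psi> \<zeta> (Fin 0)"
    by (simp_all add: B) (simp_all add: ideal_of_def axis_def)
  with \<gamma> \<psi> have "geodesic_from_to (\<psi> \<circ> \<gamma>) (Fin 0) Infty"
    by (intro geodesic_from_to_isometry) (auto simp: realizes_def)
  then obtain c where c: "(\<psi> \<circ> \<gamma>) s = pt 0 (exp (s + c))" for s using geodesic_0_Infty by blast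
  have "\<gamma> s = base (B ** screw (of_real c) ** screw (of_real s))" for s
  proof -
    have "\<gamma> s = \<phi> (\<psi> (\<gamma> s))"
      using realizes_inverse[OF \<phi> \<psi> B(1)] \<gamma> by (simp add: geodesic_from_to_def)
    also have "\<psi> (\<gamma> s) = base (screw (of_real (c + s)))"
      using c[of s] by (simp only: screw_real o_apply add.commute)
    also have "\<phi> \<dots> = base (B ** screw (of_real (c + s)))" by (rule realizes_base[OF \<phi>]) simp
    finally show ?thesis by (simp add: screw_mult matrix_mul_assoc[symmetric])
  qed
  then show ?thesis using B(1) by (intro bexI[of _ "B ** screw (of_real c)"]) (auto intro: SL2_mult)
qed

section \<open>Parallel transport along geodesics\<close>

text \<open>The base point and the first vector fix \<open>c * d\<close>, \<open>cmod c\<close> and \<open>cmod d\<close>, that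
  is, the bottom row up to \<open>(u * c, cnj u * d)\<close> with \<open>u\<close> on the unit circle.\<close>

lemma same_base_axis1:
  assumes A: "A \<in> SL2" and B: "B \<in> SL2" and base: "base A = base B" and ax: "axis1 A = axis1 B"
  shows "\<exists>\<theta>. B = A ** rot1 \<theta>"
proof -
  define c d c' d' where defs: "c = A $ 2 $ 1" "d = A $ 2 $ 2" "c' = B $ 2 $ 1" "d' = B $ 2 $ 2"
  have n: "row_norm A = row_norm B" using base_3[of A] base_3[of B] row_norm_pos[OF A] row_norm_pos[OF B] base by simp
  have "dir1 c d = dir1 c' d'" using ax row_norm_pos[OF B] by (simp add: axis1_def n defs)
  then have 1: "2 * cnj c * cnj d = 2 * cnj c' * cnj d'" and 2: "(cmod d)\<^sup>2 - (cmod c)\<^sup>2 = (cmod d')\<^sup>2 - (cmod c')\<^sup>2"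
    by (simp_all add: dir1_def pt_eq_iff)
  have cd: "c * d = c' * d'"
  proof -
    have "cnj (c * d) = cnj (c' * d')" using 1 by simp
    then show ?thesis by (simp only: complex_cnj_cancel_iff)
  qed
  have "(cmod c)\<^sup>2 + (cmod d)\<^sup>2 = (cmod c')\<^sup>2 + (cmod d')\<^sup>2" using n by (simp add: row_norm_def defs)
  with 2 have "(cmod c)\<^sup>2 = (cmod c')\<^sup>2" "(cmod d)\<^sup>2 = (cmod d')\<^sup>2" by linarith+
  then have mc: "cmod c = cmod c'" and md: "cmod d = cmod d'" by simp_all
  obtain u where u: "cmod u = 1" "c' = c * u" "d' = d * cnj u"
  proof (cases "c = 0")
    case False
    define u where "u = c' / c"
    have "cmod u = 1" using False by (simp add: u_def norm_divide mc[symmetric])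
    then have "u * cnj u = 1" by (simp flip: complex_norm_square)
    moreover have c': "c' = c * u" using False by (simp add: u_def)
    moreover have "d = u * d'" using cd False by (simp add: c')
    ultimately have "d' = d * cnj u" by (simp add: mult_ac)
    then show ?thesis using that \<open>cmod u = 1\<close> c' by blast
  next
    case True
    then have c': "c' = 0" and d: "d \<noteq> 0" using mc A by (auto simp: defs SL2_iff)
    have "cmod (cnj (d' / d)) = 1" using d by (simp add: norm_divide md[symmetric])
    then show ?thesis using that[of "cnj (d' / d)"] True c' d by simp
  qed
  define t where "t = Arg2pi u"
  have t: "u = cis t" using u(1) complex_norm_eq_1_exp[of u] by (simp add: t_def cis_conv_exp)
  have "B = A ** rot1 (2 * t)"
  proof (rule SL2_eqI[OF B SL2_mult[OF A rot_SL2(1)]])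
    have "base (A ** rot1 (2 * t)) = base A"
      by (rule base_unitary(1)[OF A rot_SL2(1)]; simp add: rot1_def cis_cnj)
    then show "base B = base (A ** rot1 (2 * t))" using base by simp
    show "B $ 2 $ 1 = (A ** rot1 (2 * t)) $ 2 $ 1" "B $ 2 $ 2 = (A ** rot1 (2 * t)) $ 2 $ 2"
      using u(2,3) by (simp_all add: rot1_def defs[symmetric] t cis_cnj)
  qed
  then show ?thesis ..
qed

lemma axis1_rot1: "A \<in> SL2 \<Longrightarrow> axis1 (A ** rot1 \<theta>) = axis1 A" "A \<in> SL2 \<Longrightarrow> base (A ** rot1 \<theta>) = base A"
proof -
  assume A: "A \<in> SL2"
  have "hyp_cross (base A) (axis1 A) (axis1 A) = 0" by (simp add: hyp_cross_def)
  then show "axis1 (A ** rot1 \<theta>) = axis1 A" "base (A ** rot1 \<theta>) = base A"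
    using spin_proj_rot1[OF A, of \<theta>] axis_inner(1)[OF A]
    by (simp_all add: spin_proj_def rotate_vec_def flip: scaleR_add_left)
qed

text \<open>Parallel transport preserves the hyperbolic metric, so the difference of two
  parallel fields has constant length.\<close>

lemma parallel_along_unique:
  assumes V: "parallel_along \<gamma> V" and W: "parallel_along \<gamma> W"
    and \<gamma>: "\<And>s. \<gamma> s \<in> upper_half_space" "\<And>s. (\<gamma> has_vector_derivative X s) (at s)"
    and "V s = W s"
  shows "V = W"
proof -
  define U where "U r = V r - W r" for r
  have vd: "vector_derivative \<gamma> (at r) = X r" for r using \<gamma>(2) by (rule vector_derivative_at)
  define U' where "U' r = (1 / \<gamma> r $ 3) *\<^sub>R (X r $ 3 *\<^sub>R U r + U r $ 3 *\<^sub>R X r - (X r \<bullet> U r) *\<^sub>R axis 3 1)" for r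
  have U: "(U has_vector_derivative U' r) (at r)" for r
  proof -
    have "((\<lambda>r. V r - W r) has_vector_derivative
      (1 / \<gamma> r $ 3) *\<^sub>R (X r $ 3 *\<^sub>R V r + V r $ 3 *\<^sub>R X r - (X r \<bullet> V r) *\<^sub>R axis 3 1) -
      (1 / \<gamma> r $ 3) *\<^sub>R (X r $ 3 *\<^sub>R W r + W r $ 3 *\<^sub>R X r - (X r \<bullet> W r) *\<^sub>R axis 3 1)) (at r)"
      using V W unfolding parallel_along_def Let_def vd by (intro has_vector_derivative_diff) auto
    then show ?thesis
      unfolding U_def U'_def by (simp add: algebra_simps inner_diff_right)
  qed
  have "((\<lambda>r. (U r \<bullet> U r) / (\<gamma> r $ 3)\<^sup>2) has_real_derivative 0) (at r)" for r
  proof -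
    have pos: "\<gamma> r $ 3 > 0" using \<gamma>(1) by (rule uhs_pos)
    have "((\<lambda>r. \<gamma> r $ 3) has_vector_derivative X r $ 3) (at r)"
      using bounded_linear.has_vector_derivative[OF bounded_linear_vec_nth \<gamma>(2)] .
    then have d3: "((\<lambda>r. \<gamma> r $ 3) has_real_derivative X r $ 3) (at r)"
      by (simp add: has_real_derivative_iff_has_vector_derivative)
    have "((\<lambda>r. U r \<bullet> U r) has_vector_derivative (U r \<bullet> U' r + U' r \<bullet> U r)) (at r)"
      by (rule bounded_bilinear.has_vector_derivative[OF bounded_bilinear_inner U U])
    then have dU: "((\<lambda>r. U r \<bullet> U r) has_real_derivative 2 * (U r \<bullet> U' r)) (at r)"
      by (simp add: has_real_derivative_iff_has_vector_derivative inner_commute)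
    have UU': "U r \<bullet> U' r * \<gamma> r $ 3 = X r $ 3 * (U r \<bullet> U r)"
      using pos by (simp add: U'_def inner_add_right inner_diff_right inner_axis inner_commute[of "U r" "X r"])
    have "((\<lambda>r. (U r \<bullet> U r) / (\<gamma> r $ 3)\<^sup>2) has_real_derivative
      (2 * (U r \<bullet> U' r) * (\<gamma> r $ 3)\<^sup>2 - (U r \<bullet> U r) * (2 * \<gamma> r $ 3 * X r $ 3)) / ((\<gamma> r $ 3)\<^sup>2 * (\<gamma> r $ 3)\<^sup>2)) (at r)"
      using pos by (intro DERIV_divide dU derivative_eq_intros d3) (auto intro!: derivative_eq_intros d3)
    moreover have "2 * (U r \<bullet> U' r) * (\<gamma> r $ 3)\<^sup>2 - (U r \<bullet> U r) * (2 * \<gamma> r $ 3 * X r $ 3) = 0"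
      using UU' by (simp add: power2_eq_square)
    ultimately show ?thesis by simp
  qed
  then have const: "(U r \<bullet> U r) / (\<gamma> r $ 3)\<^sup>2 = (U s \<bullet> U s) / (\<gamma> s $ 3)\<^sup>2" for r
    by (intro DERIV_isconst_all) auto
  have "U r = 0" for r
    using const[of r] uhs_pos[OF \<gamma>(1)[of r]] assms(5) by (simp add: U_def)
  then show ?thesis by (auto simp: U_def fun_eq_iff)
qed

text \<open>The equation of parallel transport along \<open>r \<mapsto> base (A ** screw (of_real r))\<close>,
  with denominators cleared. The vectors \<open>pt _ _\<close> on the left are the derivatives of
  \<open>dir1\<close>, \<open>dir2\<close>, \<open>dir3\<close> along that curve, whose velocity is proportional to \<open>dir1\<close>.\<close>

lemma dir_parallel:
  fixes c d :: complex
  defines "n \<equiv> (cmod c)\<^sup>2 + (cmod d)\<^sup>2" and "w \<equiv> (cmod d)\<^sup>2 - (cmod c)\<^sup>2"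
  shows "n *\<^sub>R pt 0 (- n) + w *\<^sub>R dir1 c d = dir1 c d $ 3 *\<^sub>R dir1 c d - (dir1 c d \<bullet> dir1 c d) *\<^sub>R axis 3 1"
    "n *\<^sub>R pt (- ((cnj d)\<^sup>2 + (cnj c)\<^sup>2)) 0 + w *\<^sub>R dir2 c d = dir2 c d $ 3 *\<^sub>R dir1 c d - (dir1 c d \<bullet> dir2 c d) *\<^sub>R axis 3 1"
    "n *\<^sub>R pt (\<i> * ((cnj c)\<^sup>2 - (cnj d)\<^sup>2)) 0 + w *\<^sub>R dir3 c d = dir3 c d $ 3 *\<^sub>R dir1 c d - (dir1 c d \<bullet> dir3 c d) *\<^sub>R axis 3 1"
  unfolding dir_inner n_def w_def unfolding dir1_def dir2_def dir3_def cmod_power2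
  by (simp_all add: vec_eq_iff forall_3 power2_eq_square axis_def) (simp_all add: algebra_simps)

lemma parallel_axes:
  assumes A: "A \<in> SL2"
  defines "\<gamma> \<equiv> \<lambda>r. base (A ** screw (of_real r))"
  shows "parallel_along \<gamma> (\<lambda>r. axis1 (A ** screw (of_real r)))"
    "parallel_along \<gamma> (\<lambda>r. axis2 (A ** screw (of_real r)))"
    "parallel_along \<gamma> (\<lambda>r. axis3 (A ** screw (of_real r)))"
proof -
  define c d where "c r = A $ 2 $ 1 * exp (of_real r / 2)" and "d r = A $ 2 $ 2 * exp (- of_real r / 2)" for r :: real
  define n where "n r = (cmod (c r))\<^sup>2 + (cmod (d r))\<^sup>2" for r
  define w where "w r = (cmod (d r))\<^sup>2 - (cmod (c r))\<^sup>2" for r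
  have cd: "(A ** screw (of_real r)) $ 2 $ 1 = c r" "(A ** screw (of_real r)) $ 2 $ 2 = d r" for r
    by (simp_all add: screw_def c_def d_def)
  have rn: "row_norm (A ** screw (of_real r)) = n r" for r
    unfolding row_norm_def cd n_def ..
  have npos: "n r > 0" for r unfolding rn[symmetric] by (intro row_norm_pos SL2_mult A) simp
  have \<gamma>3: "\<gamma> r $ 3 = 1 / n r" for r by (simp add: \<gamma>_def rn)
  have ax: "axis1 (A ** screw (of_real r)) = (1 / (n r)\<^sup>2) *\<^sub>R dir1 (c r) (d r)"
    "axis2 (A ** screw (of_real r)) = (1 / (n r)\<^sup>2) *\<^sub>R dir2 (c r) (d r)"
    "axis3 (A ** screw (of_real r)) = (1 / (n r)\<^sup>2) *\<^sub>R dir3 (c r) (d r)" for r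
    by (simp_all only: axis1_def axis2_def axis3_def rn cd)
  have vd: "vector_derivative \<gamma> (at r) = axis1 (A ** screw (of_real r))" for r
    unfolding \<gamma>_def using geodesic_screw(2)[OF A] by (rule vector_derivative_at)
  have c2: "(c r)\<^sup>2 = exp r *\<^sub>R (A $ 2 $ 1)\<^sup>2" and d2: "(d r)\<^sup>2 = exp (- r) *\<^sub>R (A $ 2 $ 2)\<^sup>2"
    and cdr: "c r * d r = A $ 2 $ 1 * A $ 2 $ 2" "c r * cnj (d r) = A $ 2 $ 1 * cnj (A $ 2 $ 2)" for r
    unfolding c_def d_def scaleR_conv_of_real
    by (simp_all add: power_mult_distrib exp_of_real[symmetric] exp_cnj power2_eq_square mult_ac flip: exp_add)
  have mc: "(cmod (c r))\<^sup>2 = exp r * (cmod (A $ 2 $ 1))\<^sup>2" and md: "(cmod (d r))\<^sup>2 = exp (- r) * (cmod (A $ 2 $ 2))\<^sup>2" for r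
    using arg_cong[OF c2[of r], of cmod] arg_cong[OF d2[of r], of cmod] by (simp_all add: norm_power)
  have exp': "((\<lambda>r. exp r *\<^sub>R v) has_vector_derivative exp r *\<^sub>R v) (at r)"
    "((\<lambda>r. exp (- r) *\<^sub>R v) has_vector_derivative - (exp (- r) *\<^sub>R v)) (at r)" for r and v :: "real^3"
    by (auto intro!: derivative_eq_intros simp: has_vector_derivative_def)
  have n': "(n has_real_derivative - w r) (at r)" for r
    unfolding n_def w_def mc md by (auto intro!: derivative_eq_intros)
  have dir': "((\<lambda>r. dir1 (c r) (d r)) has_vector_derivative pt 0 (- n r)) (at r)"
    "((\<lambda>r. dir2 (c r) (d r)) has_vector_derivative pt (- ((cnj (d r))\<^sup>2 + (cnj (c r))\<^sup>2)) 0) (at r)"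
    "((\<lambda>r. dir3 (c r) (d r)) has_vector_derivative pt (\<i> * ((cnj (c r))\<^sup>2 - (cnj (d r))\<^sup>2)) 0) (at r)" for r
  proof -
    let ?c = "A $ 2 $ 1" and ?d = "A $ 2 $ 2"
    have cn: "(cnj (c r))\<^sup>2 = exp r *\<^sub>R (cnj ?c)\<^sup>2" "(cnj (d r))\<^sup>2 = exp (- r) *\<^sub>R (cnj ?d)\<^sup>2"
       "cnj (c r) * cnj (d r) = cnj ?c * cnj ?d" for r
      using arg_cong[OF c2[of r], of cnj] arg_cong[OF d2[of r], of cnj] arg_cong[OF cdr(1)[of r], of cnj] by simp_all
    have 1: "dir1 (c r) (d r) = pt (2 * cnj ?c * cnj ?d) 0 + exp (- r) *\<^sub>R pt 0 ((cmod ?d)\<^sup>2) - exp r *\<^sub>R pt 0 ((cmod ?c)\<^sup>2)" for r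
      unfolding dir1_def mc md mult.assoc cn pt_arith by (simp add: pt_eq_iff)
    have 2: "dir2 (c r) (d r) = pt 0 (- 2 * Re (?c * cnj ?d)) + exp (- r) *\<^sub>R pt ((cnj ?d)\<^sup>2) 0 - exp r *\<^sub>R pt ((cnj ?c)\<^sup>2) 0" for r
      unfolding dir2_def cn cdr pt_arith by (simp add: pt_eq_iff)
    have 3: "dir3 (c r) (d r) = pt 0 (2 * Im (?c * cnj ?d)) + exp (- r) *\<^sub>R pt (\<i> * (cnj ?d)\<^sup>2) 0 + exp r *\<^sub>R pt (\<i> * (cnj ?c)\<^sup>2) 0" for r
      unfolding dir3_def cn cdr pt_arith by (simp add: pt_eq_iff algebra_simps)
    have "pt 0 (- n r) = 0 + - (exp (- r) *\<^sub>R pt 0 ((cmod ?d)\<^sup>2)) - exp r *\<^sub>R pt 0 ((cmod ?c)\<^sup>2)"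
      unfolding n_def mc md by (simp add: vec_eq_iff forall_3)
    then show "((\<lambda>r. dir1 (c r) (d r)) has_vector_derivative pt 0 (- n r)) (at r)"
      unfolding 1 by (simp only:) (intro derivative_intros exp')
    have "pt (- ((cnj (d r))\<^sup>2 + (cnj (c r))\<^sup>2)) 0 = 0 + - (exp (- r) *\<^sub>R pt ((cnj ?d)\<^sup>2) 0) - exp r *\<^sub>R pt ((cnj ?c)\<^sup>2) 0"
      unfolding cn by (simp add: vec_eq_iff forall_3)
    then show "((\<lambda>r. dir2 (c r) (d r)) has_vector_derivative pt (- ((cnj (d r))\<^sup>2 + (cnj (c r))\<^sup>2)) 0) (at r)"
      unfolding 2 by (simp only:) (intro derivative_intros exp')
    have "pt (\<i> * ((cnj (c r))\<^sup>2 - (cnj (d r))\<^sup>2)) 0 = 0 + - (exp (- r) *\<^sub>R pt (\<i> * (cnj ?d)\<^sup>2) 0) + exp r *\<^sub>R pt (\<i> * (cnj ?c)\<^sup>2) 0"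
      unfolding cn by (simp add: vec_eq_iff forall_3)
    then show "((\<lambda>r. dir3 (c r) (d r)) has_vector_derivative pt (\<i> * ((cnj (c r))\<^sup>2 - (cnj (d r))\<^sup>2)) 0) (at r)"
      unfolding 3 by (simp only:) (intro derivative_intros exp')
  qed
  have key: "parallel_along \<gamma> (\<lambda>r. (1 / (n r)\<^sup>2) *\<^sub>R D r)"
    if D: "\<And>r. (D has_vector_derivative D' r) (at r)"
      and eq: "\<And>r. n r *\<^sub>R D' r + w r *\<^sub>R D r = D r $ 3 *\<^sub>R dir1 (c r) (d r) - (dir1 (c r) (d r) \<bullet> D r) *\<^sub>R axis 3 1" for D D'
    unfolding parallel_along_def Let_def vd ax \<gamma>3
  proof
    fix r
    let ?X = "(1 / (n r)\<^sup>2) *\<^sub>R dir1 (c r) (d r)" and ?V = "(1 / (n r)\<^sup>2) *\<^sub>R D r"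
    let ?rhs = "(1 / (1 / n r)) *\<^sub>R (?X $ 3 *\<^sub>R ?V + ?V $ 3 *\<^sub>R ?X - (?X \<bullet> ?V) *\<^sub>R axis 3 1)"
    have "((\<lambda>r. 1 / (n r)\<^sup>2) has_real_derivative 2 * w r / (n r) ^ 3) (at r)"
      using npos[of r] by (auto intro!: derivative_eq_intros n' simp: field_simps power2_eq_square power3_eq_cube)
    from has_vector_derivative_scaleR[OF this D]
    have "((\<lambda>r. (1 / (n r)\<^sup>2) *\<^sub>R D r) has_vector_derivative (1 / (n r)\<^sup>2) *\<^sub>R D' r + (2 * w r / (n r) ^ 3) *\<^sub>R D r) (at r)" .
    moreover have "(1 / (n r)\<^sup>2) *\<^sub>R D' r + (2 * w r / (n r) ^ 3) *\<^sub>R D r =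
      (1 / (n r) ^ 3) *\<^sub>R (w r *\<^sub>R D r + (n r *\<^sub>R D' r + w r *\<^sub>R D r))"
    proof -
      have "(1 / (n r)\<^sup>2) *\<^sub>R D' r = (1 / (n r) ^ 3) *\<^sub>R (n r *\<^sub>R D' r)"
        using npos[of r] by (simp add: power2_eq_square power3_eq_cube)
      moreover have "(2 * w r / (n r) ^ 3) *\<^sub>R D r = (1 / (n r) ^ 3) *\<^sub>R (w r *\<^sub>R D r + w r *\<^sub>R D r)"
        by (simp flip: scaleR_add_left)
      ultimately show ?thesis by (simp only: scaleR_add_right add_ac)
    qed
    moreover have "\<dots> = ?rhs"
    proof -
      have w: "dir1 (c r) (d r) $ 3 = w r" by (simp add: w_def dir1_def)
      define k where "k = 1 / (n r)\<^sup>2"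
      have "1 / (n r) ^ 3 = n r * k * k" using npos[of r] by (simp add: k_def power2_eq_square power3_eq_cube)
      then show ?thesis unfolding eq k_def[symmetric] vector_scaleR_component w
        by (simp add: scaleR_add_right scaleR_diff_right mult_ac)
    qed
    ultimately show "((\<lambda>r. (1 / (n r)\<^sup>2) *\<^sub>R D r) has_vector_derivative ?rhs) (at r)"
      by simp
  qed
  show "parallel_along \<gamma> (\<lambda>r. axis1 (A ** screw (of_real r)))"
    "parallel_along \<gamma> (\<lambda>r. axis2 (A ** screw (of_real r)))"
    "parallel_along \<gamma> (\<lambda>r. axis3 (A ** screw (of_real r)))"
    unfolding ax
    by (rule key[OF dir'(1)] key[OF dir'(2)] key[OF dir'(3)], use dir_parallel[of "c _" "d _"] in \<open>simp add: n_def w_def\<close>)+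
qed

section \<open>Complex distances\<close>

lemma axes_screw_eq:
  assumes "A \<in> SL2" "base B = base A" "axis1 B = axis1 A" "B \<in> SL2"
  shows "base (B ** screw w) = base (A ** screw w)" "axis1 (B ** screw w) = axis1 (A ** screw w)"
proof -
  obtain \<theta> where "B = A ** rot1 \<theta>" using same_base_axis1[OF assms(1,4)] assms by auto
  then have "B ** screw w = A ** screw w ** rot1 \<theta>"
    by (simp add: rot1_screw matrix_mul_assoc[symmetric] screw_mult add.commute)
  then show "base (B ** screw w) = base (A ** screw w)" "axis1 (B ** screw w) = axis1 (A ** screw w)"
    using axis1_rot1[OF SL2_mult[OF assms(1) screw_SL2[of w]]] by simp_all
qed

text \<open>By the classification of geodesics the curve comes from some matrix; at the
  parameter \<open>s\<close> that matrix and \<open>A\<close> share base point and first vector, so they differ by a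
  rotation about the geodesic, which commutes with the translations.\<close>

lemma geodesic_through_frame:
  assumes \<gamma>: "geodesic_from_to \<gamma> \<zeta> \<eta>" "\<zeta> \<noteq> \<eta>" and A: "A \<in> SL2" "base A = \<gamma> s" "axis1 A = vector_derivative \<gamma> (at s)"
  shows "\<gamma> r = base (A ** screw (of_real (r - s)))" "vector_derivative \<gamma> (at r) = axis1 (A ** screw (of_real (r - s)))"
proof -
  obtain B where B: "B \<in> SL2" "\<gamma> = (\<lambda>r. base (B ** screw (of_real r)))" using geodesic_classification[OF \<gamma>] by blast
  have vd: "vector_derivative \<gamma> (at r) = axis1 (B ** screw (of_real r))" for r
    unfolding B(2) using geodesic_screw(2)[OF B(1)] by (rule vector_derivative_at)
  have C: "B ** screw (of_real s) \<in> SL2" using B(1) by (simp add: SL2_mult)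
  have "B ** screw (of_real s) ** screw (of_real (r - s)) = B ** screw (of_real r)"
    by (simp add: matrix_mul_assoc[symmetric] screw_mult)
  then show "\<gamma> r = base (A ** screw (of_real (r - s)))" "vector_derivative \<gamma> (at r) = axis1 (A ** screw (of_real (r - s)))"
    using axes_screw_eq[OF C, of A "of_real (r - s)"] A vd B(2) by auto
qed

lemma continuous_on_screw: "continuous_on S (\<lambda>r. screw (of_real r - w))"
  unfolding screw_def by (intro continuous_intros) auto

lemma spin_translation_iff:
  assumes chart: "spin_chart E \<pi> \<Phi>" and S: "S \<in> E" and \<gamma>: "\<gamma> = (\<lambda>r. base (\<Phi> S ** screw (of_real (r - s))))"
  shows "spin_translation E \<pi> \<gamma> s t S T \<longleftrightarrow> T \<in> E \<and> \<Phi> T = \<Phi> S ** screw (of_real (t - s))"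
proof -
  note \<Phi> = spin_chartD(4,5,3)[OF chart]
  let ?F = "\<lambda>r. \<Phi> S ** screw (of_real (r - s))" and ?I = "closed_segment s t"
  have F: "continuous_on ?I ?F" "?F ` ?I \<subseteq> SL2" "?F s = \<Phi> S"
    using \<Phi>(1)[OF S] by (auto intro!: continuous_on_matrix_mult_2 continuous_on_screw SL2_mult)
  define A where "A = \<Phi> S ** screw (of_real (- s))"
  have A: "A \<in> SL2" using \<Phi>(1)[OF S] by (simp add: A_def SL2_mult)
  have FA: "?F r = A ** screw (of_real r)" for r
    by (simp add: A_def matrix_mul_assoc[symmetric] screw_mult)
  have \<gamma>A: "\<gamma> = (\<lambda>r. base (A ** screw (of_real r)))" unfolding \<gamma> FA ..
  have par: "parallel_along \<gamma> (\<lambda>r. axis1 (?F r))" "parallel_along \<gamma> (\<lambda>r. axis2 (?F r))" "parallel_along \<gamma> (\<lambda>r. axis3 (?F r))"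
    unfolding \<gamma>A FA by (rule parallel_axes[OF A])+
  have uhs: "\<gamma> r \<in> upper_half_space" for r unfolding \<gamma>A by (intro base_uhs SL2_mult A) simp
  note uniq = parallel_along_unique[OF _ _ uhs geodesic_screw(2)[OF A, folded \<gamma>A], of _ _ s]
  show ?thesis
  proof
    assume "spin_translation E \<pi> \<gamma> s t S T"
    then obtain f1 f2 f3 \<sigma> where f: "parallel_along \<gamma> f1" "parallel_along \<gamma> f2" "parallel_along \<gamma> f3"
      and \<sigma>: "continuous_on ?I \<sigma>" "\<sigma> s = S" "\<sigma> t = T"
      "\<And>r. r \<in> ?I \<Longrightarrow> \<sigma> r \<in> E \<and> \<pi> (\<sigma> r) = (\<gamma> r, f1 r, f2 r, f3 r)"
      by (auto simp: spin_translation_def)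
    have "spin_proj (\<Phi> S) = (\<gamma> s, f1 s, f2 s, f3 s)" using \<sigma>(2) \<sigma>(4)[of s] \<Phi>(2)[OF S] by simp
    then have at_s: "f1 s = axis1 (?F s)" "f2 s = axis2 (?F s)" "f3 s = axis3 (?F s)"
      unfolding F(3) by (simp_all add: spin_proj_def)
    have f': "f1 = (\<lambda>r. axis1 (?F r))" "f2 = (\<lambda>r. axis2 (?F r))" "f3 = (\<lambda>r. axis3 (?F r))"
      by (rule uniq[OF f(1) par(1)] uniq[OF f(2) par(2)] uniq[OF f(3) par(3)], rule at_s)+
    have "\<Phi> (\<sigma> t) = ?F t"
    proof (rule spin_path_lift_end[OF chart F(1,2)])
      show "\<sigma> r \<in> E \<and> \<pi> (\<sigma> r) = spin_proj (?F r)" if "r \<in> ?I" for r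
        using \<sigma>(4)[OF that] unfolding f' by (simp add: spin_proj_def \<gamma>)
    qed (use \<sigma> F(3) in auto)
    then show "T \<in> E \<and> \<Phi> T = \<Phi> S ** screw (of_real (t - s))" using \<sigma>(3) \<sigma>(4)[of t] by auto
  next
    assume T: "T \<in> E \<and> \<Phi> T = \<Phi> S ** screw (of_real (t - s))"
    obtain \<sigma> where \<sigma>: "continuous_on ?I \<sigma>" "\<sigma> s = S"
      "\<And>r. r \<in> ?I \<Longrightarrow> \<sigma> r \<in> E \<and> \<pi> (\<sigma> r) = spin_proj (?F r) \<and> \<Phi> (\<sigma> r) = ?F r"
      using spin_path_lift[OF chart S F] by blast
    have "\<sigma> t = T" using \<sigma>(3)[of t] T \<Phi>(3) by (auto simp: inj_on_def)
    moreover have "\<pi> (\<sigma> r) = (\<gamma> r, axis1 (?F r), axis2 (?F r), axis3 (?F r))" if "r \<in> ?I" for r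
      using \<sigma>(3)[OF that] by (simp add: spin_proj_def \<gamma>)
    ultimately show "spin_translation E \<pi> \<gamma> s t S T"
      unfolding spin_translation_def using par \<sigma> by blast
  qed
qed

text \<open>In a spin chart the complex distance from \<open>S\<close> to \<open>S'\<close> is a number \<open>w\<close> for
  which right multiplication by \<open>screw w\<close> takes \<open>S\<close> to \<open>S'\<close>; the ambiguity modulo
  \<open>4 * pi * \<i>\<close> is the period of \<open>screw\<close>.\<close>

lemma complex_distanceD:
  assumes chart: "spin_chart E \<pi> \<Phi>" and \<gamma>: "geodesic_from_to \<gamma> \<zeta> \<eta>" "\<zeta> \<noteq> \<eta>"
    and "complex_distance E \<pi> \<gamma> S S' w"
  shows "\<Phi> S' = \<Phi> S ** screw w"
proof -
  obtain s t T where *: "t - s = Re w" "adapted_at \<gamma> s (\<pi> S)" "spin_translation E \<pi> \<gamma> s t S T"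
    "spin_rotation E \<pi> (vector_derivative \<gamma> (at t)) (Im w) T S'"
    using assms(4) by (auto simp: complex_distance_def)
  have S: "S \<in> E" using *(3) by (auto simp: spin_translation_def)
  note \<Phi>S = spin_chartD(4,5)[OF chart S]
  have ad: "base (\<Phi> S) = \<gamma> s" "axis1 (\<Phi> S) = vector_derivative \<gamma> (at s)"
    using *(2) unfolding \<Phi>S(2)[symmetric] by (simp_all add: spin_proj_def)
  note geo = geodesic_through_frame[OF \<gamma> \<Phi>S(1) ad]
  have "\<gamma> = (\<lambda>r. base (\<Phi> S ** screw (of_real (r - s))))" using geo(1) by (rule ext)
  from spin_translation_iff[OF chart S this] *(3)
  have T: "T \<in> E" "\<Phi> T = \<Phi> S ** screw (of_real (t - s))" by auto
  have "spin_rotation E \<pi> (axis1 (\<Phi> T)) (Im w) T S'" using *(4) by (simp only: geo(2) T(2))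
  then have "\<Phi> S' = \<Phi> S ** screw (of_real (t - s)) ** rot1 (Im w)"
    using spin_rotation_axis(1)[OF chart T(1)] T(2) by auto
  also have "\<dots> = \<Phi> S ** screw (of_real (Re w) + \<i> * of_real (Im w))"
    by (simp add: rot1_screw matrix_mul_assoc[symmetric] screw_mult *(1))
  finally show ?thesis by (simp flip: complex_eq)
qed

lemma complex_distanceI:
  assumes chart: "spin_chart E \<pi> \<Phi>" and S: "S \<in> E" "S' \<in> E" and w: "\<Phi> S' = \<Phi> S ** screw w"
  shows "complex_distance E \<pi> (\<lambda>r. base (\<Phi> S ** screw (of_real r))) S S' w"
proof -
  let ?\<gamma> = "\<lambda>r. base (\<Phi> S ** screw (of_real r))"
  note \<Phi> = spin_chartD(4,5)[OF chart]
  let ?F = "\<lambda>r. \<Phi> S ** screw (of_real r)"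
  have F: "continuous_on (closed_segment 0 (Re w)) ?F" "?F ` closed_segment 0 (Re w) \<subseteq> SL2" "?F 0 = \<Phi> S"
    using \<Phi>(1)[OF S(1)] continuous_on_screw[of _ 0] by (auto intro!: continuous_on_matrix_mult_2 SL2_mult)
  obtain \<sigma> where \<sigma>: "\<And>r. r \<in> closed_segment 0 (Re w) \<Longrightarrow> \<sigma> r \<in> E \<and> \<Phi> (\<sigma> r) = ?F r"
    using spin_path_lift[OF chart S(1) F] by blast
  define T where "T = \<sigma> (Re w)"
  have T: "T \<in> E" "\<Phi> T = \<Phi> S ** screw (of_real (Re w))" using \<sigma>[of "Re w"] by (auto simp: T_def)
  have vd: "vector_derivative ?\<gamma> (at r) = axis1 (?F r)" for r
    using geodesic_screw(2)[OF \<Phi>(1)[OF S(1)]] by (rule vector_derivative_at)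
  have "\<Phi> T ** rot1 (Im w) = \<Phi> S ** screw (of_real (Re w) + \<i> * of_real (Im w))"
    unfolding T(2) by (simp add: rot1_screw matrix_mul_assoc[symmetric] screw_mult)
  then have S': "\<Phi> S' = \<Phi> T ** rot1 (Im w)" using w by (simp flip: complex_eq)
  have "spin_translation E \<pi> ?\<gamma> 0 (Re w) S T"
    using spin_translation_iff[OF chart S(1), of ?\<gamma> 0 "Re w" T] T by simp
  moreover have "spin_rotation E \<pi> (vector_derivative ?\<gamma> (at (Re w))) (Im w) T S'"
    using spin_rotation_axis(1)[OF chart T(1), of "Im w" S'] S(2) S' by (simp add: vd T(2))
  moreover have "adapted_at ?\<gamma> 0 (\<pi> S)"
    unfolding \<Phi>(2)[OF S(1), symmetric] by (simp add: spin_proj_def vd)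
  moreover have "adapted_at ?\<gamma> (Re w) (\<pi> S')"
    unfolding \<Phi>(2)[OF S(2), symmetric] S' using axis1_rot1[OF \<Phi>(1)[OF T(1)]] by (simp add: spin_proj_def vd T(2))
  ultimately show ?thesis
    unfolding complex_distance_def by (intro exI[of _ 0] exI[of _ "Re w"] exI[of _ T]) simp
qed

section \<open>Horospheres and spinors\<close>

text \<open>The horosphere level as a function of the spinor. If the first vector of the
  frame of \<open>A\<close> points away from the centre of a horosphere through its base point, then
  this centre is the image of \<open>0\<close> under \<open>A\<close>, that is, the ideal point of the second
  column.\<close>

definition spinor_level :: "complex^2 \<Rightarrow> real"
  where "spinor_level k = (if k $ 2 = 0 then (cmod (k $ 1))\<^sup>2 else (cmod (k $ 2))\<^sup>2)"

lemma base_minus_center: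
  assumes A: "A \<in> SL2" and d: "A $ 2 $ 2 \<noteq> 0"
  shows "base A - pt (A $ 1 $ 2 / A $ 2 $ 2) 0 = pt (cnj (A $ 2 $ 1) / (row_norm A * A $ 2 $ 2)) (1 / row_norm A)"
    and "(dist (base A) (pt (A $ 1 $ 2 / A $ 2 $ 2) 0))\<^sup>2 = 1 / (row_norm A * (cmod (A $ 2 $ 2))\<^sup>2)"
proof -
  have n: "row_norm A > 0" by (rule row_norm_pos[OF A])
  define \<zeta> where "\<zeta> = cpart (base A)"
  have e: "A $ 1 $ 2 / A $ 2 $ 2 = \<zeta> - cnj (A $ 2 $ 1) / (row_norm A * A $ 2 $ 2)"
    using d unfolding \<zeta>_def by (subst SL2_first_row(2)[OF A]) (simp add: diff_divide_distrib)
  have b: "base A = pt \<zeta> (1 / row_norm A)" unfolding \<zeta>_def by (metis base_3 pt_cpart)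
  show 1: "base A - pt (A $ 1 $ 2 / A $ 2 $ 2) 0 = pt (cnj (A $ 2 $ 1) / (row_norm A * A $ 2 $ 2)) (1 / row_norm A)"
    unfolding e b pt_arith by simp
  have "(cmod (A $ 2 $ 1))\<^sup>2 = row_norm A - (cmod (A $ 2 $ 2))\<^sup>2" by (simp add: row_norm_def)
  then show "(dist (base A) (pt (A $ 1 $ 2 / A $ 2 $ 2) 0))\<^sup>2 = 1 / (row_norm A * (cmod (A $ 2 $ 2))\<^sup>2)"
    unfolding dist_norm 1 norm_pt_sq using n d
    by (simp add: norm_divide norm_mult power_divide power_mult_distrib) (simp add: field_simps power2_eq_square)
qed

lemma horo_level_base:
  assumes A: "A \<in> SL2"
  shows "horo_level (ideal_of (column 2 A)) (base A) = spinor_level (column 2 A)"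
proof (cases "A $ 2 $ 2 = 0")
  case True
  then have "A $ 1 $ 2 * A $ 2 $ 1 = - 1" using A by (simp add: SL2_iff minus_equation_iff)
  then have "cmod (A $ 1 $ 2) * cmod (A $ 2 $ 1) = 1" by (metis norm_minus_cancel norm_mult norm_one)
  then have "(cmod (A $ 1 $ 2))\<^sup>2 * (cmod (A $ 2 $ 1))\<^sup>2 = 1" by (metis power_mult_distrib power_one)
  moreover from this have "A $ 2 $ 1 \<noteq> 0" by auto
  ultimately show ?thesis using True by (simp add: ideal_of_def spinor_level_def row_norm_def field_simps)
next
  case False
  then have "horo_level (ideal_of (column 2 A)) (base A) = (1 / row_norm A) / (dist (base A) (pt (A $ 1 $ 2 / A $ 2 $ 2) 0))\<^sup>2"
    by (simp add: ideal_of_def pt_def)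
  then show ?thesis using False row_norm_pos[OF A] by (simp add: base_minus_center(2)[OF A False] spinor_level_def)
qed

lemma normal_outI:
  assumes x: "x \<in> upper_half_space" and N: "hyp_inner x N N = 1" and k: "k > 0"
    and D: "(horo_level \<zeta> has_derivative (\<lambda>u. k * hyp_inner x N u)) (at x)"
  shows "normal_out \<zeta> x = N"
  unfolding normal_out_def
proof (rule the_equality)
  show "hyp_inner x N N = 1 \<and> (\<exists>k>0. (horo_level \<zeta> has_derivative (\<lambda>u. k * hyp_inner x N u)) (at x))"
    using N k D by blast
  fix M assume M: "hyp_inner x M M = 1 \<and> (\<exists>k>0. (horo_level \<zeta> has_derivative (\<lambda>u. k * hyp_inner x M u)) (at x))"
  then obtain m where m: "m > 0" "(horo_level \<zeta> has_derivative (\<lambda>u. m * hyp_inner x M u)) (at x)" by blast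
  have x3: "x $ 3 > 0" by (rule uhs_pos[OF x])
  have "m * hyp_inner x M u = k * hyp_inner x N u" for u
    using has_derivative_unique[OF m(2) D] by metis
  then have "(m *\<^sub>R M) \<bullet> u = (k *\<^sub>R N) \<bullet> u" for u
    using x3 by (simp add: hyp_inner_def)
  then have eq: "m *\<^sub>R M = k *\<^sub>R N" using vector_eq_rdot by metis
  have "m\<^sup>2 * hyp_inner x M M = k\<^sup>2 * hyp_inner x N N"
    using arg_cong[OF eq, of "\<lambda>v. hyp_inner x v v"] by (simp add: hyp_inner_def power2_eq_square mult.assoc)
  then have "m = k" using M N m(1) k by simp
  then show "M = N" using eq k by simp
qed

lemma normal_out_base:
  assumes A: "A \<in> SL2"
  shows "normal_out (ideal_of (column 2 A)) (base A) = - axis1 A"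
proof (rule normal_outI[OF base_uhs[OF A]])
  show "hyp_inner (base A) (- axis1 A) (- axis1 A) = 1"
  proof -
    have "hyp_inner (base A) (- axis1 A) (- axis1 A) = hyp_inner (base A) (axis1 A) (axis1 A)"
      unfolding hyp_inner_def by simp
    then show ?thesis using axis_inner(1)[OF A] by simp
  qed
  define n where "n = row_norm A"
  have n: "n > 0" using row_norm_pos[OF A] by (simp add: n_def)
  show "(horo_level (ideal_of (column 2 A)) has_derivative (\<lambda>u. spinor_level (column 2 A) * hyp_inner (base A) (- axis1 A) u)) (at (base A))"
  proof (cases "A $ 2 $ 2 = 0")
    case True
    have *: "spinor_level (column 2 A) = 1 / n" using horo_level_base[OF A] True by (simp add: ideal_of_def n_def)
    have "- axis1 A = pt 0 (1 / n)"
      using n True by (simp add: axis1_def dir1_def pt_arith n_def row_norm_def pt_eq_iff power2_eq_square)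
    then have "hyp_inner (base A) (- axis1 A) u = n * u $ 3" for u
      using n by (simp add: hyp_inner_def n_def[symmetric] inner_vec_def sum_3 power2_eq_square)
    moreover have "horo_level Infty = (\<lambda>x. x $ 3)" by auto
    moreover have "((\<lambda>x::real^3. x $ 3) has_derivative (\<lambda>u. u $ 3)) (at (base A))"
      by (rule bounded_linear_imp_has_derivative[OF bounded_linear_vec_nth])
    ultimately show ?thesis using True n by (simp add: ideal_of_def *)
  next
    case False
    define p where "p = pt (A $ 1 $ 2 / A $ 2 $ 2) 0"
    define y where "y = base A - p"
    define m where "m = (cmod (A $ 2 $ 2))\<^sup>2"
    have m: "m > 0" using False by (simp add: m_def)
    have yy: "y \<bullet> y = 1 / (n * m)"
      using base_minus_center(2)[OF A False] by (simp add: y_def p_def dist_norm power2_norm_eq_inner n_def m_def)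
    have hl: "horo_level (ideal_of (column 2 A)) = (\<lambda>x. x $ 3 / ((x - p) \<bullet> (x - p)))"
      using False by (auto simp: ideal_of_def p_def pt_def dist_norm power2_norm_eq_inner)
    have "((\<lambda>x::real^3. x $ 3) has_derivative (\<lambda>u. u $ 3)) (at (base A))"
      by (rule bounded_linear_imp_has_derivative[OF bounded_linear_vec_nth])
    moreover have "((\<lambda>x. (x - p) \<bullet> (x - p)) has_derivative (\<lambda>u. y \<bullet> u + u \<bullet> y)) (at (base A))"
      unfolding y_def by (auto intro!: derivative_eq_intros)
    ultimately have "((\<lambda>x. x $ 3 / ((x - p) \<bullet> (x - p))) has_derivative
      (\<lambda>u. (u $ 3 * ((base A - p) \<bullet> (base A - p)) - base A $ 3 * (y \<bullet> u + u \<bullet> y)) / (((base A - p) \<bullet> (base A - p)) * ((base A - p) \<bullet> (base A - p))))) (at (base A))"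
      by (rule has_derivative_divide') (use yy n m in \<open>auto simp: y_def\<close>)
    moreover have "(u $ 3 * ((base A - p) \<bullet> (base A - p)) - base A $ 3 * (y \<bullet> u + u \<bullet> y)) / (((base A - p) \<bullet> (base A - p)) * ((base A - p) \<bullet> (base A - p)))
      = spinor_level (column 2 A) * hyp_inner (base A) (- axis1 A) u" for u
    proof -
      have "(u $ 3 * (y \<bullet> y) - base A $ 3 * (y \<bullet> u + u \<bullet> y)) / ((y \<bullet> y) * (y \<bullet> y)) = m * (n * u $ 3 - 2 * n * m * (y \<bullet> u))"
        unfolding yy using n m by (simp add: inner_commute[of u] n_def[symmetric] field_simps)
      also have "\<dots> = m * hyp_inner (base A) (- axis1 A) u"
      proof -
        have y: "y = pt (cnj (A $ 2 $ 1) / (n * A $ 2 $ 2)) (1 / n)"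
          unfolding y_def p_def n_def by (rule base_minus_center(1)[OF A False])
        have "complex_of_real m / A $ 2 $ 2 = cnj (A $ 2 $ 2)"
          using False unfolding m_def cmod_sq by simp
        then have 1: "m *\<^sub>R (cnj (A $ 2 $ 1) / (n * A $ 2 $ 2)) = cnj (A $ 2 $ 1) * cnj (A $ 2 $ 2) / n"
          by (simp add: scaleR_conv_of_real) (metis (no_types, lifting) mult.commute times_divide_eq_left times_divide_eq_right divide_divide_eq_left)
        have "n = (cmod (A $ 2 $ 1))\<^sup>2 + m" by (simp add: n_def m_def row_norm_def)
        then have 2: "n - 2 * m = (cmod (A $ 2 $ 1))\<^sup>2 - m" by simp
        have "n *\<^sub>R axis 3 1 - (2 * n) *\<^sub>R m *\<^sub>R y = pt (- (2 * cnj (A $ 2 $ 1) * cnj (A $ 2 $ 2))) (n - 2 * m)"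
          unfolding y pt_arith 1 using n by (simp add: vec_eq_iff forall_3 axis_def)
        also have "\<dots> = - dir1 (A $ 2 $ 1) (A $ 2 $ 2)"
          unfolding 2 unfolding dir1_def m_def by (simp add: pt_arith)
        finally have 3: "- dir1 (A $ 2 $ 1) (A $ 2 $ 2) = n *\<^sub>R axis 3 1 - (2 * n) *\<^sub>R m *\<^sub>R y" ..
        have "hyp_inner (base A) (- axis1 A) u = (- dir1 (A $ 2 $ 1) (A $ 2 $ 2)) \<bullet> u"
          using n by (simp add: hyp_inner_def axis1_def n_def[symmetric] power2_eq_square)
        also have "\<dots> = n * u $ 3 - 2 * n * m * (y \<bullet> u)"
          unfolding 3 by (simp add: inner_diff_left inner_axis')
        finally show ?thesis by simp
      qed
      also have "m = spinor_level (column 2 A)" using False by (simp add: m_def spinor_level_def)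
      finally show ?thesis by (simp add: y_def)
    qed
    ultimately show ?thesis unfolding hl by simp
  qed
  show "spinor_level (column 2 A) > 0"
    using A by (auto simp: spinor_level_def SL2_iff)
qed

text \<open>A geodesic starts from every ideal point through every point of the space. The
  proof solves for the bottom row: \<open>x\<close> and the ideal point fix its direction, the height
  of \<open>x\<close> its norm.\<close>

lemma SL2_base_center_exists:
  assumes x: "x \<in> upper_half_space"
  shows "\<exists>A\<in>SL2. base A = x \<and> ideal_of (column 2 A) = \<zeta>"
proof (cases \<zeta>)
  case Infty
  define c where "c = complex_of_real (1 / sqrt (x $ 3))"
  have x3: "x $ 3 > 0" using uhs_pos[OF x] .
  then have "(cmod c)\<^sup>2 + (cmod 0)\<^sup>2 = 1 / x $ 3" by (simp add: c_def norm_divide power_divide)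
  from base_of_base_row[OF this x] show ?thesis
    by (intro bexI[of _ "of_base_row x c 0"]) (simp_all add: Infty ideal_of_def, simp add: of_base_row_def)
next
  case (Fin z)
  define t where "t = x $ 3"
  \<comment> \<open>The condition that \<open>(b, d)\<close> is proportional to \<open>(z, 1)\<close> reads
    \<open>cnj c = q * d\<close>, and \<open>d = r\<close> is chosen real.\<close>
  define q where "q = (cpart x - z) / t"
  define r where "r = 1 / sqrt (t * (1 + (cmod q)\<^sup>2))"
  have t: "t > 0" using uhs_pos[OF x] by (simp add: t_def)
  have q: "1 + (cmod q)\<^sup>2 > 0" by (simp add: add_pos_nonneg)
  then have r: "r > 0" "r\<^sup>2 * (1 + (cmod q)\<^sup>2) = 1 / t" using t less_imp_neq[OF q] by (simp_all add: r_def power_divide)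
  have "(cmod (cnj q * r))\<^sup>2 + (cmod (complex_of_real r))\<^sup>2 = 1 / x $ 3"
    using r(2) by (simp add: norm_mult power_mult_distrib t_def algebra_simps)
  note * = base_of_base_row[OF this x]
  have qt: "q * t = cpart x - z" using t by (simp add: q_def)
  have "cpart x * complex_of_real r - q * r * t = cpart x * r - (q * t) * r" by simp
  also have "\<dots> = z * r" unfolding qt by (simp add: algebra_simps)
  finally have "cpart x * complex_of_real r - q * r * t = z * r" .
  then have "ideal_of (column 2 (of_base_row x (cnj q * r) r)) = Fin z"
    using r(1) by (simp add: ideal_of_def of_base_row_def t_def[symmetric])
  then show ?thesis using * Fin by blast
qed

text \<open>The second column and the base point determine the lower left entry through
  the formula for the first row.\<close>

lemma SL2_eqI_column:
  assumes A: "A \<in> SL2" and B: "B \<in> SL2" and base: "base A = base B" and col: "column 2 A = column 2 B"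
  shows "A = B"
proof (rule SL2_eqI[OF A B base])
  have n: "row_norm A = row_norm B" using base_3[of A] base_3[of B] row_norm_pos[OF A] row_norm_pos[OF B] base by simp
  have ent: "A $ 1 $ 2 = B $ 1 $ 2" "A $ 2 $ 2 = B $ 2 $ 2" using col by (simp_all add: vec_eq_iff)
  then have "cnj (A $ 2 $ 1) / row_norm B = cnj (B $ 2 $ 1) / row_norm B"
    using SL2_first_row(2)[OF A] SL2_first_row(2)[OF B] base n by simp
  then show "A $ 2 $ 1 = B $ 2 $ 1" using row_norm_pos[OF B] by simp
qed (use col in \<open>simp add: vec_eq_iff\<close>)

lemma column_2_rot1: "column 2 (A ** rot1 \<theta>) = cis (- \<theta> / 2) *s column 2 A" for A :: "complex^2^2"
  by (simp add: vec_eq_iff forall_2 rot1_def)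

lemma column_nonzero: "A \<in> SL2 \<Longrightarrow> column j A \<noteq> 0"
  using SL2_vec_nonzero[of A "axis j 1"] by (simp add: matrix_vector_axis axis_eq_0_iff)

text \<open>Some matrix with this base point has its second column over \<open>\<zeta>\<close>, hence the
  same first vector as \<open>A\<close>; the two differ by a rotation about this vector, which only
  rescales the second column.\<close>

lemma center_of_axis1:
  assumes A: "A \<in> SL2" and ax: "axis1 A = normal_in \<zeta> (base A)"
  shows "ideal_of (column 2 A) = \<zeta>"
proof -
  obtain B where B: "B \<in> SL2" "base B = base A" "ideal_of (column 2 B) = \<zeta>"
    using SL2_base_center_exists[OF base_uhs[OF A]] by blast
  have "axis1 B = axis1 A" using normal_out_base[OF B(1)] B ax by (simp add: normal_in_def)
  then obtain \<theta> where "A = B ** rot1 \<theta>" using same_base_axis1[OF B(1) A] B(2) by auto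
  then show ?thesis using B(3) by (simp add: column_2_rot1 ideal_of_scale)
qed

lemma same_ideal_scale:
  assumes "k \<noteq> 0" "l \<noteq> 0" "ideal_of k = ideal_of l"
  shows "\<exists>m. m \<noteq> 0 \<and> k = m *s l"
proof -
  have det: "k $ 1 * l $ 2 = k $ 2 * l $ 1" using ideal_of_eq_iff[OF assms(1,2)] assms(3) by (simp add: spinor_det_def)
  show ?thesis
  proof (cases "l $ 2 = 0")
    case True
    then have l1: "l $ 1 \<noteq> 0" using assms(2) by (auto simp: vec_eq_iff forall_2)
    then have "k $ 2 = 0" using det True by auto
    then show ?thesis using assms(1) l1 True by (intro exI[of _ "k $ 1 / l $ 1"]) (auto simp: vec_eq_iff forall_2)
  next
    case False
    then have "k $ 1 = k $ 2 / l $ 2 * l $ 1" using det by (simp add: field_simps)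
    then show ?thesis using assms(1) False by (intro exI[of _ "k $ 2 / l $ 2"]) (auto simp: vec_eq_iff forall_2)
  qed
qed

lemma spinor_level_scale: "spinor_level (m *s k) = (cmod m)\<^sup>2 * spinor_level k"
  by (auto simp: spinor_level_def norm_mult power_mult_distrib)

lemma spinor_level_pos: "k \<noteq> 0 \<Longrightarrow> spinor_level k > 0"
  by (auto simp: spinor_level_def vec_eq_iff forall_2)

text \<open>By \<open>SL2_base_center_exists\<close> the second column can be given the right
  direction. Equality of levels fixes its absolute value, and a rotation about the first
  vector adjusts the phase.\<close>

lemma SL2_base_column_exists:
  assumes k: "k \<noteq> 0" and y: "y \<in> upper_half_space" "horo_level (ideal_of k) y = spinor_level k"
  shows "\<exists>C\<in>SL2. base C = y \<and> column 2 C = k"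
proof -
  obtain B where B: "B \<in> SL2" "base B = y" "ideal_of (column 2 B) = ideal_of k"
    using SL2_base_center_exists[OF y(1)] by blast
  obtain m where m: "k = m *s column 2 B" using same_ideal_scale[OF k column_nonzero[OF B(1)]] B(3) by metis
  have "spinor_level k = spinor_level (column 2 B)"
    using y(2) horo_level_base[OF B(1)] B by simp
  then have "(cmod m)\<^sup>2 * spinor_level (column 2 B) = spinor_level (column 2 B)"
    unfolding m spinor_level_scale .
  then have "cmod m = 1"
    using spinor_level_pos[OF column_nonzero[OF B(1), of 2]] by (simp add: power2_eq_1_iff) (smt (verit) norm_ge_zero)
  then have "m = cis (Arg2pi m)" using complex_norm_eq_1_exp[of m] by (simp add: cis_conv_exp)
  then have "column 2 (B ** rot1 (- 2 * Arg2pi m)) = k" unfolding m column_2_rot1 by simp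
  moreover have "base (B ** rot1 (- 2 * Arg2pi m)) = y" using axis1_rot1(2)[OF B(1)] B(2) by simp
  ultimately show ?thesis using B(1) by (intro bexI[of _ "B ** rot1 (- 2 * Arg2pi m)"]) (auto intro: SL2_mult)
qed

section \<open>The spinor of a spin decoration\<close>

lemma SL2_fixes_two:
  assumes "P *v k = k" "P *v l = l" "spinor_det k l \<noteq> 0"
  shows "P = mat 1"
proof -
  have "P $ 1 $ 1 * k $ 1 + P $ 1 $ 2 * k $ 2 = k $ 1" "P $ 2 $ 1 * k $ 1 + P $ 2 $ 2 * k $ 2 = k $ 2"
    "P $ 1 $ 1 * l $ 1 + P $ 1 $ 2 * l $ 2 = l $ 1" "P $ 2 $ 1 * l $ 1 + P $ 2 $ 2 * l $ 2 = l $ 2"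
    using assms(1,2) by (simp_all add: vec_eq_iff forall_2)
  moreover have "(p - 1) * (x * v - y * u) = 0 \<and> q * (x * v - y * u) = 0" if "p * x + q * y = x" "p * u + q * v = u" for p q x y u v :: complex
  proof
    have "(p - 1) * (x * v - y * u) = v * (p * x + q * y - x) - y * (p * u + q * v - u)" by (simp add: algebra_simps)
    then show "(p - 1) * (x * v - y * u) = 0" using that by simp
    have "q * (x * v - y * u) = x * (p * u + q * v - u) - u * (p * x + q * y - x)" by (simp add: algebra_simps)
    then show "q * (x * v - y * u) = 0" using that by simp
  qed
  moreover have "p * (x * v - y * u) = 0 \<and> (q - 1) * (x * v - y * u) = 0" if "p * x + q * y = y" "p * u + q * v = v" for p q x y u v :: complex
  proof
    have "p * (x * v - y * u) = v * (p * x + q * y - y) - y * (p * u + q * v - v)" by (simp add: algebra_simps)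
    then show "p * (x * v - y * u) = 0" using that by simp
    have "(q - 1) * (x * v - y * u) = x * (p * u + q * v - v) - u * (p * x + q * y - y)" by (simp add: algebra_simps)
    then show "(q - 1) * (x * v - y * u) = 0" using that by simp
  qed
  ultimately have "(P $ 1 $ 1 - 1) * spinor_det k l = 0" "P $ 1 $ 2 * spinor_det k l = 0"
    "P $ 2 $ 1 * spinor_det k l = 0" "(P $ 2 $ 2 - 1) * spinor_det k l = 0"
    unfolding spinor_det_def by blast+
  then show ?thesis using assms(3) by (simp add: mat2_eq_iff mat_def)
qed

text \<open>A frame pointing away from the centre \<open>ideal_of k\<close> has a second column
  proportional to \<open>k\<close>, which \<open>P\<close> fixes. Since such a frame is determined by its base point
  and second column, a fixed point of \<open>\<phi>\<close> in the space would force \<open>P = mat 1\<close>; and levels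
  at the centre, being functions of the second column, are preserved. A second fixed ideal
  point would be a second eigenvector, with eigenvalue \<open>1\<close> by the determinant.\<close>

lemma parabolic_of_fixed_spinor:
  assumes P: "P \<in> SL2" "P \<noteq> mat 1" "P *v k = k" "k \<noteq> 0" and \<phi>: "realizes \<phi> P"
    and H: "horosphere (ideal_of k) H"
  shows "parabolic_isometry \<phi>" "\<phi> ` H = H"
proof -
  have op: "op_isometry \<phi>" using \<phi> by (simp add: realizes_def)
  have fixcol: "P *v column 2 A = column 2 A" if A: "A \<in> SL2" "ideal_of (column 2 A) = ideal_of k" for A
  proof -
    obtain m where "column 2 A = m *s k" using same_ideal_scale[OF column_nonzero[OF A(1)] P(4) A(2)] by blast
    then show ?thesis using P(3) by (simp add: vector_scalar_commute)
  qed
  have nofix: "\<phi> x \<noteq> x" if x: "x \<in> upper_half_space" for x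
  proof
    assume eq: "\<phi> x = x"
    obtain A where A: "A \<in> SL2" "base A = x" "ideal_of (column 2 A) = ideal_of k"
      using SL2_base_center_exists[OF x] by blast
    have "P ** A = A"
    proof (rule SL2_eqI_column[OF SL2_mult[OF P(1) A(1)] A(1)])
      show "base (P ** A) = base A" using realizes_base[OF \<phi> A(1)] eq A(2) by metis
      show "column 2 (P ** A) = column 2 A" using fixcol[OF A(1,3)] by (simp add: column_mult)
    qed
    then have "P ** (A ** adjugate A) = A ** adjugate A" by (simp add: matrix_mul_assoc)
    then show False using P(2) A(1) by (simp add: adjugate_mult)
  qed
  have level: "horo_level (ideal_of k) (\<phi> x) = horo_level (ideal_of k) x" if x: "x \<in> upper_half_space" for x
  proof -
    obtain A where A: "A \<in> SL2" "base A = x" "ideal_of (column 2 A) = ideal_of k"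
      using SL2_base_center_exists[OF x] by blast
    have c: "column 2 (P ** A) = column 2 A" using fixcol[OF A(1,3)] by (simp add: column_mult)
    show ?thesis
      using horo_level_base[OF A(1)] horo_level_base[OF SL2_mult[OF P(1) A(1)]] realizes_base[OF \<phi> A(1)] A(2,3)
      by (simp add: c)
  qed
  have uniq: "\<zeta> = ideal_of k" if "ideal_maps_to \<phi> \<zeta> \<zeta>" for \<zeta>
  proof (rule ccontr)
    assume ne: "\<zeta> \<noteq> ideal_of k"
    obtain l where l: "l \<noteq> 0" "ideal_of l = \<zeta>" using ideal_of_surj by blast
    have Pl: "P *v l \<noteq> 0" using SL2_vec_nonzero[OF P(1) l(1)] .
    have det: "spinor_det k l \<noteq> 0" using ideal_of_eq_iff[OF P(4) l(1)] ne l(2) by auto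
    have "ideal_maps_to \<phi> \<zeta> (ideal_of (P *v l))" using \<phi> l by (auto simp: realizes_def)
    then have "ideal_of (P *v l) = ideal_of l" using ideal_maps_to_unique that l(2) by metis
    then obtain m where m: "P *v l = m *s l" using same_ideal_scale[OF Pl l(1)] by blast
    have "spinor_det k l = spinor_det (P *v k) (P *v l)" using P(1) by (simp add: spinor_det_mult SL2_def)
    also have "\<dots> = m * spinor_det k l" by (simp add: P(3) m spinor_det_scale)
    finally have "m = 1" using det by simp
    then show False using SL2_fixes_two[OF P(3) _ det] m P(2) by simp
  qed
  have "ideal_maps_to \<phi> (ideal_of k) (ideal_of k)" using \<phi> P(3,4) unfolding realizes_def by metis
  then show "parabolic_isometry \<phi>"
    unfolding parabolic_isometry_def using op nofix uniq by blast
  obtain c where c: "H = {x \<in> upper_half_space. horo_level (ideal_of k) x = c}" using H by (auto simp: horosphere_def)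
  have bij: "\<phi> ` upper_half_space = upper_half_space"
    using op_isometryD(1)[OF op] by (simp add: hyp_isometry_def bij_betw_def)
  show "\<phi> ` H = H"
  proof
    show "\<phi> ` H \<subseteq> H" using level bij by (auto simp: c)
    show "H \<subseteq> \<phi> ` H"
    proof
      fix y assume y: "y \<in> H"
      then obtain x where "x \<in> upper_half_space" "y = \<phi> x" using bij by (auto simp: c)
      then show "y \<in> \<phi> ` H" using y level by (auto simp: c)
    qed
  qed
qed

lemma horosphere_nonempty: "horosphere \<zeta> H \<Longrightarrow> \<exists>x. x \<in> H"
proof -
  assume "horosphere \<zeta> H"
  then obtain c where c: "c > 0" "H = {x \<in> upper_half_space. horo_level \<zeta> x = c}" by (auto simp: horosphere_def)
  show ?thesis
  proof (cases \<zeta>)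
    case (Fin z)
    have "(dist (pt z (1 / c)) (pt z 0))\<^sup>2 = (1 / c)\<^sup>2" by (simp add: dist_norm pt_arith norm_pt_sq)
    then have "horo_level \<zeta> (pt z (1 / c)) = c" using c(1) by (simp add: Fin pt_def[symmetric] power2_eq_square)
    then show ?thesis using c by (intro exI[of _ "pt z (1 / c)"]) auto
  next
    case Infty
    then show ?thesis using c by (intro exI[of _ "pt 0 c"]) auto
  qed
qed

text \<open>The level of the base point, and with it membership in the horosphere, depends
  only on the second column.\<close>

lemma horosphere_spinor:
  assumes H: "horosphere \<zeta> H" and A: "A \<in> SL2" "base A \<in> H" "ideal_of (column 2 A) = \<zeta>"
  shows "y \<in> H \<longleftrightarrow> (\<exists>C\<in>SL2. base C = y \<and> column 2 C = column 2 A)"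
proof -
  obtain c where c: "H = {x \<in> upper_half_space. horo_level \<zeta> x = c}" using H by (auto simp: horosphere_def)
  have lev: "spinor_level (column 2 A) = c" using A horo_level_base[OF A(1)] by (simp add: c)
  have "base C \<in> H" if "C \<in> SL2" "column 2 C = column 2 A" for C
    using horo_level_base[OF that(1)] base_uhs[OF that(1)] that(2) lev A(3) by (simp add: c)
  moreover have "\<exists>C\<in>SL2. base C = y \<and> column 2 C = column 2 A" if "y \<in> H"
    using SL2_base_column_exists[OF column_nonzero[OF A(1)], of y 2] that lev A(3) by (simp add: c)
  ultimately show ?thesis by blast
qed

text \<open>The horosphere is the orbit of one of its points under a group isomorphic to
  the complex numbers: frames with the same second column differ by lower unipotent
  factors on the right.\<close>

lemma horosphere_connected:
  assumes H: "horosphere \<zeta> H" and A: "A \<in> SL2" "base A \<in> H" "ideal_of (column 2 A) = \<zeta>"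
  shows "connected H"
proof -
  have L: "A ** mat2 1 0 w 1 \<in> SL2" for w using A(1) by (simp add: SL2_mult)
  have "H = range (\<lambda>w. base (A ** mat2 1 0 w 1))"
  proof
    show "range (\<lambda>w. base (A ** mat2 1 0 w 1)) \<subseteq> H"
    proof
      fix y assume "y \<in> range (\<lambda>w. base (A ** mat2 1 0 w 1))"
      then obtain w where y: "y = base (A ** mat2 1 0 w 1)" by auto
      have "column 2 (A ** mat2 1 0 w 1) = column 2 A" by (simp add: vec_eq_iff)
      then show "y \<in> H" using horosphere_spinor[OF H A] y L by blast
    qed
    show "H \<subseteq> range (\<lambda>w. base (A ** mat2 1 0 w 1))"
    proof
      fix y assume "y \<in> H"
      then obtain C where C: "C \<in> SL2" "base C = y" "column 2 C = column 2 A" using horosphere_spinor[OF H A] by blast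
      define D where "D = adjugate A ** C"
      have D: "D \<in> SL2" unfolding D_def by (intro SL2_mult adjugate_SL2 A C)
      have "column 2 D = column 2 (mat 1 :: complex^2^2)"
        unfolding D_def column_mult C(3) by (simp only: column_mult[symmetric] adjugate_mult[OF A(1)])
      then have "D $ 1 $ 2 = 0" "D $ 2 $ 2 = 1" by (simp_all add: vec_eq_iff forall_2 mat_def)
      then have "D = mat2 1 0 (D $ 2 $ 1) 1" using D by (simp add: mat2_eq_iff SL2_iff)
      moreover have "A ** D = C" unfolding D_def by (simp add: matrix_mul_assoc adjugate_mult[OF A(1)])
      ultimately show "y \<in> range (\<lambda>w. base (A ** mat2 1 0 w 1))" using C(2) by (metis rangeI)
    qed
  qed
  moreover have "connected (UNIV :: complex set)" by (simp add: convex_connected)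
  moreover have "continuous_on UNIV (base \<circ> (\<lambda>w. A ** mat2 1 0 w 1))"
    using L by (intro continuous_on_compose continuous_on_matrix_mult_2 continuous_intros continuous_on_subset[OF continuous_on_base]) auto
  ultimately show ?thesis
    using connected_continuous_image[of UNIV "base \<circ> (\<lambda>w. A ** mat2 1 0 w 1)"] by (simp add: o_def)
qed

text \<open>The spinor of a spin-decorated horosphere is the common second column of the
  matrices of its inward spin frames.\<close>

definition has_spinor :: "'e::real_normed_vector set \<Rightarrow> ('e \<Rightarrow> complex^2^2) \<Rightarrow> (real^3) set \<Rightarrow> 'e spin_decoration \<Rightarrow> complex^2 \<Rightarrow> bool"
  where "has_spinor E \<Phi> H W k \<longleftrightarrow>
    (\<forall>x\<in>H. fst W x \<in> E \<and> snd W x \<in> E \<and> base (\<Phi> (fst W x)) = x \<and> column 2 (\<Phi> (fst W x)) = k \<and>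
       \<Phi> (snd W x) = \<Phi> (fst W x) ** rot2 (- pi)) \<and>
    (\<forall>C\<in>SL2. column 2 C = k \<longrightarrow> base C \<in> H)"

text \<open>Let \<open>A x\<close> be the matrix of the inward spin frame at \<open>x\<close>. For points \<open>x\<close>, \<open>y\<close>
  of the horosphere there is a matrix \<open>P\<close> that fixes the second column of \<open>A x\<close> and moves
  \<open>x\<close> to \<open>y\<close>. Unless it is the identity it acts by a parabolic isometry preserving the
  horosphere, so it maps the decoration at \<open>x\<close> to the decoration at \<open>y\<close>. Hence \<open>P ** A x\<close>
  and \<open>A y\<close> have the same frame and differ at most by a sign. The second column is
  therefore constant up to sign, and constant by continuity.\<close>

lemma spinor_of_decoration:
  assumes chart: "spin_chart E \<pi> \<Phi>" and dec: "spin_decorated_horosphere E \<pi> \<zeta> H W"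
  shows "\<exists>k. k \<noteq> 0 \<and> ideal_of k = \<zeta> \<and> has_spinor E \<Phi> H W k"
proof -
  note \<Phi> = spin_chartD(4,5,2)[OF chart]
  obtain v where H: "horosphere \<zeta> H" and v: "decoration \<zeta> H v" and Win: "lift_along E \<pi> H (frame_in \<zeta> v) (fst W)"
    and Wout: "lift_along E \<pi> H (frame_out \<zeta> v) (snd W)"
    and rot: "\<And>x. x \<in> H \<Longrightarrow> spin_rotation E \<pi> (v x) (- pi) (fst W x) (snd W x)"
    using dec by (auto simp: spin_decorated_horosphere_def)
  define A where "A x = \<Phi> (fst W x)" for x
  have E: "fst W x \<in> E" "snd W x \<in> E" if "x \<in> H" for x using Win Wout that by (auto simp: lift_along_def)
  have A: "A x \<in> SL2" "base (A x) = x" "axis1 (A x) = normal_in \<zeta> x" "axis2 (A x) = v x" if "x \<in> H" for x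
  proof -
    show "A x \<in> SL2" using \<Phi>(1) E that by (simp add: A_def)
    have "spin_proj (A x) = frame_in \<zeta> v x" using \<Phi>(2) E Win that by (simp add: A_def lift_along_def)
    then show "base (A x) = x" "axis1 (A x) = normal_in \<zeta> x" "axis2 (A x) = v x" by (simp_all add: spin_proj_def frame_in_def)
  qed
  have center: "ideal_of (column 2 (A x)) = \<zeta>" if "x \<in> H" for x
    using center_of_axis1 A that by metis
  have pm: "column 2 (A y) = column 2 (A x) \<or> column 2 (A y) = - column 2 (A x)" if x: "x \<in> H" and y: "y \<in> H" for x y
  proof -
    have "base (A x) \<in> H" using A x by simp
    then obtain C where C: "C \<in> SL2" "base C = y" "column 2 C = column 2 (A x)"
      using horosphere_spinor[OF H A(1)[OF x] _ center[OF x], of y] y by auto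
    define P where "P = C ** adjugate (A x)"
    have P: "P \<in> SL2" unfolding P_def by (intro SL2_mult adjugate_SL2 A x C)
    have PA: "P ** A x = C" unfolding P_def by (simp add: matrix_mul_assoc[symmetric] adjugate_mult[OF A(1)[OF x]])
    then have Pk: "P *v column 2 (A x) = column 2 (A x)" using C(3) by (simp add: column_mult[symmetric])
    obtain \<phi> where \<phi>: "realizes \<phi> P" using SL2_realized[OF P] by blast
    have ax2: "axis2 C = v y"
    proof (cases "P = mat 1")
      case True
      then show ?thesis using PA C(2) A[OF x] by simp
    next
      case False
      have "parabolic_isometry \<phi>" "\<phi> ` H = H"
        using parabolic_of_fixed_spinor[OF P False Pk column_nonzero[OF A(1)[OF x]] \<phi>] H center[OF x] by simp_all
      then have "frechet_derivative \<phi> (at x) (v x) = v (\<phi> x)" using v x by (auto simp: decoration_def)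
      moreover have "spin_proj C = push_frame \<phi> (spin_proj (A x))" using \<phi> A(1)[OF x] PA by (auto simp: realizes_def)
      ultimately show ?thesis using A[OF x] C(2) by (simp add: spin_proj_def)
    qed
    have ax1: "axis1 C = axis1 (A y)"
      using normal_out_base[OF C(1)] C(2,3) center[OF x] A(3)[OF y] by (simp add: normal_in_def)
    \<comment> \<open>The third vectors agree as cross products of the first two.\<close>
    have "spin_proj (A y) = spin_proj C"
      using axis_cross(1)[OF C(1)] axis_cross(1)[OF A(1)[OF y]] ax1 ax2 C(2) A[OF y] by (simp add: spin_proj_def)
    then have "A y = C \<or> A y = - C" using spin_proj_eq_iff[OF A(1)[OF y] C(1)] by simp
    then show ?thesis using C(3) by (auto simp: vec_eq_iff)
  qed
  obtain x0 where x0: "x0 \<in> H" using horosphere_nonempty[OF H] by blast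
  define k where "k = column 2 (A x0)"
  have "continuous_on H (\<lambda>x. A x)"
    using continuous_on_compose[of H "fst W" \<Phi>] Win \<Phi>(3) continuous_on_subset[of E \<Phi> "fst W ` H"]
    unfolding A_def lift_along_def by (auto simp: o_def)
  then have cont: "continuous_on H (\<lambda>x. A x $ i $ 2)" for i
    by (intro continuous_intros)
  have conn: "connected H" using horosphere_connected[OF H A(1)[OF x0] _ center[OF x0]] A(2)[OF x0] x0 by simp
  have "A x $ i $ 2 = k $ i" if x: "x \<in> H" for x i
  proof -
    have "column 2 (A y) = k \<or> column 2 (A y) = - k" if "y \<in> H" for y using pm[OF x0 that] by (simp add: k_def)
    then have "(\<lambda>x. A x $ i $ 2) ` H \<subseteq> {k $ i, - k $ i}"
      by (auto simp: vec_eq_iff)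
    then have "finite ((\<lambda>x. A x $ i $ 2) ` H)" by (rule finite_subset) simp
    then have "(\<lambda>x. A x $ i $ 2) constant_on H" using continuous_finite_range_constant[OF conn cont] by simp
    then show ?thesis using x x0 by (auto simp: constant_on_def k_def)
  qed
  then have const: "column 2 (A x) = k" if "x \<in> H" for x using that by (simp add: vec_eq_iff)
  have "base C \<in> H" if "C \<in> SL2" "column 2 C = k" for C
    using horosphere_spinor[OF H A(1)[OF x0] _ center[OF x0], of "base C"] A(2)[OF x0] x0 that by (auto simp: k_def)
  moreover have "\<Phi> (snd W x) = \<Phi> (fst W x) ** rot2 (- pi)" if x: "x \<in> H" for x
    using rot[OF x] A(4)[OF x] spin_rotation_axis(2)[OF chart E(1)[OF x]] by (simp add: A_def)
  ultimately have "has_spinor E \<Phi> H W k"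
    unfolding has_spinor_def using E A(2) const by (auto simp: A_def)
  moreover have "k \<noteq> 0" "ideal_of k = \<zeta>" using column_nonzero A(1) center x0 by (auto simp: k_def)
  ultimately show ?thesis by blast
qed

section \<open>Complex lambda lengths as determinants\<close>

lemma rot2_pi: "rot2 pi = mat2 0 \<i> \<i> 0" "rot2 (- pi) = mat2 0 (- \<i>) (- \<i>) 0"
  by (simp_all add: rot2_def)

text \<open>Let \<open>A\<close> and \<open>B\<close> be the matrices of the inward frames at the ends \<open>p1\<close>, \<open>p2\<close> of
  the segment. The outward frame at \<open>p2\<close> has the matrix \<open>B ** rot2 (- pi)\<close>, whose first
  column is \<open>-\<i>\<close> times the second column \<open>k2\<close> of \<open>B\<close>. If the complex distance is \<open>w\<close>, then
  \<open>A ** screw w\<close> is that matrix, and comparing first columns shows that \<open>exp (w / 2)\<close>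
  times the first column of \<open>A\<close> is \<open>-\<i> * k2\<close>. Taking the determinant with the second
  column \<open>k1\<close> of \<open>A\<close> gives the value. Conversely a suitable matrix \<open>A\<close> with second column
  \<open>k1\<close> yields such a configuration, so the value is attained.\<close>

lemma lambda_length_spinors:
  assumes chart: "spin_chart E \<pi> \<Phi>"
    and k: "k1 \<noteq> 0" "has_spinor E \<Phi> H1 W1 k1" and l: "k2 \<noteq> 0" "has_spinor E \<Phi> H2 W2 k2"
    and ne: "ideal_of k1 \<noteq> ideal_of k2"
  shows "lambda_length E \<pi> (ideal_of k1) H1 W1 (ideal_of k2) H2 W2 = \<i> * spinor_det k1 k2"
  unfolding lambda_length_def
proof (rule the_equality)
  let ?P = "\<lambda>m. \<exists>\<gamma> p1 p2 d. geodesic_from_to \<gamma> (ideal_of k1) (ideal_of k2) \<and> p1 \<in> range \<gamma> \<inter> H1 \<and>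
      p2 \<in> range \<gamma> \<inter> H2 \<and> complex_distance E \<pi> \<gamma> (fst W1 p1) (snd W2 p2) d \<and> m = exp (d / 2)"
  note \<Phi> = spin_chartD(4)[OF chart]
  show "m = \<i> * spinor_det k1 k2" if "?P m" for m
  proof -
    from that obtain \<gamma> p1 p2 d where *: "geodesic_from_to \<gamma> (ideal_of k1) (ideal_of k2)" "p1 \<in> H1" "p2 \<in> H2"
      "complex_distance E \<pi> \<gamma> (fst W1 p1) (snd W2 p2) d" "m = exp (d / 2)" by blast
    define A where "A = \<Phi> (fst W1 p1)"
    have A: "A \<in> SL2" "column 2 A = k1" using k(2) *(2) \<Phi> by (auto simp: has_spinor_def A_def)
    define B where "B = \<Phi> (fst W2 p2)"
    have B: "column 2 B = k2" "\<Phi> (snd W2 p2) = B ** rot2 (- pi)" using l(2) *(3) by (auto simp: has_spinor_def B_def)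
    have "A ** screw d = B ** rot2 (- pi)"
      using complex_distanceD[OF chart *(1) ne *(4)] B(2) by (simp add: A_def)
    then have "(A ** screw d) $ i $ 1 = (B ** rot2 (- pi)) $ i $ 1" for i by simp
    then have "A $ i $ 1 * m = - \<i> * k2 $ i" for i
      using arg_cong[OF B(1), of "\<lambda>v. v $ i"] by (simp add: screw_def rot2_pi *(5) mult.commute)
    note m = this
    have "A $ 1 $ 1 * k1 $ 2 - k1 $ 1 * A $ 2 $ 1 = 1"
      using A by (auto simp: SL2_iff)
    then have "m = (A $ 1 $ 1 * m) * k1 $ 2 - k1 $ 1 * (A $ 2 $ 1 * m)"
      by (metis (no_types, lifting) left_diff_distrib mult.assoc mult.commute mult_1)
    then show "m = \<i> * spinor_det k1 k2"
      unfolding m by (simp add: spinor_det_def algebra_simps)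
  qed
  \<comment> \<open>For existence, \<open>C\<close> and \<open>C'\<close> are the matrices of the inward frame of
    the first and of the outward frame of the second horosphere, and \<open>D\<close> is that of the
    inward frame at the same point.\<close>
  let ?l = "\<i> * spinor_det k1 k2"
  have det: "spinor_det k1 k2 \<noteq> 0" using ideal_of_eq_iff[OF k(1) l(1)] ne by simp
  define w where "w = 2 * Ln ?l"
  have w: "exp (w / 2) = ?l" using det by (simp add: w_def)
  define C where "C = of_columns ((- \<i> / ?l) *s k2) k1"
  have "spinor_det k2 k1 = - spinor_det k1 k2" by (simp add: spinor_det_def algebra_simps)
  then have "spinor_det ((- \<i> / ?l) *s k2) k1 = 1" using det unfolding spinor_det_scale by simp
  then have C: "C \<in> SL2" "column 2 C = k1" by (simp_all only: C_def SL2_column_det column_of_columns)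
  define C' where "C' = C ** screw w"
  have C': "C' \<in> SL2" using C by (simp add: C'_def SL2_mult)
  have C'1: "column 1 C' = - \<i> *s k2" using det by (simp add: C'_def C_def of_columns_def screw_def w vec_eq_iff forall_2)
  define D where "D = C' ** rot2 pi"
  have D: "D \<in> SL2" using C' by (simp add: D_def SL2_mult)
  have "column 2 D = \<i> *s column 1 C'" by (simp add: D_def rot2_pi vec_eq_iff)
  then have D2: "column 2 D = k2" by (simp add: C'1 vec_eq_iff)
  define x y where "x = base C" and "y = base D"
  have xy: "x \<in> H1" "y \<in> H2" using k(2) l(2) C D D2 by (auto simp: has_spinor_def x_def y_def)
  have fx: "\<Phi> (fst W1 x) = C" "fst W1 x \<in> E"
    using SL2_eqI_column[OF \<Phi> C(1)] k(2) xy(1) C(2) by (auto simp: has_spinor_def x_def)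
  have "\<Phi> (fst W2 y) = D"
    using SL2_eqI_column[OF \<Phi> D] l(2) xy(2) D2 by (auto simp: has_spinor_def y_def)
  then have "\<Phi> (snd W2 y) = C' ** (rot2 pi ** rot2 (- pi))" and sE: "snd W2 y \<in> E"
    using l(2) xy(2) by (auto simp: has_spinor_def D_def matrix_mul_assoc)
  moreover have "rot2 pi ** rot2 (- pi) = mat 1" by (simp add: rot2_pi mat2_eq_iff mat_def)
  ultimately have sy: "\<Phi> (snd W2 y) = C ** screw w" by (simp add: C'_def)
  let ?\<gamma> = "\<lambda>r. base (C ** screw (of_real r))"
  have "complex_distance E \<pi> ?\<gamma> (fst W1 x) (snd W2 y) w"
    using complex_distanceI[OF chart fx(2) sE] sy fx(1) by simp
  moreover have "geodesic_from_to ?\<gamma> (ideal_of k1) (ideal_of k2)"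
  proof -
    have "column 1 C = (- \<i> / ?l) *s k2" by (simp add: C_def)
    then have "ideal_of (column 1 C) = ideal_of k2" using det by (simp only:) (rule ideal_of_scale, simp)
    then show ?thesis using geodesic_screw(1)[OF C(1)] C(2) by simp
  qed
  moreover have "x = ?\<gamma> 0" by (simp add: x_def)
  then have "x \<in> range ?\<gamma> \<inter> H1" using xy by blast
  moreover have "y = ?\<gamma> (Re w)"
  proof -
    have "y = base C'" unfolding y_def D_def
      by (rule base_unitary(1)[OF C' rot_SL2(2)]; simp add: rot2_pi)
    also have "C' = C ** screw (of_real (Re w)) ** rot1 (Im w)"
    proof -
      have "of_real (Re w) + \<i> * of_real (Im w) = w" by (simp flip: complex_eq)
      then show ?thesis by (simp add: C'_def rot1_screw matrix_mul_assoc[symmetric] screw_mult)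
    qed
    also have "base \<dots> = base (C ** screw (of_real (Re w)))"
      by (rule axis1_rot1(2)) (simp add: SL2_mult C(1))
    finally show ?thesis .
  qed
  then have "y \<in> range ?\<gamma> \<inter> H2" using xy by blast
  ultimately show "?P ?l"
    using w by (intro exI[of _ ?\<gamma>] exI[of _ x] exI[of _ y] exI[of _ w]) simp
qed

section \<open>Shape parameters as cross ratios\<close>

text \<open>The image of the ideal point of \<open>d\<close> under the Moebius transformation that
  takes \<open>a\<close>, \<open>b\<close>, \<open>c\<close> to \<open>0\<close>, \<open>Infty\<close>, \<open>1\<close>.\<close>

definition spinor_cross_ratio :: "complex^2 \<Rightarrow> complex^2 \<Rightarrow> complex^2 \<Rightarrow> complex^2 \<Rightarrow> complex"
  where "spinor_cross_ratio a b c d =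
    (spinor_det a d * spinor_det b c) / (spinor_det a c * spinor_det b d)"

lemma normalizing_matrix:
  assumes "spinor_det a b \<noteq> 0" "spinor_det a c \<noteq> 0" "spinor_det b c \<noteq> 0"
  shows "\<exists>B\<in>SL2. ideal_of (B *v a) = Fin 0 \<and> ideal_of (B *v b) = Infty \<and> ideal_of (B *v c) = Fin 1 \<and>
    (\<forall>d. ideal_of (B *v d) = (if spinor_det b d = 0 then Infty else Fin (spinor_cross_ratio a b c d)))"
proof -
  \<comment> \<open>The rows of the matrix are multiples of the linear forms
    \<open>spinor_det a\<close> and \<open>spinor_det b\<close>, which vanish at \<open>a\<close> and at \<open>b\<close>. The factors \<open>p\<close>,
    \<open>q\<close> make the forms agree at \<open>c\<close>, and \<open>s\<close> makes the determinant \<open>1\<close>.\<close>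
  define s where "s = csqrt (1 / (spinor_det a b * spinor_det a c * spinor_det b c))"
  define p where "p = s * spinor_det b c"
  define q where "q = s * spinor_det a c"
  have s2: "s * s = 1 / (spinor_det a b * spinor_det a c * spinor_det b c)"
    using power2_csqrt by (simp add: s_def flip: power2_eq_square)
  have nz: "s \<noteq> 0" "p \<noteq> 0" "q \<noteq> 0" using assms by (auto simp: s_def p_def q_def)
  define B where "B = mat2 (- p * a $ 2) (p * a $ 1) (- q * b $ 2) (q * b $ 1)"
  have Bk: "(B *v k) $ 1 = p * spinor_det a k" "(B *v k) $ 2 = q * spinor_det b k" for k
    by (simp_all add: B_def spinor_det_def algebra_simps)
  have "- p * a $ 2 * (q * b $ 1) - p * a $ 1 * (- q * b $ 2) = (s * s) * (spinor_det b c * spinor_det a c * spinor_det a b)"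
    by (simp add: p_def q_def spinor_det_def algebra_simps)
  also have "\<dots> = 1" unfolding s2 using assms by simp
  finally have B: "B \<in> SL2" by (simp add: B_def)
  have self: "spinor_det a a = 0" "spinor_det b b = 0" by (simp_all add: spinor_det_def)
  have ba: "spinor_det b a \<noteq> 0" using assms(1) by (simp add: spinor_det_def algebra_simps)
  have gen: "ideal_of (B *v d) = (if spinor_det b d = 0 then Infty else Fin (spinor_cross_ratio a b c d))" for d
  proof -
    have "p * spinor_det a d / (q * spinor_det b d) = spinor_cross_ratio a b c d"
      unfolding p_def q_def spinor_cross_ratio_def using nz(1) by (simp add: mult.commute)
    then show ?thesis using nz unfolding ideal_of_def Bk by simp
  qed
  show ?thesis
    using B gen gen[of a] gen[of b] gen[of c] ba self assms by (intro bexI[of _ B]) (auto simp: spinor_cross_ratio_def)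
qed

lemma ideal_maps_to_fixing:
  assumes "\<And>x. x \<in> upper_half_space \<Longrightarrow> \<phi> x = x" shows "ideal_maps_to \<phi> \<zeta> \<zeta>"
proof -
  have "filterlim (\<lambda>x. x) (ideal_nhds \<zeta>) (ideal_nhds \<zeta>)" by (rule filterlim_ident)
  moreover from filterlim_ideal_uhs[OF this]
  have "eventually (\<lambda>x. \<phi> x = x) (ideal_nhds \<zeta>)" by (rule eventually_mono) (rule assms)
  ultimately show ?thesis unfolding ideal_maps_to_def
    using filterlim_cong[of "ideal_nhds \<zeta>" "ideal_nhds \<zeta>" "ideal_nhds \<zeta>" "ideal_nhds \<zeta>" \<phi> "\<lambda>x. x"] by simp
qed

lemma distinct_ideal_images:
  assumes "ideal_maps_to \<phi> (ideal_of k) \<zeta>" "ideal_maps_to \<phi> (ideal_of l) \<eta>" "\<zeta> \<noteq> \<eta>" "k \<noteq> 0" "l \<noteq> 0"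
  shows "spinor_det k l \<noteq> 0"
  using assms ideal_maps_to_unique ideal_of_eq_iff by metis

text \<open>Precomposing \<open>\<phi>\<close> with the inverse of a normalizing matrix gives an
  orientation-preserving isometry that fixes \<open>0\<close>, \<open>1\<close>, \<open>Infty\<close>, hence the identity. So \<open>\<phi>\<close>
  sends the fourth point where the normalizing matrix sends it.\<close>

lemma cross_ratio_of_isometry:
  assumes op: "op_isometry \<phi>" and nz: "a \<noteq> 0" "b \<noteq> 0" "c \<noteq> 0" "d \<noteq> 0"
    and maps: "ideal_maps_to \<phi> (ideal_of a) (Fin 0)" "ideal_maps_to \<phi> (ideal_of b) Infty"
      "ideal_maps_to \<phi> (ideal_of c) (Fin 1)" "ideal_maps_to \<phi> (ideal_of d) (Fin w)"
  shows "w = spinor_cross_ratio a b c d"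
proof -
  have det: "spinor_det a b \<noteq> 0" "spinor_det a c \<noteq> 0" "spinor_det b c \<noteq> 0"
    by (rule distinct_ideal_images[OF maps(1,2)] distinct_ideal_images[OF maps(1,3)] distinct_ideal_images[OF maps(2,3)]; use nz in simp)+
  obtain B where B: "B \<in> SL2" "ideal_of (B *v a) = Fin 0" "ideal_of (B *v b) = Infty" "ideal_of (B *v c) = Fin 1"
    "ideal_of (B *v d) = (if spinor_det b d = 0 then Infty else Fin (spinor_cross_ratio a b c d))"
    using normalizing_matrix[OF det] by blast
  obtain \<psi> where \<psi>: "realizes \<psi> (adjugate B)" using SL2_realized adjugate_SL2 B(1) by blast
  have undo: "ideal_maps_to \<psi> (ideal_of (B *v k)) (ideal_of k)" if "k \<noteq> 0" for k
  proof -
    have "adjugate B *v (B *v k) = k" by (simp add: matrix_vector_mul_assoc adjugate_mult[OF B(1)])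
    then show ?thesis using \<psi> SL2_vec_nonzero[OF B(1) that] unfolding realizes_def by metis
  qed
  have comp: "op_isometry (\<phi> \<circ> \<psi>)" using op \<psi> by (intro op_isometry_comp) (auto simp: realizes_def)
  have "(\<phi> \<circ> \<psi>) x = x" if "x \<in> upper_half_space" for x
    using op_isometry_fixing_three[OF comp _ _ _ that] ideal_maps_to_comp[OF undo maps(1)]
      ideal_maps_to_comp[OF undo maps(2)] ideal_maps_to_comp[OF undo maps(3)] nz B(2-4) by auto
  then have "ideal_maps_to (\<phi> \<circ> \<psi>) (ideal_of (B *v d)) (ideal_of (B *v d))" by (rule ideal_maps_to_fixing)
  moreover have "ideal_maps_to (\<phi> \<circ> \<psi>) (ideal_of (B *v d)) (Fin w)" using ideal_maps_to_comp[OF undo maps(4)] nz by simp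
  ultimately have "ideal_of (B *v d) = Fin w" by (rule ideal_maps_to_unique)
  then show ?thesis using B(5) by (auto split: if_splits)
qed

lemma cross_ratio_realized:
  assumes nz: "a \<noteq> 0" "b \<noteq> 0" "c \<noteq> 0" "d \<noteq> 0"
    and det: "spinor_det a b \<noteq> 0" "spinor_det a c \<noteq> 0" "spinor_det b c \<noteq> 0" "spinor_det b d \<noteq> 0"
  shows "\<exists>\<phi>. op_isometry \<phi> \<and> ideal_maps_to \<phi> (ideal_of a) (Fin 0) \<and> ideal_maps_to \<phi> (ideal_of b) Infty \<and>
    ideal_maps_to \<phi> (ideal_of c) (Fin 1) \<and> ideal_maps_to \<phi> (ideal_of d) (Fin (spinor_cross_ratio a b c d))"
proof -
  obtain B where B: "B \<in> SL2" "ideal_of (B *v a) = Fin 0" "ideal_of (B *v b) = Infty" "ideal_of (B *v c) = Fin 1"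
    "ideal_of (B *v d) = Fin (spinor_cross_ratio a b c d)"
    using normalizing_matrix[OF det(1-3)] det(4) by metis
  obtain \<phi> where "realizes \<phi> B" using SL2_realized B(1) by blast
  then show ?thesis using B(2-5) nz unfolding realizes_def by metis
qed

lemma spinor_det_swap: "spinor_det l k = - spinor_det k l"
  by (simp add: spinor_det_def)

lemma spinor_cross_ratio_swap:
  "spinor_cross_ratio b a c d = 1 / spinor_cross_ratio a b c d"
  "spinor_cross_ratio a b d c = 1 / spinor_cross_ratio a b c d"
  "spinor_cross_ratio b a d c = spinor_cross_ratio a b c d"
  by (simp_all add: spinor_cross_ratio_def mult.commute)

lemma Im_reciprocal: "Im (1 / z) = - Im z / (cmod z)\<^sup>2"
  by (simp add: Im_divide cmod_power2)

text \<open>Exchanging the end points of the edge, or the other two vertices, inverts the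
  cross ratio and so moves it to the lower half plane. This makes the shape parameter well
  defined.\<close>

lemma shape_parameter_spinors:
  assumes nz: "a \<noteq> 0" "b \<noteq> 0" "c \<noteq> 0" "d \<noteq> 0"
    and det: "spinor_det a b \<noteq> 0" "spinor_det a c \<noteq> 0" "spinor_det a d \<noteq> 0" "spinor_det b c \<noteq> 0" "spinor_det b d \<noteq> 0"
    and Im: "Im (spinor_cross_ratio a b c d) > 0"
    and \<Delta>: "\<Delta> = {ideal_of a, ideal_of b, ideal_of c, ideal_of d}"
  shows "shape_parameter \<Delta> {ideal_of a, ideal_of b} = spinor_cross_ratio a b c d"
  unfolding shape_parameter_def
proof (rule the_equality)
  let ?e = "{ideal_of a, ideal_of b}"
  let ?P = "\<lambda>z. Im z > 0 \<and> (\<exists>\<phi> a' b' c' d'. op_isometry \<phi> \<and> ?e = {a', b'} \<and> \<Delta> - ?e = {c', d'} \<and>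
       ideal_maps_to \<phi> a' (Fin 0) \<and> ideal_maps_to \<phi> b' Infty \<and>
       ideal_maps_to \<phi> c' (Fin 1) \<and> ideal_maps_to \<phi> d' (Fin z))"
  have "ideal_of c \<notin> ?e" "ideal_of d \<notin> ?e"
    using det nz by (auto simp: ideal_of_eq_iff spinor_det_swap[of c] spinor_det_swap[of d])
  then have opp: "\<Delta> - ?e = {ideal_of c, ideal_of d}" by (auto simp: \<Delta>)
  show "?P (spinor_cross_ratio a b c d)"
    using cross_ratio_realized[OF nz det(1,2,4,5)] Im opp by blast
  fix z assume z: "?P z"
  then obtain \<phi> a' b' c' d' where *: "op_isometry \<phi>" "?e = {a', b'}" "{ideal_of c, ideal_of d} = {c', d'}"
       "ideal_maps_to \<phi> a' (Fin 0)" "ideal_maps_to \<phi> b' Infty" "ideal_maps_to \<phi> c' (Fin 1)" "ideal_maps_to \<phi> d' (Fin z)"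
    unfolding opp by blast
  have cr: "z = spinor_cross_ratio k l m n"
    if "k \<noteq> 0" "l \<noteq> 0" "m \<noteq> 0" "n \<noteq> 0" "a' = ideal_of k" "b' = ideal_of l" "c' = ideal_of m" "d' = ideal_of n" for k l m n
    by (rule cross_ratio_of_isometry[OF *(1) that(1-4)]) (use *(4-7) that in simp_all)
  have "a' = ideal_of a \<and> b' = ideal_of b \<or> a' = ideal_of b \<and> b' = ideal_of a"
    "c' = ideal_of c \<and> d' = ideal_of d \<or> c' = ideal_of d \<and> d' = ideal_of c"
    using *(2)[symmetric] *(3)[symmetric] unfolding doubleton_eq_iff .
  then have "z = spinor_cross_ratio a b c d \<or> z = spinor_cross_ratio b a c d \<or>
      z = spinor_cross_ratio a b d c \<or> z = spinor_cross_ratio b a d c"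
    using cr[OF nz] cr[OF nz(2,1,3,4)] cr[OF nz(1,2,4,3)] cr[OF nz(2,1,4,3)] by blast
  moreover have "\<not> Im (1 / spinor_cross_ratio a b c d) > 0"
    unfolding Im_reciprocal using Im by (simp add: not_less divide_nonpos_nonneg)
  ultimately show "z = spinor_cross_ratio a b c d"
    using conjunct1[OF z] spinor_cross_ratio_swap[where a=a and b=b and c=c and d=d] by metis
qed

section \<open>Shape parameters from lambda lengths\<close>

text \<open>Substituting \<open>\<i> * D i j\<close> for the lambda lengths and cross ratios of spinors
  for the shape parameters leaves an identity between quotients of determinants \<open>D i j\<close>.
  The order in which the two vertices off the edge enter the cross ratio must be the one
  with positive imaginary part. The given ordering of the vertices provides it for the
  edge \<open>01\<close>, where the cross ratio is \<open>w\<close>; by the Pluecker relation the other two values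
  are \<open>1 / (1 - w)\<close> and \<open>1 - 1 / w\<close>, which lie in the upper half plane together with \<open>w\<close>.\<close>

theorem proposition5p3:
  fixes E :: "'e::real_normed_vector set" and \<pi> :: "'e \<Rightarrow> frame"
    and vertex :: "nat \<Rightarrow> ideal_point"
    and H :: "nat \<Rightarrow> (real^3) set" and W :: "nat \<Rightarrow> 'e spin_decoration"
    and z lam :: "nat \<Rightarrow> nat \<Rightarrow> complex"
  assumes spin: "spin_frame_bundle E \<pi>"
    and tetrahedron: "\<exists>\<phi> w. op_isometry \<phi> \<and> Im w > 0 \<and>
      ideal_maps_to \<phi> (vertex 0) (Fin 0) \<and> ideal_maps_to \<phi> (vertex 1) Infty \<and>
      ideal_maps_to \<phi> (vertex 2) (Fin w) \<and> ideal_maps_to \<phi> (vertex 3) (Fin 1)"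
    and horospheres: "\<And>i. i < 4 \<Longrightarrow> spin_decorated_horosphere E \<pi> (vertex i) (H i) (W i)"
    and z: "\<And>i j. z i j = shape_parameter (vertex ` {..<4}) {vertex i, vertex j}"
    and lambda: "\<And>i j. lam i j = lambda_length E \<pi> (vertex i) (H i) (W i) (vertex j) (H j) (W j)"
  shows "z 0 1 = z 2 3 \<and> z 2 3 = (lam 0 2 * lam 1 3) / (lam 0 3 * lam 1 2) \<and>
    z 0 2 = z 1 3 \<and> z 1 3 = - ((lam 0 3 * lam 1 2) / (lam 0 1 * lam 2 3)) \<and>
    z 0 3 = z 1 2 \<and> z 1 2 = (lam 0 1 * lam 2 3) / (lam 0 2 * lam 1 3)"
proof -
  obtain \<Phi> where chart: "spin_chart E \<pi> \<Phi>" using spin_chart_exists[OF spin] by blast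
  have "\<exists>k. k \<noteq> 0 \<and> ideal_of k = vertex i \<and> has_spinor E \<Phi> (H i) (W i) k" if "i < 4" for i
    using spinor_of_decoration[OF chart horospheres[OF that]] .
  then obtain k where k: "\<And>i. i < 4 \<Longrightarrow> k i \<noteq> 0" "\<And>i. i < 4 \<Longrightarrow> ideal_of (k i) = vertex i"
      "\<And>i. i < 4 \<Longrightarrow> has_spinor E \<Phi> (H i) (W i) (k i)"
    by metis
  obtain \<phi> w where \<phi>: "op_isometry \<phi>" "Im w > 0" "ideal_maps_to \<phi> (ideal_of (k 0)) (Fin 0)" "ideal_maps_to \<phi> (ideal_of (k 1)) Infty"
      "ideal_maps_to \<phi> (ideal_of (k 2)) (Fin w)" "ideal_maps_to \<phi> (ideal_of (k 3)) (Fin 1)"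
    using tetrahedron k(2) by auto
  define D where "D i j = spinor_det (k i) (k j)" for i j
  have Dsym: "D j i = - D i j" for i j unfolding D_def by (rule spinor_det_swap)
  have w01: "w \<noteq> 0" "w \<noteq> 1" using \<phi>(2) by auto
  have D: "D 0 1 \<noteq> 0" "D 0 2 \<noteq> 0" "D 0 3 \<noteq> 0" "D 1 2 \<noteq> 0" "D 1 3 \<noteq> 0" "D 2 3 \<noteq> 0"
    unfolding D_def
    by (rule distinct_ideal_images[OF \<phi>(3,4)] distinct_ideal_images[OF \<phi>(3,5)] distinct_ideal_images[OF \<phi>(3,6)]
        distinct_ideal_images[OF \<phi>(4,5)] distinct_ideal_images[OF \<phi>(4,6)] distinct_ideal_images[OF \<phi>(5,6)];
        use w01 k(1) in force)+
  have D': "D j i \<noteq> 0" if "D i j \<noteq> 0" for i j using that Dsym[of j i] by simp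
  have cr: "spinor_cross_ratio (k a) (k b) (k c) (k d) = (D a d * D b c) / (D a c * D b d)" for a b c d
    by (simp add: spinor_cross_ratio_def D_def)
  have w: "w = (D 0 2 * D 1 3) / (D 0 3 * D 1 2)"
    using cross_ratio_of_isometry[OF \<phi>(1) _ _ _ _ \<phi>(3,4,6,5)] k(1) by (simp add: cr)
  have plucker: "D 0 1 * D 2 3 = D 0 2 * D 1 3 - D 0 3 * D 1 2"
    by (simp add: D_def spinor_det_def algebra_simps)
  have D02: "D 0 2 * D 1 3 = w * (D 0 3 * D 1 2)" using D by (simp add: w)
  have D01: "D 0 1 * D 2 3 = (w - 1) * (D 0 3 * D 1 2)"
    unfolding plucker D02 by (simp add: algebra_simps)
  have w2: "- ((D 0 3 * D 1 2) / (D 0 1 * D 2 3)) = 1 / (1 - w)"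
    unfolding D01 using D w01 by (simp add: field_simps)
  have w3: "(D 0 1 * D 2 3) / (D 0 2 * D 1 3) = 1 - 1 / w"
    unfolding D01 D02 using D w01 by (simp add: field_simps)
  have Im2: "Im (1 / (1 - w)) > 0"
    unfolding Im_reciprocal using \<phi>(2) w01 by (intro divide_pos_pos) auto
  have "Im (1 / w) < 0"
    unfolding Im_reciprocal using \<phi>(2) w01 by (intro divide_neg_pos) auto
  then have Im3: "Im (1 - 1 / w) > 0" by simp
  have shape: "z a b = (D a d * D b c) / (D a c * D b d)"
    if abcd: "{a, b, c, d} = {0, 1, 2, 3}"
      and nz: "D a b \<noteq> 0" "D a c \<noteq> 0" "D a d \<noteq> 0" "D b c \<noteq> 0" "D b d \<noteq> 0"
      and Im: "Im ((D a d * D b c) / (D a c * D b d)) > 0" for a b c d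
  proof -
    have "i < 4" if "i \<in> {a, b, c, d}" for i using that unfolding abcd by auto
    then have lt: "a < 4" "b < 4" "c < 4" "d < 4" by simp_all
    have "{..<4} = {a, b, c, d}" unfolding abcd by auto
    then have \<Delta>: "vertex ` {..<4} = {ideal_of (k a), ideal_of (k b), ideal_of (k c), ideal_of (k d)}"
      using k(2) lt by simp
    have "shape_parameter (vertex ` {..<4}) {ideal_of (k a), ideal_of (k b)} = spinor_cross_ratio (k a) (k b) (k c) (k d)"
      by (rule shape_parameter_spinors[OF k(1)[OF lt(1)] k(1)[OF lt(2)] k(1)[OF lt(3)] k(1)[OF lt(4)]
            nz[unfolded D_def] Im[folded cr] \<Delta>])
    then show ?thesis using k(2) lt by (simp add: z cr)
  qed
  have lam: "lam i j = \<i> * D i j" if "i < 4" "j < 4" "D i j \<noteq> 0" for i j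
    using lambda_length_spinors[OF chart k(1)[OF that(1)] k(3)[OF that(1)] k(1)[OF that(2)] k(3)[OF that(2)]] that(3)
      ideal_of_eq_iff[OF k(1)[OF that(1)] k(1)[OF that(2)]] k(2)[OF that(1)] k(2)[OF that(2)] by (simp add: lambda D_def)
  have quotients: "(D 0 2 * D 1 3) / (D 0 3 * D 1 2) = w" "(D 2 0 * D 3 1) / (D 2 1 * D 3 0) = w"
    "(D 0 3 * D 2 1) / (D 0 1 * D 2 3) = 1 / (1 - w)" "(D 1 2 * D 3 0) / (D 1 0 * D 3 2) = 1 / (1 - w)"
    "(D 0 1 * D 3 2) / (D 0 2 * D 3 1) = 1 - 1 / w" "(D 1 0 * D 2 3) / (D 1 3 * D 2 0) = 1 - 1 / w"
    unfolding w2[symmetric] w3[symmetric] Dsym[of 2 0] Dsym[of 3 1] Dsym[of 2 1] Dsym[of 3 0] Dsym[of 1 0] Dsym[of 3 2]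
    by (simp_all add: w mult.commute)
  note Ds = D D[THEN D']
  have "z 0 1 = w" "z 2 3 = w" "z 0 2 = 1 / (1 - w)" "z 1 3 = 1 / (1 - w)" "z 0 3 = 1 - 1 / w" "z 1 2 = 1 - 1 / w"
    by (rule shape[of 0 1 3 2, unfolded quotients] shape[of 2 3 1 0, unfolded quotients] shape[of 0 2 1 3, unfolded quotients]
        shape[of 1 3 0 2, unfolded quotients] shape[of 0 3 2 1, unfolded quotients] shape[of 1 2 3 0, unfolded quotients];
        (rule Ds \<phi>(2) Im2 Im3 | blast))+
  moreover have "(lam 0 2 * lam 1 3) / (lam 0 3 * lam 1 2) = w" "- ((lam 0 3 * lam 1 2) / (lam 0 1 * lam 2 3)) = 1 / (1 - w)"
    "(lam 0 1 * lam 2 3) / (lam 0 2 * lam 1 3) = 1 - 1 / w"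
    using D by (simp_all add: lam w2[symmetric] w3[symmetric]) (simp add: w)
  ultimately show ?thesis by simp
qed

end
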